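(* Let $(H,W,\mu)$ be an abstract Wiener space and let $X_1,\dots,X_n$ be independent random variables defined on a probability space $(\Omega,\mathcal{F},\mathcal{P})$ and taking values in $(W,\mathcal{B}(W))$. Assume that for each $j\in\{1,\dots,n\}$ the law of $X_j$ is absolutely continuous with respect to $\mu$, and denote its density by $f_j$. Let $\alpha_1,\dots,\alpha_n\in[-1,1]$ satisfy $\sum_{j=1}^n\alpha_j^2=1$. Then the law of $\alpha_1X_1+\cdots+\alpha_nX_n$ is also absolutely continuous with respect to $\mu$, with density given by $$\Gamma(\alpha_1)f_1\diamond\cdots\diamond\Gamma(\alpha_n)f_n .$$
   Context: Abstract Wiener space $(H,W,\mu)$: $(H,\langle\cdot,\cdot\rangle_H)$ is a separable real Hilbert space continuously and densely embedded in the Banach space $(W,\|\cdot\|_W)$, and $\mu$ is a Gaussian probability measure on the Borel sets $\mathcal{B}(W)$ such that $\int_W e^{i\langle w,w^*\rangle}d\mu(w)=e^{-\frac12\|w^*\|_H^2}$ for all $w^*\in W^*$, where $W^*\subset H$ is the dual space of $W$ (dense in $H$) and $\langle\cdot,\cdot\rangle$ is the dual pairing between $W$ and $W^*$. For $p\ge1$, $\mathcal{L}^p(W,\mu)$ is the space of real-valued $f$ with $\|f\|_p=(\int_W|f|^pd\mu)^{1/p}<\infty$. The map $w^*\mapsto\langle\cdot,w^*\rangle$ is an isometry from $W^*$ (with the $H$-norm) into $\mathcal{L}^2(W,\mu)$; for $\mathfrak{h}\in H$, $\delta(\mathfrak{h})\in\mathcal{L}^2(W,\mu)$ denotes the image of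 $\mathfrak{h}$ under its continuous extension to $H$. Set $\mathcal{E}(\mathfrak{h})=\exp\{\delta(\mathfrak{h})-\frac12\|\mathfrak{h}\|_H^2\}$; the linear span of the $\mathcal{E}(\mathfrak{h})$, $\mathfrak{h}\in H$, is dense in every $\mathcal{L}^p(W,\mu)$, $1\le p<\infty$. Operator $\Gamma(\lambda)$, $|\lambda|\le1$: on $\mathcal{L}^2(W,\mu)$ it multiplies the $n$-th Wiener chaos component of a function by $\lambda^n$ for each $n\ge0$ (the $n$-th Wiener chaos is the space of $n$-fold multiple Wiener–Itô integrals $\delta^n(\mathfrak{h}_n)$ with $\mathfrak{h}_n$ in the symmetric tensor power $H^{\hat\otimes n}$). It extends to a continuous linear operator on $\mathcal{L}^p(W,\mu)$ for every $p\ge1$, equals the Ornstein–Uhlenbeck operator $(\Gamma(\lambda)f)(w)=\int_Wf(\lambda w+\sqrt{1-\lambda^2}\,\tilde w)\,d\mu(\tilde w)$, and satisfies $\Gamma(\lambda)\mathcal{E}(\mathfrak{h})=\mathcal{E}(\lambda\mathfrak{h})$. Wick product: $\mathcal{E}(\mathfrak{h})\diamond\mathcal{E}(\mathfrak{k}):=\mathcal{E}(\mathfrak{h}+\mathfrak{k})$ for $\mathfrak{h},\mathfrak{k}\in H$, extended bilinearly to the linear span of the $\mathcal{E}(\mathfrak{h})$; it is commutative, associative and distributive. For $p\ge 1$ and $\alpha^2+\beta^2\le1$ one has the known inequality $\|\Gamma(\alpha)f\diamond\Gamma(\beta)g\|_p\le\|f\|_p\|g\|_p$. Hence, when $\sum_j\alpha_j^2\le1$,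 the multilinear map $(f_1,\dots,f_n)\mapsto\Gamma(\alpha_1)f_1\diamond\cdots\diamond\Gamma(\alpha_n)f_n$, which on exponentials is $(\mathcal{E}(\mathfrak{h}_1),\dots,\mathcal{E}(\mathfrak{h}_n))\mapsto\mathcal{E}(\alpha_1\mathfrak{h}_1+\cdots+\alpha_n\mathfrak{h}_n)$, extends uniquely to a continuous multilinear map from $\mathcal{L}^p(W,\mu)^n$ to $\mathcal{L}^p(W,\mu)$ with norm at most $1$; for densities $f_j\in\mathcal{L}^1(W,\mu)$ the expression is understood in this sense with $p=1$. *)

theory Defs
  imports "HOL-Probability.Probability"
begin

(* Elements of L^p are represented by measurable functions; identities between them hold
   almost everywhere. *)

definition lp_space :: "'a measure \<Rightarrow> real \<Rightarrow> ('a \<Rightarrow> real) set" where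
  "lp_space M p = {f \<in> borel_measurable M. integrable M (\<lambda>x. \<bar>f x\<bar> powr p)}"

(* Only meaningful on lp_space M p: the Bochner integral of a non-integrable function is 0. *)
definition lp_norm :: "'a measure \<Rightarrow> real \<Rightarrow> ('a \<Rightarrow> real) \<Rightarrow> real" where
  "lp_norm M p f = (LINT x|M. \<bar>f x\<bar> powr p) powr (1 / p)"

(* Linear span of a family of functions. *)
definition fun_span :: "('i \<Rightarrow> 'a \<Rightarrow> real) \<Rightarrow> ('a \<Rightarrow> real) set" where
  "fun_span F = {u. \<exists>A c. finite A \<and> u = (\<lambda>x. \<Sum>i\<in>A. c i * F i x)}"

(* The inclusion of the dual of W into H (Riesz representative of the restriction to H),
   where H is included in W by the map \<iota>. *)
definition dual_emb ::
  "('h::real_inner \<Rightarrow> 'w::real_normed_vector) \<Rightarrow> ('w \<Rightarrow>\<^sub>L real) \<Rightarrow> 'h" where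
  "dual_emb \<iota> \<phi> = (THE h. \<forall>k. h \<bullet> k = blinfun_apply \<phi> (\<iota> k))"

(* Separability of H is expressed by second countability.  W is then separable too, because H
   is dense in it, so the sort of 'w imposes no additional condition.  The formula for the
   characteristic functional already says that every continuous linear functional is a centred
   Gaussian variable under \<mu>, i.e. that \<mu> is Gaussian. *)
locale abstract_wiener_space = prob_space \<mu>
  for \<mu> :: "'w::{banach, second_countable_topology} measure" +
  fixes \<iota> :: "'h::{real_inner, complete_space, second_countable_topology} \<Rightarrow> 'w"
  assumes sets_eq_borel: "sets \<mu> = sets borel"
    and bounded_linear_embedding: "bounded_linear \<iota>"
    and inj_embedding: "inj \<iota>"
    and dense_embedding: "closure (range \<iota>) = UNIV"
    and characteristic_functional:
      "\<And>\<phi> :: 'w \<Rightarrow>\<^sub>L real.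
        (LINT w|\<mu>. exp (\<i> * complex_of_real (blinfun_apply \<phi> w))) =
          complex_of_real (exp (- (norm (dual_emb \<iota> \<phi>))\<^sup>2 / 2))"

(* Value at h of the continuous extension to H, with values in L^2, of the isometry
   sending a functional \<phi> of H-norm norm (dual_emb \<iota> \<phi>) to \<phi> itself. *)
definition delta ::
  "'w::real_normed_vector measure \<Rightarrow> ('h::real_inner \<Rightarrow> 'w) \<Rightarrow> 'h \<Rightarrow> 'w \<Rightarrow> real" where
  "delta \<mu> \<iota> h = (SOME g. g \<in> lp_space \<mu> 2 \<and>
     (\<forall>\<phi> :: nat \<Rightarrow> 'w \<Rightarrow>\<^sub>L real. (\<lambda>m. dual_emb \<iota> (\<phi> m)) \<longlonglongrightarrow> h \<longrightarrow>
        (\<lambda>m. lp_norm \<mu> 2 (\<lambda>w. blinfun_apply (\<phi> m) w - g w)) \<longlonglongrightarrow> 0))"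

definition stoch_exp ::
  "'w::real_normed_vector measure \<Rightarrow> ('h::real_inner \<Rightarrow> 'w) \<Rightarrow> 'h \<Rightarrow> 'w \<Rightarrow> real" where
  "stoch_exp \<mu> \<iota> h w = exp (delta \<mu> \<iota> h w - (norm h)\<^sup>2 / 2)"

(* Monic Hermite polynomials of variance v:
   exp (t x - t^2 v / 2) is the sum over n of (t^n / n!) hermite n v x. *)
fun hermite :: "nat \<Rightarrow> real \<Rightarrow> real \<Rightarrow> real" where
  "hermite 0 v x = 1"
| "hermite (Suc 0) v x = x"
| "hermite (Suc (Suc n)) v x = x * hermite (Suc n) v x - real (Suc n) * v * hermite n v x"

(* The n-fold Wiener-Ito integral of the n-th symmetric tensor power of h. *)
definition multiple_integral_power ::
  "'w::real_normed_vector measure \<Rightarrow> ('h::real_inner \<Rightarrow> 'w) \<Rightarrow> nat \<Rightarrow> 'h \<Rightarrow> 'w \<Rightarrow> real" where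
  "multiple_integral_power \<mu> \<iota> n h w = hermite n ((norm h)\<^sup>2) (delta \<mu> \<iota> h w)"

(* The tensor powers of single vectors span a dense subspace of the n-th symmetric tensor power
   of H, on which the n-fold integral is sqrt (n!) times an isometry into L^2; hence the space
   of all n-fold integrals is the L^2-closure of the span of the integrals of these powers. *)
definition wiener_chaos ::
  "'w::real_normed_vector measure \<Rightarrow> ('h::real_inner \<Rightarrow> 'w) \<Rightarrow> nat \<Rightarrow> ('w \<Rightarrow> real) set" where
  "wiener_chaos \<mu> \<iota> n = {g \<in> lp_space \<mu> 2.
     \<exists>u :: nat \<Rightarrow> 'w \<Rightarrow> real. (\<forall>m. u m \<in> fun_span (multiple_integral_power \<mu> \<iota> n)) \<and>
       (\<lambda>m. lp_norm \<mu> 2 (\<lambda>w. u m w - g w)) \<longlonglongrightarrow> 0}"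

(* The operator \<Gamma>(l) on L^2: if f is the L^2-sum of g n in the n-th chaos, then
   \<Gamma>(l) f is the L^2-sum of l^n g n. *)
definition Gamma_op ::
  "'w::real_normed_vector measure \<Rightarrow> ('h::real_inner \<Rightarrow> 'w) \<Rightarrow> real \<Rightarrow> ('w \<Rightarrow> real) \<Rightarrow> 'w \<Rightarrow> real" where
  "Gamma_op \<mu> \<iota> l f = (SOME u. u \<in> lp_space \<mu> 2 \<and>
     (\<exists>g. (\<forall>n. g n \<in> wiener_chaos \<mu> \<iota> n) \<and>
       (\<lambda>N. lp_norm \<mu> 2 (\<lambda>w. f w - (\<Sum>n<N. g n w))) \<longlonglongrightarrow> 0 \<and>
       (\<lambda>N. lp_norm \<mu> 2 (\<lambda>w. u w - (\<Sum>n<N. l ^ n * g n w))) \<longlonglongrightarrow> 0))"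

(* Bilinear extension of E(h), E(k) |-> E(h + k) to functions equal almost everywhere to an
   element of the span of the exponentials; the exponentials of distinct vectors are linearly
   independent modulo null functions, so the result does not depend on the representations. *)
definition wick ::
  "'w::real_normed_vector measure \<Rightarrow> ('h::real_inner \<Rightarrow> 'w) \<Rightarrow>
     ('w \<Rightarrow> real) \<Rightarrow> ('w \<Rightarrow> real) \<Rightarrow> 'w \<Rightarrow> real" where
  "wick \<mu> \<iota> f g = (SOME u. \<exists>A c B d. finite A \<and> finite B \<and>
     (AE w in \<mu>. f w = (\<Sum>h\<in>A. c h * stoch_exp \<mu> \<iota> h w)) \<and>
     (AE w in \<mu>. g w = (\<Sum>k\<in>B. d k * stoch_exp \<mu> \<iota> k w)) \<and>
     u = (\<lambda>w. \<Sum>h\<in>A. \<Sum>k\<in>B. c h * d k * stoch_exp \<mu> \<iota> (h + k) w))"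

(* The Wick product of F 1, ..., F n; its unit is E(0) = 1. *)
primrec wick_prod ::
  "'w::real_normed_vector measure \<Rightarrow> ('h::real_inner \<Rightarrow> 'w) \<Rightarrow>
     (nat \<Rightarrow> 'w \<Rightarrow> real) \<Rightarrow> nat \<Rightarrow> 'w \<Rightarrow> real" where
  "wick_prod \<mu> \<iota> F 0 = (\<lambda>w. 1)"
| "wick_prod \<mu> \<iota> F (Suc n) = wick \<mu> \<iota> (wick_prod \<mu> \<iota> F n) (F (Suc n))"

(* T is a continuous (i.e. bounded) multilinear map from n copies of L^p to L^p, the arguments
   being f 1, ..., f n, that extends
   (f 1, ..., f n) |-> \<Gamma>(\<alpha> 1) (f 1) \<diamond> ... \<diamond> \<Gamma>(\<alpha> n) (f n)
   from the span of the exponentials.  Compatibility with almost everywhere equality of the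
   arguments follows from multilinearity and boundedness. *)
definition gamma_wick_extension ::
  "'w::real_normed_vector measure \<Rightarrow> ('h::real_inner \<Rightarrow> 'w) \<Rightarrow> real \<Rightarrow> nat \<Rightarrow> (nat \<Rightarrow> real) \<Rightarrow>
     ((nat \<Rightarrow> 'w \<Rightarrow> real) \<Rightarrow> 'w \<Rightarrow> real) \<Rightarrow> bool" where
  "gamma_wick_extension \<mu> \<iota> p n \<alpha> T \<longleftrightarrow>
     (\<forall>f. (\<forall>j\<in>{1..n}. f j \<in> lp_space \<mu> p) \<longrightarrow> T f \<in> lp_space \<mu> p) \<and>
     (\<forall>f i g a b. (\<forall>j\<in>{1..n}. f j \<in> lp_space \<mu> p) \<longrightarrow> i \<in> {1..n} \<longrightarrow> g \<in> lp_space \<mu> p \<longrightarrow>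
        (AE w in \<mu>. T (f(i := \<lambda>x. a * f i x + b * g x)) w = a * T f w + b * T (f(i := g)) w)) \<and>
     (\<exists>C. \<forall>f. (\<forall>j\<in>{1..n}. f j \<in> lp_space \<mu> p) \<longrightarrow>
        lp_norm \<mu> p (T f) \<le> C * (\<Prod>j=1..n. lp_norm \<mu> p (f j))) \<and>
     (\<forall>f. (\<forall>j\<in>{1..n}. f j \<in> fun_span (stoch_exp \<mu> \<iota>)) \<longrightarrow>
        (AE w in \<mu>. T f w = wick_prod \<mu> \<iota> (\<lambda>j. Gamma_op \<mu> \<iota> (\<alpha> j) (f j)) n w))"

(* The element \<Gamma>(\<alpha> 1) (f 1) \<diamond> ... \<diamond> \<Gamma>(\<alpha> n) (f n)
   of L^p, for f 1, ..., f n in L^p. *)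
definition gamma_wick ::
  "'w::real_normed_vector measure \<Rightarrow> ('h::real_inner \<Rightarrow> 'w) \<Rightarrow> real \<Rightarrow> nat \<Rightarrow> (nat \<Rightarrow> real) \<Rightarrow>
     (nat \<Rightarrow> 'w \<Rightarrow> real) \<Rightarrow> 'w \<Rightarrow> real" where
  "gamma_wick \<mu> \<iota> p n \<alpha> = (SOME T. gamma_wick_extension \<mu> \<iota> p n \<alpha> T)"

(* Nonnegativity is required because ennreal truncates negative values to 0. *)
definition has_real_density ::
  "'o measure \<Rightarrow> 'w measure \<Rightarrow> ('o \<Rightarrow> 'w) \<Rightarrow> ('w \<Rightarrow> real) \<Rightarrow> bool" where
  "has_real_density P \<mu> X f \<longleftrightarrow>
     f \<in> borel_measurable \<mu> \<and> (AE w in \<mu>. 0 \<le> f w) \<and> distributed P \<mu> X (\<lambda>w. ennreal (f w))"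

end

theory Submission
  imports Defs
begin

text \<open>
  Let \<open>w\<^sub>1, \<dots>, w\<^sub>n\<close> be independent with law \<open>\<mu>\<close> and let \<open>Z = \<alpha>\<^sub>1 w\<^sub>1 + \<dots> + \<alpha>\<^sub>n w\<^sub>n\<close>. Since
  \<open>\<Sum>\<alpha>\<^sub>j\<^sup>2 = 1\<close>, the law of \<open>Z\<close> is again \<open>\<mu>\<close>. If the \<open>X\<^sub>j\<close> are independent with densities \<open>f\<^sub>j\<close>,
  their joint law has density \<open>F = f\<^sub>1(w\<^sub>1) \<cdots> f\<^sub>n(w\<^sub>n)\<close> with respect to the law of
  \<open>(w\<^sub>1, \<dots>, w\<^sub>n)\<close>, so the law of \<open>\<Sum>\<alpha>\<^sub>j X\<^sub>j\<close> is the image under \<open>Z\<close> of a measure that is absolutely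
  continuous, hence is itself absolutely continuous with respect to \<open>\<mu>\<close>. Its density is the
  conditional expectation of \<open>F\<close> given \<open>Z\<close> (\<open>mixture_density\<close>), which makes sense for all
  integrable \<open>f\<^sub>j\<close>, is multilinear, and has norm at most 1 from the \<open>n\<close>-fold product of \<open>L\<^sup>1\<close> to
  \<open>L\<^sup>1\<close>. It remains to identify this map with
  \<open>\<Gamma>(\<alpha>\<^sub>1) f\<^sub>1 \<diamond> \<dots> \<diamond> \<Gamma>(\<alpha>\<^sub>n) f\<^sub>n\<close>, i.e. to show that it extends the Wick expression from
  the exponentials (\<open>mixture_density_extends_wick\<close>) and that such an extension is unique
  (\<open>gamma_wick_extension_unique\<close>).

  The identification uses one transform,
  \<open>(S u)(\<phi>) = \<integral> u exp (\<phi> - \<parallel>\<phi>\<parallel>\<^sub>H\<^sup>2 / 2) d\<mu>\<close> for continuous functionals \<open>\<phi>\<close> on \<open>W\<close>. It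
  sends \<open>\<E>(h)\<close> to \<open>exp \<langle>\<phi>, h\<rangle>\<close> and is injective. On combinations of exponentials it turns the Wick
  product into the pointwise product and \<open>\<Gamma>(\<lambda>)\<close> into the dilation \<open>\<phi> \<mapsto> \<lambda> \<phi>\<close>; the latter because
  it sends the \<open>n\<close>-th chaos to functions homogeneous of degree \<open>n\<close>. Finally, as \<open>Z\<close> is linear in
  the \<open>w\<^sub>j\<close> and \<open>\<Sum>\<alpha>\<^sub>j\<^sup>2 = 1\<close>, the weight \<open>exp (\<phi> - \<parallel>\<phi>\<parallel>\<^sub>H\<^sup>2 / 2)\<close> evaluated at \<open>Z\<close> is the product of
  the weights of \<open>\<alpha>\<^sub>j \<phi>\<close> at \<open>w\<^sub>j\<close>. So the transform of the conditional expectation is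
  \<open>\<Prod> (S f\<^sub>j)(\<alpha>\<^sub>j \<phi>)\<close>, which is the transform of the Wick expression.

  Three facts rest on the same principle (\<open>exponential_monotone_class\<close>): the law of \<open>Z\<close> is
  determined by its Laplace transform, the S-transform is injective, and the exponentials span a
  dense subspace of \<open>L\<^sup>1\<close>, which gives uniqueness of the extension. The principle is that a vector
  space of functions which contains \<open>exp \<phi>\<close> for all functionals \<open>\<phi>\<close>, and is closed under
  pointwise limits dominated by such exponentials, contains the indicators of all Borel sets.
  It needs enough functionals to generate the Borel sets, whence the Hahn-Banach theorem. That theorem
  also shows that \<open>W\<^sup>*\<close> is dense in \<open>H\<close>, so that \<open>\<delta>\<close> is defined on all of \<open>H\<close>.
\<close>

section \<open>Hahn-Banach, projections and the dual of \<open>W\<close> inside \<open>H\<close>\<close>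

definition sublinear :: "('a::real_vector \<Rightarrow> real) \<Rightarrow> bool" where
  "sublinear q \<longleftrightarrow> (\<forall>x y. q (x + y) \<le> q x + q y) \<and> (\<forall>c x. 0 < c \<longrightarrow> q (c *\<^sub>R x) \<le> c * q x)"

lemma sublinear_add: "sublinear q \<Longrightarrow> q (x + y) \<le> q x + q y"
  by (auto simp: sublinear_def)

lemma sublinear_scale:
  assumes "sublinear q" "0 \<le> c" shows "q (c *\<^sub>R x) = c * q x"
proof -
  have le: "q (c *\<^sub>R x) \<le> c * q x" if "0 < c" for c x
    using assms that by (auto simp: sublinear_def)
  have "q 0 \<le> 2 * q 0" "q 0 \<le> (1/2) * q 0" using le[of 2 0] le[of "1/2" 0] by auto
  hence z: "q 0 = 0" by auto
  show ?thesis
  proof (cases "c = 0")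
    case False
    hence c: "c > 0" using assms by auto
    have "q (inverse c *\<^sub>R (c *\<^sub>R x)) \<le> inverse c * q (c *\<^sub>R x)" by (rule le) (use c in simp)
    hence "c * q x \<le> q (c *\<^sub>R x)" using c by (simp add: field_simps)
    thus ?thesis using le[OF c, of x] by auto
  qed (use z in auto)
qed

lemma sublinear_zero: "sublinear q \<Longrightarrow> q 0 = 0"
  using sublinear_scale[of q 0 0] by auto

lemma sublinear_minus: "sublinear q \<Longrightarrow> - q (- x) \<le> q x"
  using sublinear_add[of q x "-x"] sublinear_zero[of q] by auto

text \<open>
  The two conditions hold when the family is directed downwards (a chain of sublinear functions), but
  also for the family \<open>t \<mapsto> q (x + t z) - t q z\<close>, whose members are not sublinear themselves.
\<close>

lemma sublinear_INF:
  assumes ne: "I \<noteq> {}" and bdd: "\<And>x. bdd_below ((\<lambda>i. g i x) ` I)"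
    and add: "\<And>i j x y. i \<in> I \<Longrightarrow> j \<in> I \<Longrightarrow> \<exists>k\<in>I. g k (x + y) \<le> g i x + g j y"
    and scale: "\<And>i c x. i \<in> I \<Longrightarrow> 0 < c \<Longrightarrow> \<exists>k\<in>I. g k (c *\<^sub>R x) \<le> c * g i x"
  shows "sublinear (\<lambda>x. INF i\<in>I. g i x)"
  unfolding sublinear_def
proof (intro conjI allI impI)
  fix x y
  have "(INF i\<in>I. g i (x + y)) - g j y \<le> (INF i\<in>I. g i x)" if j: "j \<in> I" for j
  proof (rule cINF_greatest[OF ne])
    fix i assume "i \<in> I"
    then obtain k where "k \<in> I" "g k (x + y) \<le> g i x + g j y" using add j by blast
    thus "(INF i\<in>I. g i (x + y)) - g j y \<le> g i x"
      using cINF_lower[OF bdd, of k "x + y"] by auto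
  qed
  hence "(INF i\<in>I. g i (x + y)) - (INF i\<in>I. g i x) \<le> (INF j\<in>I. g j y)"
    by (intro cINF_greatest[OF ne]) (auto simp: algebra_simps)
  thus "(INF i\<in>I. g i (x + y)) \<le> (INF i\<in>I. g i x) + (INF j\<in>I. g j y)" by auto
next
  fix c :: real and x assume c: "0 < c"
  have "(INF i\<in>I. g i (c *\<^sub>R x)) / c \<le> (INF i\<in>I. g i x)"
  proof (rule cINF_greatest[OF ne])
    fix i assume "i \<in> I"
    then obtain k where "k \<in> I" "g k (c *\<^sub>R x) \<le> c * g i x" using scale c by blast
    thus "(INF i\<in>I. g i (c *\<^sub>R x)) / c \<le> g i x"
      using cINF_lower[OF bdd, of k "c *\<^sub>R x"] c by (auto simp: field_simps)
  qed
  thus "(INF i\<in>I. g i (c *\<^sub>R x)) \<le> c * (INF i\<in>I. g i x)" using c by (simp add: field_simps)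
qed

text \<open>
  Take \<open>r x = inf\<^sub>t (q (x + t z) - t q z)\<close> over \<open>t \<ge> 0\<close>; the values \<open>t = 0\<close> and \<open>t = 1\<close> give the two
  bounds. It serves twice below: to prescribe the value of a functional at \<open>z\<close>, and to show that a
  minimal sublinear function is odd.
\<close>

lemma sublinear_tilt:
  assumes q: "sublinear q"
  obtains r where "sublinear r" "r \<le> q" "r (- z) \<le> - q z"
proof -
  let ?g = "\<lambda>t x. q (x + t *\<^sub>R z) - t * q z"
  let ?r = "\<lambda>x. INF t\<in>{0..}. ?g t x"
  have bdd: "bdd_below ((\<lambda>t. ?g t x) ` {0..})" for x
  proof (rule bdd_belowI2[where m = "- q (- x)"])
    fix t :: real assume "t \<in> {0..}"
    thus "- q (- x) \<le> ?g t x"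
      using sublinear_add[OF q, of "-x" "x + t *\<^sub>R z"] sublinear_scale[OF q, of t z] by auto
  qed
  have "sublinear ?r"
  proof (rule sublinear_INF[OF _ bdd])
    fix i j :: real and x y assume "i \<in> {0..}" "j \<in> {0..}"
    thus "\<exists>k\<in>{0..}. ?g k (x + y) \<le> ?g i x + ?g j y"
      using sublinear_add[OF q, of "x + i *\<^sub>R z" "y + j *\<^sub>R z"]
      by (intro bexI[of _ "i + j"]) (auto simp: algebra_simps)
  next
    fix i c :: real and x assume "i \<in> {0..}" "0 < c"
    thus "\<exists>k\<in>{0..}. ?g k (c *\<^sub>R x) \<le> c * ?g i x"
      using sublinear_scale[OF q, of c "x + i *\<^sub>R z"]
      by (intro bexI[of _ "c * i"]) (auto simp: algebra_simps)
  qed auto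
  moreover have "?r \<le> q"
    using cINF_lower[OF bdd, of 0] by (auto simp: le_fun_def)
  moreover have "?r (- z) \<le> - q z"
    using cINF_lower[OF bdd, of 1 "-z"] sublinear_zero[OF q] by auto
  ultimately show thesis using that by blast
qed

text \<open>
  Zorn's lemma; the infimum of a chain of sublinear functions below \<open>p\<close> is finite because each member
  lies above \<open>- p (- x)\<close> at \<open>x\<close>.
\<close>

lemma minimal_sublinear_below:
  assumes p: "sublinear p"
  obtains q where "sublinear q" "q \<le> p" "\<And>r. sublinear r \<Longrightarrow> r \<le> q \<Longrightarrow> r = q"
proof -
  let ?A = "{q. sublinear q \<and> q \<le> p}"
  let ?P = "\<lambda>q r. r \<le> q"
  have po: "partial_order_on ?A (relation_of ?P ?A)"
    by (auto simp: partial_order_on_def preorder_on_def relation_of_def refl_on_def trans_def antisym_def)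
  have "\<exists>m\<in>?A. \<forall>q\<in>?A. m \<ge> q \<longrightarrow> q = m"
  proof (rule predicate_Zorn[OF po])
    fix C assume "C \<in> Chains (relation_of ?P ?A)"
    hence sub: "C \<subseteq> ?A" and chain: "\<And>q r. q \<in> C \<Longrightarrow> r \<in> C \<Longrightarrow> q \<le> r \<or> r \<le> q"
      by (auto simp: Chains_def relation_of_def)
    show "\<exists>u\<in>?A. \<forall>a\<in>C. u \<le> a"
    proof (cases "C = {}")
      case True thus ?thesis using p by auto
    next
      case False
      let ?u = "\<lambda>x. INF q\<in>C. q x"
      have bdd: "bdd_below ((\<lambda>q. q x) ` C)" for x
      proof (rule bdd_belowI2[where m = "- p (- x)"])
        fix q assume "q \<in> C"
        hence "sublinear q" "q (-x) \<le> p (-x)" using sub by (auto simp: le_fun_def)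
        thus "- p (- x) \<le> q x" using sublinear_minus[of q x] by auto
      qed
      have "sublinear ?u"
      proof (rule sublinear_INF[OF False bdd])
        fix i j x y assume ij: "i \<in> C" "j \<in> C"
        hence "sublinear i" "sublinear j" using sub by auto
        hence "i (x + y) \<le> i x + i y" "j (x + y) \<le> j x + j y" by (auto intro: sublinear_add)
        thus "\<exists>k\<in>C. k (x + y) \<le> i x + j y"
          using chain[OF ij] ij by (smt (verit) le_funD)
      next
        fix i c x assume "i \<in> C" "(0::real) < c"
        thus "\<exists>k\<in>C. k (c *\<^sub>R x) \<le> c * i x"
          using sub sublinear_scale[of i c x] by (intro bexI[of _ i]) auto
      qed
      moreover have le: "?u \<le> q" if "q \<in> C" for q
        using cINF_lower[OF bdd that] by (auto simp: le_fun_def)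
      moreover have "?u \<le> p" using le sub False by (blast intro: order_trans)
      ultimately show ?thesis by auto
    qed
  qed
  then obtain m where m: "m \<in> ?A" "\<And>q. q \<in> ?A \<Longrightarrow> q \<le> m \<Longrightarrow> q = m" by blast
  show thesis
    by (rule that[of m]) (use m in \<open>auto intro: order_trans\<close>)
qed

text \<open>
  A minimal sublinear function is linear: tilting it along any \<open>x\<close> cannot make it smaller, which says
  \<open>q (- x) \<le> - q x\<close>, and an odd sublinear function is additive and homogeneous. Starting from the tilt of
  \<open>p\<close> along \<open>z\<close> forces the value \<open>p z\<close> at \<open>z\<close>.
\<close>

theorem Hahn_Banach_sublinear:
  assumes p: "sublinear p"
  obtains f where "linear f" "\<And>x. f x \<le> p x" "f z = p z"
proof -
  obtain r where r: "sublinear r" "r \<le> p" "r (- z) \<le> - p z" by (rule sublinear_tilt[OF p])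
  obtain q where q: "sublinear q" "q \<le> r" and min: "\<And>r. sublinear r \<Longrightarrow> r \<le> q \<Longrightarrow> r = q"
    by (rule minimal_sublinear_below[OF r(1)]) blast
  have odd: "q (- x) = - q x" for x
  proof -
    obtain s where s: "sublinear s" "s \<le> q" "s (- x) \<le> - q x" by (rule sublinear_tilt[OF q(1)])
    hence "q (- x) \<le> - q x" using min by metis
    thus ?thesis using sublinear_minus[OF q(1), of "-x"] by auto
  qed
  have "linear q"
  proof (rule linearI)
    fix x y show "q (x + y) = q x + q y"
      using sublinear_add[OF q(1), of x y] sublinear_add[OF q(1), of "-x" "-y"] odd[of "x + y"]
        odd[of x] odd[of y] by (simp add: algebra_simps)
  next
    fix c :: real and x show "q (c *\<^sub>R x) = c *\<^sub>R q x"
      using sublinear_scale[OF q(1), of c x] sublinear_scale[OF q(1), of "-c" x] odd[of "c *\<^sub>R x"]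
      by (cases "c \<ge> 0") auto
  qed
  moreover have "q x \<le> p x" for x using q(2) r(2) by (meson le_funD order_trans)
  moreover have "q z = p z"
    using odd[of z] r(3) le_funD[OF q(2), of "-z"] \<open>q z \<le> p z\<close> by auto
  ultimately show thesis using that by blast
qed

type_synonym 'a dual = "'a \<Rightarrow>\<^sub>L real"

corollary norming_functional:
  fixes z :: "'a::real_normed_vector"
  obtains \<phi> :: "'a dual" where "\<And>x. \<bar>blinfun_apply \<phi> x\<bar> \<le> norm x" "blinfun_apply \<phi> z = norm z"
proof -
  have "sublinear (norm :: 'a \<Rightarrow> real)" by (auto simp: sublinear_def norm_triangle_ineq)
  then obtain f where f: "linear f" "\<And>x::'a. f x \<le> norm x" "f z = norm z"
    by (rule Hahn_Banach_sublinear) blast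
  have abs: "\<bar>f x\<bar> \<le> norm x" for x
    using f(2)[of x] f(2)[of "-x"] linear_neg[OF f(1), of x] by auto
  have bl: "bounded_linear f"
    by (rule bounded_linear_intro[where K = 1]) (use f abs in \<open>auto simp: linear_add linear_scale\<close>)
  show thesis
    by (rule that[of "Blinfun f"]) (use abs f bl in \<open>auto simp: bounded_linear_Blinfun_apply\<close>)
qed

text \<open>
  A minimising sequence for the distance from \<open>h\<close> is Cauchy by the parallelogram law. Its limit lies in
  the closure of \<open>S\<close>, which is the form that yields density of a subspace with trivial orthogonal
  complement.
\<close>

lemma subspace_projection:
  fixes S :: "'a::{real_inner, complete_space} set"
  assumes S: "subspace S"
  obtains m where "m \<in> closure S" "\<And>s. s \<in> S \<Longrightarrow> (h - m) \<bullet> s = 0"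
proof -
  define d where "d = (INF s\<in>S. (norm (h - s))\<^sup>2)"
  have ne: "S \<noteq> {}" using subspace_0[OF S] by auto
  have bdd: "bdd_below ((\<lambda>s. (norm (h - s))\<^sup>2) ` S)" by (rule bdd_belowI2[where m = 0]) auto
  have dle: "d \<le> (norm (h - s))\<^sup>2" if "s \<in> S" for s
    unfolding d_def by (rule cINF_lower[OF bdd that])
  have "\<exists>s\<in>S. (norm (h - s))\<^sup>2 < d + 1 / real (Suc k)" for k
    using cINF_less_iff[OF ne bdd, of "d + 1 / real (Suc k)"] by (auto simp: d_def)
  then obtain s where s: "\<And>k. s k \<in> S" "\<And>k. (norm (h - s k))\<^sup>2 < d + 1 / real (Suc k)" by metis
  have par: "(norm (s i - s j))\<^sup>2 \<le> 2 / real (Suc i) + 2 / real (Suc j)" for i j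
  proof -
    have "(1/2) *\<^sub>R (s i + s j) \<in> S" using s S by (intro subspace_scale subspace_add) auto
    hence "d \<le> (norm (h - (1/2) *\<^sub>R (s i + s j)))\<^sup>2" by (rule dle)
    moreover have "(norm (s i - s j))\<^sup>2 + 4 * (norm (h - (1/2) *\<^sub>R (s i + s j)))\<^sup>2
      = 2 * (norm (h - s i))\<^sup>2 + 2 * (norm (h - s j))\<^sup>2"
      by (simp add: power2_norm_eq_inner inner_simps inner_commute algebra_simps)
    ultimately show ?thesis using s(2)[of i] s(2)[of j] by linarith
  qed
  have "Cauchy s"
  proof (rule CauchyI)
    fix e :: real assume e: "0 < e"
    then obtain M where M: "4 / real (Suc M) < e\<^sup>2"
      using reals_Archimedean[of "e\<^sup>2 / 4"] by (auto simp: field_simps)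
    show "\<exists>M. \<forall>m\<ge>M. \<forall>n\<ge>M. norm (s m - s n) < e"
    proof (intro exI[of _ M] allI impI)
      fix m n assume mn: "M \<le> m" "M \<le> n"
      have "2 / real (Suc m) \<le> 2 / real (Suc M)" "2 / real (Suc n) \<le> 2 / real (Suc M)"
        using mn by (auto intro!: divide_left_mono)
      hence "(norm (s m - s n))\<^sup>2 < e\<^sup>2" using par[of m n] M by linarith
      thus "norm (s m - s n) < e" using e by (simp add: power_less_imp_less_base)
    qed
  qed
  then obtain m where m: "s \<longlonglongrightarrow> m" using Cauchy_convergent convergent_def by blast
  have "m \<in> closure S" using closure_sequential m s(1) by blast
  moreover have "(h - m) \<bullet> x = 0" if x: "x \<in> S" for x
  proof -
    have dm: "(norm (h - m))\<^sup>2 \<le> d"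
    proof (rule LIMSEQ_le)
      show "(\<lambda>k. (norm (h - s k))\<^sup>2) \<longlonglongrightarrow> (norm (h - m))\<^sup>2" by (intro tendsto_intros m)
      show "(\<lambda>k. d + 1 / real (Suc k)) \<longlonglongrightarrow> d"
        using tendsto_add[OF tendsto_const[of d] LIMSEQ_inverse_real_of_nat]
        by (simp add: inverse_eq_divide)
    qed (use s in \<open>auto intro: less_imp_le\<close>)
    have ge: "d \<le> (norm (h - m - t *\<^sub>R x))\<^sup>2" for t
    proof (rule LIMSEQ_le_const)
      show "(\<lambda>k. (norm (h - (s k + t *\<^sub>R x)))\<^sup>2) \<longlonglongrightarrow> (norm (h - m - t *\<^sub>R x))\<^sup>2"
        by (rule tendsto_eq_intros m | rule refl | simp add: algebra_simps)+
      show "\<exists>N. \<forall>n\<ge>N. d \<le> (norm (h - (s n + t *\<^sub>R x)))\<^sup>2"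
        using s x S by (auto intro!: dle subspace_add subspace_scale)
    qed
    \<comment> \<open>A quadratic in \<open>t\<close> that is nonnegative and vanishes at \<open>0\<close> has no linear term.\<close>
    have q: "0 \<le> t\<^sup>2 * (x \<bullet> x) - 2 * t * ((h - m) \<bullet> x)" for t
    proof -
      have "(norm (a - t *\<^sub>R x))\<^sup>2 = (norm a)\<^sup>2 - 2 * t * (a \<bullet> x) + t\<^sup>2 * (x \<bullet> x)" for a
        by (simp only: power2_norm_eq_inner)
          (simp add: inner_simps inner_commute algebra_simps power2_eq_square)
      from this[of "h - m"] show ?thesis using ge[of t] dm by linarith
    qed
    show ?thesis
    proof (cases "x = 0")
      case False
      hence xx: "x \<bullet> x > 0" by simp
      have "((h - m) \<bullet> x)\<^sup>2 \<le> 0"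
        using q[of "((h - m) \<bullet> x) / (x \<bullet> x)"] xx by (simp add: field_simps power2_eq_square)
      thus ?thesis by simp
    qed auto
  qed
  ultimately show thesis using that by blast
qed

text \<open>
  The representing vector is a multiple of the component of some \<open>x\<close> with \<open>f x \<noteq> 0\<close> orthogonal to
  the kernel.
\<close>

theorem Riesz_representation:
  fixes f :: "'a::{real_inner, complete_space} \<Rightarrow> real"
  assumes "bounded_linear f"
  shows "\<exists>!h. \<forall>k. h \<bullet> k = f k"
proof -
  interpret f: bounded_linear f by fact
  have ker: "subspace {x. f x = 0}"
    by (auto simp: subspace_def f.add f.scaleR f.zero)
  have clker: "closed {x. f x = 0}"
    by (intro closed_Collect_eq continuous_intros f.continuous_on)
  have ex: "\<exists>h. \<forall>k. h \<bullet> k = f k"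
  proof (cases "\<forall>x. f x = 0")
    case True thus ?thesis by (intro exI[of _ 0]) auto
  next
    case False
    then obtain x where x: "f x \<noteq> 0" by auto
    obtain m where m: "m \<in> closure {x. f x = 0}" "\<And>s. s \<in> {x. f x = 0} \<Longrightarrow> (x - m) \<bullet> s = 0"
      using subspace_projection[OF ker] by blast
    define e where "e = x - m"
    have fe: "f e \<noteq> 0" using m(1) clker x by (auto simp: e_def f.diff)
    hence ee: "e \<bullet> e \<noteq> 0" using f.zero by auto
    have "((f e / (e \<bullet> e)) *\<^sub>R e) \<bullet> k = f k" for k
    proof -
      have "e \<bullet> (k - (f k / f e) *\<^sub>R e) = 0"
        unfolding e_def by (rule m(2)) (use fe in \<open>auto simp: f.diff f.scaleR e_def\<close>)
      hence "e \<bullet> k = (f k / f e) * (e \<bullet> e)" by (simp add: inner_simps)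
      thus ?thesis using fe ee by simp
    qed
    thus ?thesis by blast
  qed
  moreover have "h = h'" if "\<forall>k. h \<bullet> k = f k" "\<forall>k. h' \<bullet> k = f k" for h h'
    using that by (metis vector_eq_rdot)
  ultimately show ?thesis by blast
qed

lemma dual_emb_inner:
  fixes \<iota> :: "'h::{real_inner, complete_space} \<Rightarrow> 'w::real_normed_vector"
  assumes "bounded_linear \<iota>"
  shows "dual_emb \<iota> \<phi> \<bullet> k = blinfun_apply \<phi> (\<iota> k)"
proof -
  have "bounded_linear (\<lambda>k. blinfun_apply \<phi> (\<iota> k))"
    using assms by (intro bounded_linear_compose[OF blinfun.bounded_linear_right])
  from theI'[OF Riesz_representation[OF this]] show ?thesis
    unfolding dual_emb_def by blast
qed

lemma dual_emb_eqI:
  fixes \<iota> :: "'h::{real_inner, complete_space} \<Rightarrow> 'w::real_normed_vector"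
  assumes "bounded_linear \<iota>" "\<And>k. h \<bullet> k = blinfun_apply \<phi> (\<iota> k)"
  shows "dual_emb \<iota> \<phi> = h"
  using dual_emb_inner[OF assms(1), of \<phi>] assms(2) by (metis vector_eq_rdot)

lemma dual_emb_linear:
  fixes \<iota> :: "'h::{real_inner, complete_space} \<Rightarrow> 'w::real_normed_vector"
  assumes "bounded_linear \<iota>"
  shows "dual_emb \<iota> (\<phi> + \<psi>) = dual_emb \<iota> \<phi> + dual_emb \<iota> \<psi>"
    and "dual_emb \<iota> (\<phi> - \<psi>) = dual_emb \<iota> \<phi> - dual_emb \<iota> \<psi>"
    and "dual_emb \<iota> (c *\<^sub>R \<phi>) = c *\<^sub>R dual_emb \<iota> \<phi>"
    and "dual_emb \<iota> 0 = 0"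
  by (intro dual_emb_eqI assms;
      simp add: dual_emb_inner[OF assms] inner_simps blinfun.bilinear_simps)+

text \<open>
  A vector \<open>k\<close> orthogonal to all Riesz representatives is annihilated by every functional on \<open>W\<close>
  (after the inclusion), so it vanishes by Hahn-Banach and injectivity.
\<close>

lemma dense_range_dual_emb:
  fixes \<iota> :: "'h::{real_inner, complete_space} \<Rightarrow> 'w::real_normed_vector"
  assumes \<iota>: "bounded_linear \<iota>" and "inj \<iota>"
  shows "closure (range (dual_emb \<iota>)) = UNIV"
proof -
  have sub: "subspace (range (dual_emb \<iota>))"
    using dual_emb_linear[OF \<iota>] by (auto simp: subspace_def) (metis rangeI)+
  have "h \<in> closure (range (dual_emb \<iota>))" for h
  proof -
    obtain m where m: "m \<in> closure (range (dual_emb \<iota>))"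
        "\<And>s. s \<in> range (dual_emb \<iota>) \<Longrightarrow> (h - m) \<bullet> s = 0"
      using subspace_projection[OF sub] by blast
    have "blinfun_apply \<phi> (\<iota> (h - m)) = 0" for \<phi> :: "'w dual"
      using m(2)[of "dual_emb \<iota> \<phi>"] dual_emb_inner[OF \<iota>] by (simp add: inner_commute)
    moreover obtain \<phi> :: "'w dual" where "blinfun_apply \<phi> (\<iota> (h - m)) = norm (\<iota> (h - m))"
      using norming_functional by blast
    ultimately have "\<iota> (h - m) = \<iota> 0"
      using linear_0[OF bounded_linear.linear[OF \<iota>]] by simp
    hence "h = m" using \<open>inj \<iota>\<close> by (auto dest: injD)
    thus ?thesis using m(1) by simp
  qed
  thus ?thesis by auto
qed

section \<open>Borel sets generated by exponentials of functionals\<close>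

text \<open>
  By separability countably many functionals \<open>\<phi>\<^sub>d\<close>, each norming a point \<open>d\<close> of a dense set, recover the
  norm as a supremum. Hence every closed ball is a countable intersection of half spaces, and every open
  set is a countable union of closed balls.
\<close>

theorem borel_subset_if_functionals_measurable:
  fixes M :: "'w::{real_normed_vector, second_countable_topology} measure"
  assumes sp: "space M = UNIV"
    and meas: "\<And>\<phi> :: 'w dual. \<phi> \<in> borel_measurable M"
  shows "sets (borel :: 'w measure) \<subseteq> sets M"
proof -
  obtain D :: "'w set" where D: "countable D" "\<And>X. open X \<Longrightarrow> X \<noteq> {} \<Longrightarrow> \<exists>d\<in>D. d \<in> X"
    by (rule countable_dense_setE) blast
  have "\<exists>\<phi> :: 'w dual. (\<forall>x. \<bar>\<phi> x\<bar> \<le> norm x) \<and> \<phi> d = norm d" for d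
    using norming_functional by metis
  then obtain \<phi> :: "'w \<Rightarrow> 'w dual"
    where \<phi>: "\<And>d x. \<bar>(\<phi> d) x\<bar> \<le> norm x" "\<And>d. (\<phi> d) d = norm d" by metis
  have norming: "norm x \<le> r" if "\<And>d. d \<in> D \<Longrightarrow> (\<phi> d) x \<le> r" for x r
  proof (rule field_le_epsilon)
    fix e :: real assume e: "0 < e"
    obtain d where d: "d \<in> D" "d \<in> ball x (e / 2)"
      using D(2)[of "ball x (e / 2)"] e by auto
    have "norm x \<le> norm d + norm (d - x)" by (metis norm_triangle_sub add.commute norm_minus_commute)
    also have "norm d = (\<phi> d) x + (\<phi> d) (d - x)"
      using \<phi>(2) by (simp add: blinfun.bilinear_simps)
    finally show "norm x \<le> r + e"
      using that[OF d(1)] \<phi>(1)[of d "d - x"] d(2) by (auto simp: dist_norm norm_minus_commute)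
  qed
  have cball: "cball a r \<in> sets M" for a r
  proof -
    have "cball a r = (\<Inter>d\<in>D. {x \<in> space M. (\<phi> d) x \<le> (\<phi> d) a + r})"
    proof (intro set_eqI iffI)
      fix x assume x: "x \<in> cball a r"
      have "(\<phi> d) x \<le> (\<phi> d) a + r" for d
        using \<phi>(1)[of d "x - a"] x by (simp add: blinfun.bilinear_simps dist_norm norm_minus_commute)
      thus "x \<in> (\<Inter>d\<in>D. {x \<in> space M. (\<phi> d) x \<le> (\<phi> d) a + r})"
        using sp by auto
    next
      fix x assume "x \<in> (\<Inter>d\<in>D. {x \<in> space M. (\<phi> d) x \<le> (\<phi> d) a + r})"
      hence "norm (x - a) \<le> r" by (intro norming) (auto simp: blinfun.bilinear_simps algebra_simps)
      thus "x \<in> cball a r" by (simp add: dist_norm norm_minus_commute)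
    qed
    also have "\<dots> \<in> sets M"
    proof (rule sets.countable_INT'')
      show "UNIV \<in> sets M" using sets.top[of M] sp by simp
    qed (use D meas in \<open>auto intro: borel_measurable_le\<close>)
    finally show ?thesis .
  qed
  have "U \<in> sets M" if U: "open U" for U
  proof -
    let ?I = "{(d, n). d \<in> D \<and> cball d (1 / real (Suc n)) \<subseteq> U}"
    have "U = (\<Union>(d, n)\<in>?I. cball d (1 / real (Suc n)))"
    proof (intro set_eqI iffI)
      fix x assume "x \<in> U"
      then obtain e where e: "e > 0" "ball x e \<subseteq> U" using U openE by blast
      obtain n where n: "1 / real (Suc n) < e / 2"
        using reals_Archimedean[of "e / 2"] e by (auto simp: inverse_eq_divide)
      obtain d where d: "d \<in> D" "d \<in> ball x (1 / real (Suc n))"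
        using D(2)[of "ball x (1 / real (Suc n))"] by auto
      have "cball d (1 / real (Suc n)) \<subseteq> ball x e"
      proof
        fix y assume "y \<in> cball d (1 / real (Suc n))"
        thus "y \<in> ball x e" using d(2) n dist_triangle[of x y d] by (auto simp: dist_commute)
      qed
      hence "(d, n) \<in> ?I" "x \<in> cball d (1 / real (Suc n))" using d e by (auto simp: dist_commute less_imp_le)
      thus "x \<in> (\<Union>(d, n)\<in>?I. cball d (1 / real (Suc n)))" by blast
    qed auto
    also have "\<dots> \<in> sets M"
    proof (rule sets.countable_UN')
      show "countable ?I" by (rule countable_subset[of _ "D \<times> UNIV"]) (use D in auto)
    qed (use cball in auto)
    finally show ?thesis .
  qed
  hence "sigma_sets UNIV {S :: 'w set. open S} \<subseteq> sets M"
    using sets.sigma_sets_subset[of "{S. open S}" M] sp by auto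
  thus ?thesis by (simp add: borel_def)
qed

text \<open>
  The indicator of \<open>{f > c}\<close> is a bounded limit of polynomials in \<open>f\<close>, by Weierstrass approximation of the
  piecewise linear functions \<open>min 1 (max 0 (k (y - c)))\<close>. The sets whose indicators are bounded limits of
  elements of the algebra \<open>A\<close> are closed under intersection, since \<open>A\<close> is closed under products; the sets
  whose indicators lie in \<open>K\<close> form a Dynkin system. The two are combined by the \<open>\<pi>\<close>-\<open>\<lambda>\<close> theorem.
\<close>

theorem functional_monotone_class:
  fixes K A :: "('a \<Rightarrow> real) set"
  assumes lin: "\<And>f g a b. f \<in> K \<Longrightarrow> g \<in> K \<Longrightarrow> (\<lambda>x. a * f x + b * g x) \<in> K"
    and lim: "\<And>F f c. (\<And>k::nat. F k \<in> K) \<Longrightarrow> (\<And>k x. \<bar>F k x\<bar> \<le> c) \<Longrightarrow>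
        (\<And>x. (\<lambda>k. F k x) \<longlonglongrightarrow> f x) \<Longrightarrow> f \<in> K"
    and sub: "A \<subseteq> K"
    and A_one: "(\<lambda>x. 1) \<in> A"
    and A_lin: "\<And>f g a b. f \<in> A \<Longrightarrow> g \<in> A \<Longrightarrow> (\<lambda>x. a * f x + b * g x) \<in> A"
    and A_mult: "\<And>f g. f \<in> A \<Longrightarrow> g \<in> A \<Longrightarrow> (\<lambda>x. f x * g x) \<in> A"
    and A_bdd: "\<And>f. f \<in> A \<Longrightarrow> \<exists>c. \<forall>x. \<bar>f x\<bar> \<le> c"
    and S: "S \<in> sigma_sets UNIV {{x. c < f x} | f c. f \<in> A}"
  shows "indicator S \<in> K"
proof -
  define G where "G = {S :: 'a set. \<exists>u b. (\<forall>k::nat. u k \<in> A) \<and> (\<forall>k x. \<bar>u k x\<bar> \<le> b) \<and>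
    (\<forall>x. (\<lambda>k. u k x) \<longlonglongrightarrow> indicator S x)}"
  have GK: "indicator S \<in> K" if "S \<in> G" for S
    using that lim sub unfolding G_def by blast
  have Int: "Int_stable G"
  proof (rule Int_stableI)
    fix S T assume "S \<in> G" "T \<in> G"
    then obtain u b v c where u: "\<And>k::nat. u k \<in> A" "\<And>k x. \<bar>u k x\<bar> \<le> b" "\<And>x. (\<lambda>k. u k x) \<longlonglongrightarrow> indicator S x"
      and v: "\<And>k::nat. v k \<in> A" "\<And>k x. \<bar>v k x\<bar> \<le> c" "\<And>x. (\<lambda>k. v k x) \<longlonglongrightarrow> indicator T x"
      unfolding G_def by blast
    have "(\<lambda>k. u k x * v k x) \<longlonglongrightarrow> indicator (S \<inter> T) x" for x
      using tendsto_mult[OF u(3) v(3), of x x] by (simp add: indicator_inter_arith)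
    moreover have "\<bar>u k x * v k x\<bar> \<le> b * c" for k x
      unfolding abs_mult using u(2)[of k x] v(2)[of k x] by (intro mult_mono) auto
    ultimately show "S \<inter> T \<in> G"
      unfolding G_def using A_mult u(1) v(1)
      by (intro CollectI exI[of _ "\<lambda>k x. u k x * v k x"] exI[of _ "b * c"]) auto
  qed
  have const: "(\<lambda>x. c) \<in> A" for c
    using A_lin[OF A_one A_one, of c 0] by simp
  have poly: "(\<lambda>x. p (f x)) \<in> A" if "f \<in> A" "real_polynomial_function p" for f and p :: "real \<Rightarrow> real"
    using that(2)
  proof induct
    case (linear p)
    then obtain c where "p = (\<lambda>y. y * c)" using real_bounded_linear by auto
    thus ?case using A_lin[OF that(1) that(1), of c 0] by (simp add: mult.commute)
  next
    case (add p q) thus ?case using A_lin[of "\<lambda>x. p (f x)" "\<lambda>x. q (f x)" 1 1] by simp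
  qed (auto intro: const A_mult)
  have basic: "{x. c < f x} \<in> G" if f: "f \<in> A" for f c
  proof -
    obtain b where b: "\<And>x. \<bar>f x\<bar> \<le> b" using A_bdd[OF f] by auto
    define g where "g = (\<lambda>(k::nat) y. min 1 (max 0 (real k * (y - c))))"
    have "\<exists>p. real_polynomial_function p \<and> (\<forall>y\<in>{-b..b}. \<bar>g k y - p y\<bar> < 1 / real (Suc k))" for k
    proof -
      have "continuous_on {-b..b} (g k)" unfolding g_def by (intro continuous_intros)
      then obtain p where "real_polynomial_function p" "\<And>y. y \<in> {-b..b} \<Longrightarrow> \<bar>g k y - p y\<bar> < 1 / real (Suc k)"
        using Stone_Weierstrass_real_polynomial_function[of "{-b..b}" "g k" "1 / real (Suc k)"] by auto
      thus ?thesis by auto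
    qed
    then obtain p where p: "\<And>k. real_polynomial_function (p k)"
      "\<And>k y. y \<in> {-b..b} \<Longrightarrow> \<bar>g k y - p k y\<bar> < 1 / real (Suc k)" by metis
    have near: "\<bar>g k (f x) - p k (f x)\<bar> < 1 / real (Suc k)" for k x
      using b[of x] by (intro p) (auto simp: abs_le_iff)
    have "\<bar>p k (f x)\<bar> \<le> 2" for k x
    proof -
      have "\<bar>g k (f x)\<bar> \<le> 1" "1 / real (Suc k) \<le> 1" by (auto simp: g_def)
      thus ?thesis using near[of k x] by linarith
    qed
    moreover have "(\<lambda>k. p k (f x)) \<longlonglongrightarrow> indicator {x. c < f x} x" for x
    proof -
      have "(\<lambda>k. g k (f x)) \<longlonglongrightarrow> indicator {x. c < f x} x"
      proof (cases "c < f x")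
        case True
        then obtain N where N: "1 < real N * (f x - c)"
          using reals_Archimedean3[of "f x - c"] by auto
        have "g k (f x) = 1" if "k \<ge> N" for k
        proof -
          have "real N * (f x - c) \<le> real k * (f x - c)" using that True by (intro mult_right_mono) auto
          thus ?thesis using N by (auto simp: g_def)
        qed
        hence "eventually (\<lambda>k. g k (f x) = 1) sequentially" by (auto simp: eventually_sequentially)
        thus ?thesis using True by (simp add: tendsto_eventually)
      next
        case False
        have "real k * (f x - c) \<le> 0" for k using False by (intro mult_nonneg_nonpos) auto
        hence "g k (f x) = 0" for k unfolding g_def by (simp add: max_absorb1)
        thus ?thesis using False by simp
      qed
      moreover have "(\<lambda>k. p k (f x) - g k (f x)) \<longlonglongrightarrow> 0"
        by (rule LIMSEQ_norm_0) (use near[of _ x] in \<open>auto simp: abs_minus_commute\<close>)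
      ultimately have "(\<lambda>k. g k (f x) + (p k (f x) - g k (f x))) \<longlonglongrightarrow> indicator {x. c < f x} x + 0"
        by (rule tendsto_add)
      thus ?thesis by simp
    qed
    ultimately show ?thesis
      unfolding G_def using poly[OF f p(1)]
      by (intro CollectI exI[of _ "\<lambda>k x. p k (f x)"] exI[of _ "2::real"]) auto
  qed
  have SG: "S \<in> sigma_sets UNIV G"
    using S by (rule set_rev_mp) (rule sigma_sets_subseteq, use basic in auto)
  have "G \<subseteq> Pow UNIV" by simp
  from Int this SG show ?thesis
  proof (induct rule: sigma_sets_induct_disjoint)
    case (basic S) thus ?case by (rule GK)
  next
    case empty
    have "(\<lambda>x. 0 * 1 + 0 * 1) \<in> K" using lin sub A_one by blast
    thus ?case by (simp add: indicator_def[abs_def])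
  next
    case (compl S)
    have "(\<lambda>x. 1 * 1 + (-1) * indicator S x) \<in> K" using compl sub A_one by (intro lin) auto
    moreover have "(\<lambda>x. 1 * 1 + (-1) * indicator S x) = (indicator (UNIV - S) :: _ \<Rightarrow> real)"
      by (auto simp: fun_eq_iff indicator_def)
    ultimately show ?case by simp
  next
    case (union S)
    have zero: "(\<lambda>x. 0) \<in> K" using lin[of "\<lambda>x. 1" "\<lambda>x. 1" 0 0] sub A_one by auto
    have 1: "(\<lambda>x. \<Sum>i<n. indicator (S i) x :: real) \<in> K" for n
    proof (induct n)
      case (Suc n)
      thus ?case using lin[OF Suc union(3)[of n], of 1 1] by simp
    qed (use zero in simp)
    have eq: "(\<Sum>i<n. indicator (S i) x) = (indicator (\<Union>i<n. S i) x :: real)" for n x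
      using union(1) by (intro indicator_UN_disjoint[symmetric]) (auto simp: disjoint_family_on_def)
    have 2: "(\<lambda>n. \<Sum>i<n. indicator (S i) x :: real) \<longlonglongrightarrow> indicator (\<Union>i. S i) x" for x
      unfolding eq by (rule LIMSEQ_indicator_UN)
    have 3: "\<bar>\<Sum>i<n. indicator (S i) x :: real\<bar> \<le> 1" for n x
      unfolding eq by (auto simp: indicator_def)
    show ?case using 1 3 2 by (rule lim)
  qed
qed

lemma difference_quotient_LIMSEQ:
  fixes f :: "real \<Rightarrow> real"
  assumes "(f has_real_derivative D) (at 0)"
  shows "(\<lambda>k. real (Suc k) * (f (x / real (Suc k)) - f 0)) \<longlonglongrightarrow> x * D"
proof (cases "x = 0")
  case False
  have "(\<lambda>h. (f h - f 0) / h) \<midarrow>0\<rightarrow> D" using assms by (simp add: DERIV_def)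
  moreover have "(\<lambda>k. x / real (Suc k)) \<longlonglongrightarrow> 0"
    using tendsto_mult[OF tendsto_const[of x] LIMSEQ_inverse_real_of_nat] by (simp add: inverse_eq_divide)
  hence "filterlim (\<lambda>k. x / real (Suc k)) (at 0) sequentially"
    using False by (auto simp: filterlim_at)
  ultimately have "(\<lambda>k. (f (x / real (Suc k)) - f 0) / (x / real (Suc k))) \<longlonglongrightarrow> D"
    by (rule filterlim_compose)
  moreover have "x * ((f (x / real (Suc k)) - f 0) / (x / real (Suc k))) =
      real (Suc k) * (f (x / real (Suc k)) - f 0)" for k
    using False by simp
  ultimately show ?thesis using tendsto_mult[OF tendsto_const[of x]] by fastforce
qed simp

lemma power_le_fact_exp:
  fixes x :: real assumes "0 \<le> x" shows "x ^ n \<le> fact n * exp x"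
proof -
  have "(\<Sum>k\<in>{n}. x ^ k /\<^sub>R fact k) \<le> (\<Sum>k. x ^ k /\<^sub>R fact k)"
    by (rule sum_le_suminf[OF summable_exp_generic]) (use assms in auto)
  thus ?thesis by (simp add: exp_def field_simps)
qed

lemma abs_exp_minus_one_le: "\<bar>exp y - 1\<bar> \<le> \<bar>y\<bar> * exp \<bar>y\<bar>" for y :: real
proof (cases "y \<ge> 0")
  case True
  have "(1 - y) * exp y \<le> exp (-y) * exp y"
    using exp_ge_add_one_self[of "-y"] by (intro mult_right_mono) auto
  thus ?thesis using True by (simp add: exp_minus algebra_simps)
next
  case False
  have "1 - exp y \<le> - y" using exp_ge_add_one_self[of y] by linarith
  also have "\<dots> \<le> - y * exp (- y)" using False by (intro mult_le_cancel_left1[THEN iffD2]) auto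
  finally show ?thesis using False by simp
qed

text \<open>
  Applied to the power series of sine and cosine.
\<close>

lemma partial_sum_le_exp_abs:
  fixes x :: real
  assumes "\<And>n. \<bar>c n\<bar> \<le> inverse (fact n)"
  shows "\<bar>\<Sum>n<N. c n * x ^ n\<bar> \<le> exp \<bar>x\<bar>"
proof -
  have "\<bar>\<Sum>n<N. c n * x ^ n\<bar> \<le> (\<Sum>n<N. \<bar>x\<bar> ^ n /\<^sub>R fact n)"
    by (rule order_trans[OF sum_abs sum_mono])
      (use assms in \<open>auto simp: abs_mult power_abs intro!: mult_right_mono\<close>)
  also have "\<dots> \<le> exp \<bar>x\<bar>" unfolding exp_def
    by (rule sum_le_suminf[OF summable_exp_generic]) auto
  finally show ?thesis .
qed

text \<open>
  The phase \<open>c\<close> makes the single family of cosines contain the sines as well.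
\<close>

inductive_set trig_polys :: "('w::real_normed_vector \<Rightarrow> real) set" where
  cos: "(\<lambda>w. cos ((\<phi> :: 'w dual) w + c)) \<in> trig_polys"
| lin: "f \<in> trig_polys \<Longrightarrow> g \<in> trig_polys \<Longrightarrow> (\<lambda>w. a * f w + b * g w) \<in> trig_polys"

lemma trig_polys_mult:
  assumes f: "f \<in> trig_polys" and g: "g \<in> trig_polys"
  shows "(\<lambda>w. f w * g w) \<in> trig_polys"
  using f
proof induct
  case (cos \<phi> c)
  from g show ?case
  proof induct
    case (cos \<psi> d)
    have eq: "(\<lambda>w. cos (\<phi> w + c) * cos (\<psi> w + d)) =
      (\<lambda>w. (1/2) * cos ((\<phi> - \<psi>) w + (c - d)) + (1/2) * cos ((\<phi> + \<psi>) w + (c + d)))"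
      by (auto simp: fun_eq_iff cos_times_cos blinfun.bilinear_simps algebra_simps)
    show ?case unfolding eq by (intro trig_polys.lin trig_polys.cos)
  next
    case (lin h k a b)
    thus ?case using trig_polys.lin[OF lin(2,4), of a b] by (simp add: algebra_simps)
  qed
next
  case (lin h k a b)
  thus ?case using trig_polys.lin[OF lin(2,4), of a b] by (simp add: algebra_simps)
qed

lemma trig_polys_bounded: "f \<in> trig_polys \<Longrightarrow> \<exists>c. \<forall>w. \<bar>f w\<bar> \<le> c"
proof (induct rule: trig_polys.induct)
  case (cos \<phi> c) thus ?case by (intro exI[of _ 1]) auto
next
  case (lin f g a b)
  then obtain c d where cd: "\<And>w. \<bar>f w\<bar> \<le> c" "\<And>w. \<bar>g w\<bar> \<le> d" by blast
  have "\<bar>a * f w + b * g w\<bar> \<le> \<bar>a\<bar> * c + \<bar>b\<bar> * d" for w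
    by (rule order_trans[OF abs_triangle_ineq])
      (use cd in \<open>auto simp: abs_mult intro!: add_mono mult_left_mono\<close>)
  thus ?case by blast
qed

text \<open>
  The exponentials are unbounded, so the bounded version does not apply to them. Difference quotients in
  \<open>t\<close> of \<open>\<phi>\<^sup>n exp (t \<phi>)\<close> are dominated by exponentials, which brings all \<open>\<phi>\<^sup>n\<close> into \<open>K\<close>; then the power
  series of sine and cosine, dominated by \<open>exp \<bar>\<phi>\<bar>\<close>, bring in the trigonometric polynomials. These
  form a bounded algebra that generates the Borel sets.
\<close>

theorem exponential_monotone_class:
  fixes K :: "('w::{real_normed_vector, second_countable_topology} \<Rightarrow> real) set"
  assumes exp: "\<And>\<phi> :: 'w dual. (\<lambda>w. exp (\<phi> w)) \<in> K"
    and lin: "\<And>f g a b. f \<in> K \<Longrightarrow> g \<in> K \<Longrightarrow> (\<lambda>w. a * f w + b * g w) \<in> K"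
    and lim: "\<And>F f c (\<psi> :: 'w dual). (\<And>k::nat. F k \<in> K) \<Longrightarrow>
        (\<And>k w. \<bar>F k w\<bar> \<le> c * (exp (\<psi> w) + exp (- \<psi> w))) \<Longrightarrow>
        (\<And>w. (\<lambda>k. F k w) \<longlonglongrightarrow> f w) \<Longrightarrow> f \<in> K"
    and S: "S \<in> sets borel"
  shows "indicator S \<in> K"
proof -
  have exp_abs: "exp \<bar>x\<bar> \<le> exp x + exp (- x)" for x :: real by (cases "x \<ge> 0") auto
  have pow: "(\<lambda>w. \<phi> w ^ n * exp (t * \<phi> w)) \<in> K" for \<phi> :: "'w dual" and n t
  proof (induct n arbitrary: t)
    case 0 show ?case using exp[of "t *\<^sub>R \<phi>"] by (simp add: blinfun.bilinear_simps)
  next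
    case (Suc n)
    let ?F = "\<lambda>k w. real (Suc k) * (\<phi> w ^ n * exp ((t + 1 / real (Suc k)) * \<phi> w))
        + (- real (Suc k)) * (\<phi> w ^ n * exp (t * \<phi> w))"
    let ?G = "\<lambda>k w. \<phi> w ^ n * exp (t * \<phi> w) *
        (real (Suc k) * (exp (\<phi> w / real (Suc k)) - 1))"
    have FG: "?F k w = ?G k w" for k w
      by (simp add: algebra_simps exp_add add_divide_distrib)
    show ?case
    proof (rule lim[of ?F "fact (Suc n)" "(\<bar>t\<bar> + 2) *\<^sub>R \<phi>"])
      show "?F k \<in> K" for k by (intro lin Suc)
      show "(\<lambda>k. ?F k w) \<longlonglongrightarrow> \<phi> w ^ Suc n * exp (t * \<phi> w)" for w
      proof -
        have "(exp has_real_derivative 1) (at (0::real))" by (auto intro!: derivative_eq_intros)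
        from tendsto_mult[OF tendsto_const[of "\<phi> w ^ n * exp (t * \<phi> w)"]
            difference_quotient_LIMSEQ[OF this, of "\<phi> w"]]
        show ?thesis unfolding FG by (simp add: mult_ac)
      qed
      show "\<bar>?F k w\<bar> \<le> fact (Suc n) * (exp (((\<bar>t\<bar> + 2) *\<^sub>R \<phi>) w)
          + exp (- ((\<bar>t\<bar> + 2) *\<^sub>R \<phi>) w))" for k w
      proof -
        define x where "x = \<phi> w"
        have q: "\<bar>real (Suc k) * (exp (x / real (Suc k)) - 1)\<bar> \<le> \<bar>x\<bar> * exp \<bar>x\<bar>"
        proof -
          have "\<bar>exp (x / real (Suc k)) - 1\<bar> \<le> \<bar>x / real (Suc k)\<bar> * exp \<bar>x\<bar>"
          proof (rule order_trans[OF abs_exp_minus_one_le], rule mult_left_mono)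
            have "\<bar>x\<bar> * 1 \<le> \<bar>x\<bar> * real (Suc k)" by (rule mult_left_mono) auto
            thus "exp \<bar>x / real (Suc k)\<bar> \<le> exp \<bar>x\<bar>" by (simp add: field_simps)
          qed simp
          hence "real (Suc k) * \<bar>exp (x / real (Suc k)) - 1\<bar> \<le> real (Suc k) * (\<bar>x / real (Suc k)\<bar> * exp \<bar>x\<bar>)"
            by (rule mult_left_mono) simp
          thus ?thesis by (simp only: abs_mult) simp
        qed
        have "\<bar>?F k w\<bar> = \<bar>x\<bar> ^ n * exp (t * x) * \<bar>real (Suc k) * (exp (x / real (Suc k)) - 1)\<bar>"
          unfolding FG by (simp add: x_def abs_mult power_abs)
        also have "\<dots> \<le> \<bar>x\<bar> ^ n * exp (\<bar>t\<bar> * \<bar>x\<bar>) * (\<bar>x\<bar> * exp \<bar>x\<bar>)"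
          by (intro mult_mono q) (auto simp: abs_mult[symmetric])
        also have "\<dots> = \<bar>x\<bar> ^ Suc n * exp ((\<bar>t\<bar> + 1) * \<bar>x\<bar>)" by (simp add: exp_add algebra_simps)
        also have "\<dots> \<le> (fact (Suc n) * exp \<bar>x\<bar>) * exp ((\<bar>t\<bar> + 1) * \<bar>x\<bar>)"
          by (intro mult_right_mono power_le_fact_exp) auto
        also have "\<dots> = fact (Suc n) * exp \<bar>(\<bar>t\<bar> + 2) * x\<bar>"
        proof -
          have "\<bar>(\<bar>t\<bar> + 2) * x\<bar> = \<bar>x\<bar> + (\<bar>t\<bar> + 1) * \<bar>x\<bar>"
            unfolding abs_mult by (simp add: algebra_simps)
          thus ?thesis by (simp only: exp_add mult.assoc)
        qed
        also have "\<dots> \<le> fact (Suc n) * (exp ((\<bar>t\<bar> + 2) * x) + exp (- ((\<bar>t\<bar> + 2) * x)))"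
          by (intro mult_left_mono exp_abs) auto
        finally show ?thesis by (simp add: x_def blinfun.bilinear_simps)
      qed
    qed
  qed
  have zero: "(\<lambda>w. 0) \<in> K" using lin[OF exp exp, of 0 0 0 0] by simp
  have series: "(\<lambda>w. f (\<phi> w)) \<in> K"
    if c: "\<And>n. \<bar>c n\<bar> \<le> inverse (fact n)" "\<And>x. (\<lambda>n. c n * x ^ n) sums f x"
    for c :: "nat \<Rightarrow> real" and f and \<phi> :: "'w dual"
  proof (rule lim[of "\<lambda>N w. \<Sum>n<N. c n * \<phi> w ^ n" 1 \<phi>])
    show "(\<lambda>w. \<Sum>n<N. c n * \<phi> w ^ n) \<in> K" for N
    proof (induct N)
      case (Suc N)
      from lin[OF Suc pow[of \<phi> N 0], of 1 "c N"] show ?case by simp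
    qed (use zero in simp)
    show "\<bar>\<Sum>n<N. c n * \<phi> w ^ n\<bar> \<le> 1 * (exp (\<phi> w) + exp (- \<phi> w))" for N w
      using order_trans[OF partial_sum_le_exp_abs[OF c(1)] exp_abs] by simp
    show "(\<lambda>N. \<Sum>n<N. c n * \<phi> w ^ n) \<longlonglongrightarrow> f (\<phi> w)" for w
      using c(2) unfolding sums_def by auto
  qed
  have coeff: "\<bar>cos_coeff n\<bar> \<le> inverse (fact n)" "\<bar>sin_coeff n\<bar> \<le> inverse (fact n)" for n
    by (auto simp: cos_coeff_def sin_coeff_def inverse_eq_divide abs_divide power_abs)
  have cosK: "(\<lambda>w. cos (\<phi> w)) \<in> K" for \<phi> :: "'w dual"
    by (rule series[OF coeff(1) cos_converges[where 'a=real, unfolded real_scaleR_def]])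
  have sinK: "(\<lambda>w. sin (\<phi> w)) \<in> K" for \<phi> :: "'w dual"
    by (rule series[OF coeff(2) sin_converges[where 'a=real, unfolded real_scaleR_def]])
  have sub: "trig_polys \<subseteq> K"
  proof
    fix f :: "'w \<Rightarrow> real" assume "f \<in> trig_polys"
    thus "f \<in> K"
    proof induct
      case (cos \<phi> c)
      have eq: "(\<lambda>w. cos (\<phi> w + c)) = (\<lambda>w. cos c * cos (\<phi> w) + (- sin c) * sin (\<phi> w))"
        by (auto simp: cos_add)
      show ?case unfolding eq by (intro lin cosK sinK)
    qed (auto intro: lin)
  qed
  let ?G = "{{w. c < f w} | f c. f \<in> trig_polys} :: 'w set set"
  have "sets borel \<subseteq> sets (sigma UNIV ?G)"
  proof (rule borel_subset_if_functionals_measurable)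
    fix \<phi> :: "'w dual"
    have trig: "f \<in> borel_measurable (sigma UNIV ?G)" if "f \<in> trig_polys" for f
      by (rule borel_measurableI_greater) (use that in auto)
    have 1: "(\<lambda>w. real (Suc k) * sin (\<phi> w / real (Suc k))) \<in> borel_measurable (sigma UNIV ?G)" for k
    proof -
      have eq: "(\<lambda>w. sin (\<phi> w / real (Suc k))) =
          (\<lambda>w. cos (blinfun_apply ((1 / real (Suc k)) *\<^sub>R \<phi>) w + (- pi / 2)))"
        by (auto simp: fun_eq_iff blinfun.bilinear_simps cos_diff)
      have "(\<lambda>w. sin (\<phi> w / real (Suc k))) \<in> borel_measurable (sigma UNIV ?G)"
        unfolding eq by (intro trig trig_polys.cos)
      thus ?thesis by measurable
    qed
    have 2: "(\<lambda>k. real (Suc k) * sin (\<phi> w / real (Suc k))) \<longlonglongrightarrow> \<phi> w" for w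
      using difference_quotient_LIMSEQ[of sin 1 "\<phi> w"] DERIV_sin[of "0::real"] by simp
    show "blinfun_apply \<phi> \<in> borel_measurable (sigma UNIV ?G)"
      using 2 1 by (rule borel_measurable_LIMSEQ_real)
  qed simp
  hence S': "S \<in> sigma_sets UNIV ?G" using S by auto
  show ?thesis
  proof (rule functional_monotone_class[OF lin _ sub _ _ trig_polys_mult trig_polys_bounded S'])
    show "(\<lambda>w. 1) \<in> trig_polys" using trig_polys.cos[of 0 0] by simp
    show "f \<in> K" if "\<And>k::nat. F k \<in> K" "\<And>k x. \<bar>F k x\<bar> \<le> c" "\<And>x. (\<lambda>k. F k x) \<longlonglongrightarrow> f x" for F f c
      by (rule lim[of F "c / 2" 0]) (use that in auto)
  qed (auto intro: trig_polys.lin)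
qed

section \<open>Gaussian variables and the map \<open>\<delta>\<close>\<close>

lemma power2_diff_le: "(a - b)\<^sup>2 \<le> 2 * a\<^sup>2 + 2 * b\<^sup>2" for a b :: real
proof -
  have "0 \<le> (a + b)\<^sup>2" by simp
  thus ?thesis by (simp add: power2_eq_square algebra_simps)
qed

lemma square_integrable_diff:
  fixes f g :: "'a \<Rightarrow> real"
  assumes [measurable]: "f \<in> borel_measurable M" "g \<in> borel_measurable M"
    and "integrable M (\<lambda>x. (f x)\<^sup>2)" "integrable M (\<lambda>x. (g x)\<^sup>2)"
  shows "integrable M (\<lambda>x. (f x - g x)\<^sup>2)"
proof (rule Bochner_Integration.integrable_bound)
  show "integrable M (\<lambda>x. 2 * (f x)\<^sup>2 + 2 * (g x)\<^sup>2)" using assms by auto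
  show "AE x in M. norm ((f x - g x)\<^sup>2) \<le> norm (2 * (f x)\<^sup>2 + 2 * (g x)\<^sup>2)"
    using power2_diff_le by (auto simp: abs_of_nonneg)
qed simp

text \<open>
  A subsequence whose increments are summable in \<open>L\<^sup>1\<close> converges almost everywhere, and Fatou's lemma
  turns the Cauchy property into convergence in \<open>L\<^sup>2\<close> to its limit.
\<close>

lemma (in finite_measure) L2_complete:
  fixes Y :: "nat \<Rightarrow> 'a \<Rightarrow> real"
  assumes meas [measurable]: "\<And>m. Y m \<in> borel_measurable M"
    and sq: "\<And>m. integrable M (\<lambda>x. (Y m x)\<^sup>2)"
    and Cauchy: "\<And>e. 0 < e \<Longrightarrow> \<exists>N. \<forall>m\<ge>N. \<forall>n\<ge>N. (LINT x|M. (Y m x - Y n x)\<^sup>2) < e"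
  obtains Z where "Z \<in> borel_measurable M" "integrable M (\<lambda>x. (Z x)\<^sup>2)"
    "(\<lambda>m. LINT x|M. (Y m x - Z x)\<^sup>2) \<longlonglongrightarrow> 0"
proof -
  have "\<forall>k. \<exists>N. \<forall>m\<ge>N. \<forall>n\<ge>N. (LINT x|M. (Y m x - Y n x)\<^sup>2) < (1/4) ^ k"
    using Cauchy by simp
  then obtain N where N: "\<And>k m n. m \<ge> N k \<Longrightarrow> n \<ge> N k \<Longrightarrow> (LINT x|M. (Y m x - Y n x)\<^sup>2) < (1/4) ^ k"
    by metis
  \<comment> \<open>The sum makes \<open>r (Suc k)\<close> exceed \<open>N k\<close> as well; the term \<open>k\<close> makes \<open>r\<close> unbounded.\<close>
  define r where "r k = k + (\<Sum>i\<le>k. N i)" for k :: nat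
  have rN: "r k \<ge> N k" "r (Suc k) \<ge> N k" "r k \<ge> k" for k
  proof -
    have "N k \<le> sum N {..k}" by (rule member_le_sum) auto
    thus "r k \<ge> N k" "r (Suc k) \<ge> N k" "r k \<ge> k" by (auto simp: r_def)
  qed
  define D where "D k x = Y (r (Suc k)) x - Y (r k) x" for k x
  have Dm [measurable]: "D k \<in> borel_measurable M" for k unfolding D_def[abs_def] by simp
  have D: "(LINT x|M. (D k x)\<^sup>2) \<le> (1/4) ^ k" for k
    unfolding D_def using N[OF rN(2) rN(1), of k] by simp
  have Dsq: "integrable M (\<lambda>x. (D k x)\<^sup>2)" for k
    unfolding D_def by (rule square_integrable_diff[OF meas meas sq sq])
  have Dint: "(\<integral>\<^sup>+x. ennreal \<bar>D k x\<bar> \<partial>M) \<le> ennreal ((1/2) ^ k * (measure M (space M) + 1))" for k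
  proof -
    \<comment> \<open>From \<open>2 a b \<le> a\<^sup>2 + b\<^sup>2\<close> with \<open>a = 2\<^sup>-\<^sup>k\<close>, balancing the bound \<open>4\<^sup>-\<^sup>k\<close> on the square.\<close>
    have "(\<integral>\<^sup>+x. ennreal \<bar>D k x\<bar> \<partial>M) \<le> (\<integral>\<^sup>+x. ennreal ((1/2) ^ k + 2 ^ k * (D k x)\<^sup>2) \<partial>M)"
    proof (rule nn_integral_mono, rule ennreal_leI)
      fix x
      have "0 \<le> ((1/2) ^ k - \<bar>D k x\<bar>)\<^sup>2" by simp
      hence "2 * (1/2) ^ k * \<bar>D k x\<bar> \<le> (1/2) ^ k * (1/2) ^ k + (D k x)\<^sup>2"
        by (simp add: power2_eq_square algebra_simps)
      hence "2 ^ k * (2 * (1/2) ^ k * \<bar>D k x\<bar>) \<le> 2 ^ k * ((1/2) ^ k * (1/2) ^ k + (D k x)\<^sup>2)"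
        by (rule mult_left_mono) simp
      also have "2 ^ k * (2 * (1/2) ^ k * \<bar>D k x\<bar>) = 2 * \<bar>D k x\<bar>"
        by (simp add: power_one_over)
      also have "2 ^ k * ((1/2) ^ k * (1/2) ^ k + (D k x)\<^sup>2) = (1/2) ^ k + 2 ^ k * (D k x)\<^sup>2"
        by (simp add: power_one_over algebra_simps)
      finally show "\<bar>D k x\<bar> \<le> (1/2) ^ k + 2 ^ k * (D k x)\<^sup>2"
        using abs_ge_zero[of "D k x"] by linarith
    qed
    also have "\<dots> = ennreal (LINT x|M. (1/2) ^ k + 2 ^ k * (D k x)\<^sup>2)"
      using Dsq by (intro nn_integral_eq_integral) (auto intro!: AE_I2 add_nonneg_nonneg)
    also have "(LINT x|M. (1/2) ^ k + 2 ^ k * (D k x)\<^sup>2) = (1/2) ^ k * measure M (space M) + 2 ^ k * (LINT x|M. (D k x)\<^sup>2)"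
      using Dsq by (subst Bochner_Integration.integral_add) auto
    also have "\<dots> \<le> (1/2) ^ k * measure M (space M) + 2 ^ k * (1/4) ^ k"
      using D by (intro add_left_mono mult_left_mono) auto
    also have "(2::real) ^ k * (1/4) ^ k = (1/2) ^ k"
      by (simp add: power_mult_distrib[symmetric])
    finally show ?thesis by (simp add: ennreal_leI algebra_simps)
  qed
  have "(\<integral>\<^sup>+x. (\<Sum>k. ennreal \<bar>D k x\<bar>) \<partial>M) = (\<Sum>k. \<integral>\<^sup>+x. ennreal \<bar>D k x\<bar> \<partial>M)"
    by (rule nn_integral_suminf) simp
  also have "\<dots> \<le> (\<Sum>k. ennreal ((1/2) ^ k * (measure M (space M) + 1)))"
    by (intro suminf_le Dint) auto
  also have "\<dots> < \<infinity>"
    by (subst suminf_ennreal2) (auto intro!: summable_mult2 mult_nonneg_nonneg add_nonneg_nonneg)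
  finally have fin: "AE x in M. (\<Sum>k. ennreal \<bar>D k x\<bar>) \<noteq> \<infinity>"
    by (intro nn_integral_PInf_AE) auto
  have conv: "AE x in M. convergent (\<lambda>k. Y (r k) x)"
    using fin
  proof eventually_elim
    case (elim x)
    hence "summable (\<lambda>k. \<bar>D k x\<bar>)"
      by (intro summable_suminf_not_top) auto
    hence "summable (\<lambda>k. D k x)" by (rule summable_rabs_cancel)
    hence "summable (\<lambda>k. Y (r (Suc k)) x - Y (r k) x)" by (simp add: D_def)
    then obtain L where "(\<lambda>n. \<Sum>k<n. Y (r (Suc k)) x - Y (r k) x) \<longlonglongrightarrow> L"
      unfolding summable_def sums_def by blast
    hence "(\<lambda>n. Y (r n) x - Y (r 0) x) \<longlonglongrightarrow> L"
      unfolding sum_lessThan_telescope[of "\<lambda>k. Y (r k) x"] .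
    from tendsto_add[OF this tendsto_const[of "Y (r 0) x"]] show ?case
      by (auto simp: convergent_def)
  qed
  define Z where "Z x = lim (\<lambda>k. Y (r k) x)" for x
  have Zm [measurable]: "Z \<in> borel_measurable M" unfolding Z_def by measurable
  have Zlim: "AE x in M. (\<lambda>k. Y (r k) x) \<longlonglongrightarrow> Z x"
    using conv by eventually_elim (simp add: Z_def convergent_LIMSEQ_iff)
  have bound: "(\<integral>\<^sup>+x. ennreal ((Y m x - Z x)\<^sup>2) \<partial>M) \<le> ennreal e"
    if K: "\<And>m n. m \<ge> K \<Longrightarrow> n \<ge> K \<Longrightarrow> (LINT x|M. (Y m x - Y n x)\<^sup>2) < e" and m: "m \<ge> K" for K m e
  proof -
    have "(\<integral>\<^sup>+x. ennreal ((Y m x - Z x)\<^sup>2) \<partial>M) = (\<integral>\<^sup>+x. liminf (\<lambda>k. ennreal ((Y m x - Y (r k) x)\<^sup>2)) \<partial>M)"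
    proof (rule nn_integral_cong_AE)
      show "AE x in M. ennreal ((Y m x - Z x)\<^sup>2) = liminf (\<lambda>k. ennreal ((Y m x - Y (r k) x)\<^sup>2))"
        using Zlim
      proof eventually_elim
        case (elim x)
        hence "(\<lambda>k. ennreal ((Y m x - Y (r k) x)\<^sup>2)) \<longlonglongrightarrow> ennreal ((Y m x - Z x)\<^sup>2)"
          by (intro tendsto_intros)
        from lim_imp_Liminf[OF trivial_limit_sequentially this] show ?case by simp
      qed
    qed
    also have "\<dots> \<le> liminf (\<lambda>k. \<integral>\<^sup>+x. ennreal ((Y m x - Y (r k) x)\<^sup>2) \<partial>M)"
      by (rule nn_integral_liminf) simp
    also have "\<dots> \<le> ennreal e"
    proof (rule Liminf_le)
      show "eventually (\<lambda>k. (\<integral>\<^sup>+x. ennreal ((Y m x - Y (r k) x)\<^sup>2) \<partial>M) \<le> ennreal e) sequentially"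
        unfolding eventually_sequentially
      proof (intro exI[of _ K] allI impI)
        fix k assume "K \<le> k"
        hence "(LINT x|M. (Y m x - Y (r k) x)\<^sup>2) < e" using K[OF m] rN(3)[of k] by auto
        moreover have "(\<integral>\<^sup>+x. ennreal ((Y m x - Y (r k) x)\<^sup>2) \<partial>M) = ennreal (LINT x|M. (Y m x - Y (r k) x)\<^sup>2)"
          by (intro nn_integral_eq_integral square_integrable_diff sq meas) auto
        ultimately show "(\<integral>\<^sup>+x. ennreal ((Y m x - Y (r k) x)\<^sup>2) \<partial>M) \<le> ennreal e"
          by (simp add: ennreal_leI)
      qed
    qed simp
    finally show ?thesis .
  qed
  have int: "integrable M (\<lambda>x. (Y m x - Z x)\<^sup>2)" if "m \<ge> N 0" for m
  proof (rule integrableI_bounded)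
    show "(\<integral>\<^sup>+ x. ennreal (norm ((Y m x - Z x)\<^sup>2)) \<partial>M) < \<infinity>"
      using bound[of "N 0" 1 m] N[of 0] that by (auto intro: le_less_trans)
  qed simp
  have Zsq: "integrable M (\<lambda>x. (Z x)\<^sup>2)"
    using square_integrable_diff[OF _ _ sq[of "N 0"] int[of "N 0"]] by simp
  have "(\<lambda>m. LINT x|M. (Y m x - Z x)\<^sup>2) \<longlonglongrightarrow> 0"
  proof (rule LIMSEQ_I)
    fix e :: real assume e: "0 < e"
    obtain K where K: "\<And>m n. m \<ge> K \<Longrightarrow> n \<ge> K \<Longrightarrow> (LINT x|M. (Y m x - Y n x)\<^sup>2) < e / 2"
      using Cauchy[of "e / 2"] e by auto
    have "(LINT x|M. (Y m x - Z x)\<^sup>2) < e" if m: "m \<ge> K" for m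
    proof -
      have "ennreal (LINT x|M. (Y m x - Z x)\<^sup>2) = (\<integral>\<^sup>+x. ennreal ((Y m x - Z x)\<^sup>2) \<partial>M)"
        by (intro nn_integral_eq_integral[symmetric] square_integrable_diff sq Zsq meas Zm) auto
      also have "\<dots> \<le> ennreal (e / 2)" by (rule bound[OF K m])
      finally show ?thesis using e by (simp add: ennreal_le_iff)
    qed
    thus "\<exists>no. \<forall>n\<ge>no. norm ((LINT x|M. (Y n x - Z x)\<^sup>2) - 0) < e" by auto
  qed
  thus thesis using that Zm Zsq by blast
qed

context prob_space
begin

text \<open>
  Specified through the characteristic function so that the degenerate case \<open>v = 0\<close> is included and limits
  are immediate.
\<close>

definition gaussian :: "real \<Rightarrow> ('a \<Rightarrow> real) \<Rightarrow> bool" where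
  "gaussian v Y \<longleftrightarrow> Y \<in> borel_measurable M \<and> 0 \<le> v \<and>
     (\<forall>t. (LINT w|M. iexp (t * Y w)) = complex_of_real (exp (- (t\<^sup>2 * v) / 2)))"

text \<open>
  By uniqueness of characteristic functions; this reduces all moments to those of the standard normal
  distribution, without separating the case \<open>v = 0\<close>.
\<close>

lemma gaussian_distr:
  assumes Y: "gaussian v Y"
  shows "distr M borel Y = distr std_normal_distribution borel (\<lambda>x. sqrt v * x)"
proof (rule Levy_uniqueness)
  have [measurable]: "Y \<in> borel_measurable M" using Y by (simp add: gaussian_def)
  interpret N: real_distribution std_normal_distribution by (rule real_dist_normal_dist)
  show "real_distribution (distr M borel Y)" by simp
  show "real_distribution (distr std_normal_distribution borel (\<lambda>x. sqrt v * x))"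
    by (rule N.real_distribution_distr) simp
  show "char (distr M borel Y) = char (distr std_normal_distribution borel (\<lambda>x. sqrt v * x))"
  proof
    fix t
    have "char (distr M borel Y) t = complex_of_real (exp (- (t\<^sup>2 * v) / 2))"
      unfolding char_def using Y by (subst integral_distr) (auto simp: gaussian_def)
    also have "\<dots> = char std_normal_distribution (t * sqrt v)"
      using Y by (simp add: char_std_normal_distribution gaussian_def power_mult_distrib)
    also have "\<dots> = char (distr std_normal_distribution borel (\<lambda>x. sqrt v * x)) t"
      unfolding char_def by (subst integral_distr) (auto simp: mult.assoc)
    finally show "char (distr M borel Y) t = char (distr std_normal_distribution borel (\<lambda>x. sqrt v * x)) t" .
  qed
qed

lemma gaussian_transfer:
  fixes g :: "real \<Rightarrow> real"
  assumes Y: "gaussian v Y" and g [measurable]: "g \<in> borel_measurable borel"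
  shows "integrable M (\<lambda>w. g (Y w)) \<longleftrightarrow> integrable std_normal_distribution (\<lambda>x. g (sqrt v * x))"
    and "(LINT w|M. g (Y w)) = (LINT x|std_normal_distribution. g (sqrt v * x))"
proof -
  have [measurable]: "Y \<in> borel_measurable M" using Y by (simp add: gaussian_def)
  have 1: "integrable M (\<lambda>w. g (Y w)) \<longleftrightarrow> integrable (distr M borel Y) g"
    by (rule integrable_distr_eq[symmetric]) auto
  have 2: "(LINT w|M. g (Y w)) = integral\<^sup>L (distr M borel Y) g"
    by (rule integral_distr[symmetric]) auto
  show "integrable M (\<lambda>w. g (Y w)) \<longleftrightarrow> integrable std_normal_distribution (\<lambda>x. g (sqrt v * x))"
    unfolding 1 gaussian_distr[OF Y] by (rule integrable_distr_eq) auto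
  show "(LINT w|M. g (Y w)) = (LINT x|std_normal_distribution. g (sqrt v * x))"
    unfolding 2 gaussian_distr[OF Y] by (rule integral_distr) auto
qed

lemma std_normal_exp:
  "integrable std_normal_distribution (\<lambda>x. exp (s * x))"
  "(LINT x|std_normal_distribution. exp (s * x)) = exp (s\<^sup>2 / 2)"
proof -
  \<comment> \<open>Completing the square.\<close>
  have eq: "std_normal_density x * exp (s * x) = exp (s\<^sup>2 / 2) * normal_density s 1 x" for x
    unfolding normal_density_def by (simp add: exp_add[symmetric] power2_eq_square field_simps)
  show "integrable std_normal_distribution (\<lambda>x. exp (s * x))"
    by (subst integrable_density) (auto simp: eq normal_density_nonneg)
  show "(LINT x|std_normal_distribution. exp (s * x)) = exp (s\<^sup>2 / 2)"
    by (subst integral_density) (auto simp: eq normal_density_nonneg)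
qed

lemma gaussian_exp:
  assumes Y: "gaussian v Y"
  shows "integrable M (\<lambda>w. exp (Y w))" "(LINT w|M. exp (Y w)) = exp (v / 2)"
  using gaussian_transfer[OF Y, of exp] std_normal_exp[of "sqrt v"] Y
  by (auto simp: gaussian_def)

lemma gaussian_square:
  assumes Y: "gaussian v Y"
  shows "integrable M (\<lambda>w. (Y w)\<^sup>2)" "(LINT w|M. (Y w)\<^sup>2) = v"
  using gaussian_transfer[OF Y, of power2] integrable_std_normal_distribution_moment[of 2]
    std_normal_distribution_even_moments[of 1] Y
  by (auto simp: gaussian_def power_mult_distrib)

text \<open>
  Characteristic functions converge because \<open>exp (i t x)\<close> is Lipschitz in \<open>x\<close> and the \<open>L\<^sup>1\<close> norm is at most
  the \<open>L\<^sup>2\<close> norm.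
\<close>

lemma gaussian_limit:
  assumes Y: "\<And>m. gaussian (v m) (Y m)" and v: "v \<longlonglongrightarrow> u"
    and Z [measurable]: "Z \<in> borel_measurable M"
    and sq: "\<And>m. integrable M (\<lambda>w. (Y m w - Z w)\<^sup>2)"
    and lim: "(\<lambda>m. LINT w|M. (Y m w - Z w)\<^sup>2) \<longlonglongrightarrow> 0"
  shows "gaussian u Z"
  unfolding gaussian_def
proof (intro conjI allI)
  show "0 \<le> u" using v Y by (intro LIMSEQ_le_const[OF v]) (auto simp: gaussian_def)
  fix t
  have Ym [measurable]: "Y m \<in> borel_measurable M" for m using Y by (simp add: gaussian_def)
  have "(\<lambda>m. (LINT w|M. iexp (t * Y m w)) - (LINT w|M. iexp (t * Z w))) \<longlonglongrightarrow> 0"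
  proof (rule Lim_null_comparison)
    show "eventually (\<lambda>m. norm ((LINT w|M. iexp (t * Y m w)) - (LINT w|M. iexp (t * Z w)))
        \<le> \<bar>t\<bar> * sqrt (LINT w|M. (Y m w - Z w)\<^sup>2)) sequentially"
    proof (rule always_eventually, rule allI)
      fix m
      have int: "integrable M (\<lambda>w. iexp (t * U w))" if [measurable]: "U \<in> borel_measurable M" for U
        by (rule integrable_const_bound[where B = 1]) auto
      have i1: "integrable M (\<lambda>w. \<bar>Y m w - Z w\<bar>)"
        using square_integrable_imp_integrable[OF _ sq[of m]] by auto
      have "norm ((LINT w|M. iexp (t * Y m w)) - (LINT w|M. iexp (t * Z w)))
          = norm (LINT w|M. iexp (t * Y m w) - iexp (t * Z w))"
        by (rule arg_cong[where f = norm], rule Bochner_Integration.integral_diff[symmetric]) (intro int; simp)+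
      also have "\<dots> \<le> (LINT w|M. \<bar>t\<bar> * \<bar>Y m w - Z w\<bar>)"
      proof (rule order_trans[OF integral_norm_bound], rule integral_mono)
        show "integrable M (\<lambda>w. norm (iexp (t * Y m w) - iexp (t * Z w)))"
          by (intro integrable_norm Bochner_Integration.integrable_diff int) auto
        show "integrable M (\<lambda>w. \<bar>t\<bar> * \<bar>Y m w - Z w\<bar>)" using i1 by auto
        fix w
        have "iexp (t * Y m w) - iexp (t * Z w) = iexp (t * Z w) * (iexp (t * (Y m w - Z w)) - 1)"
          by (simp add: exp_add[symmetric] algebra_simps)
        hence "norm (iexp (t * Y m w) - iexp (t * Z w)) = norm (iexp (t * (Y m w - Z w)) - 1)"
          by (simp add: norm_mult)
        also have "\<dots> \<le> \<bar>t * (Y m w - Z w)\<bar>"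
          using iexp_approx1[of "t * (Y m w - Z w)" 0] by simp
        finally show "norm (iexp (t * Y m w) - iexp (t * Z w)) \<le> \<bar>t\<bar> * \<bar>Y m w - Z w\<bar>"
          by (simp add: abs_mult)
      qed
      also have "\<dots> = \<bar>t\<bar> * (LINT w|M. \<bar>Y m w - Z w\<bar>)" by simp
      also have "(LINT w|M. \<bar>Y m w - Z w\<bar>) \<le> sqrt (LINT w|M. (Y m w - Z w)\<^sup>2)"
        using variance_positive[of "\<lambda>w. \<bar>Y m w - Z w\<bar>"] variance_eq[OF i1] sq[of m]
        by (intro real_le_rsqrt) auto
      finally show "norm ((LINT w|M. iexp (t * Y m w)) - (LINT w|M. iexp (t * Z w)))
        \<le> \<bar>t\<bar> * sqrt (LINT w|M. (Y m w - Z w)\<^sup>2)" by (simp add: mult_left_mono)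
    qed
    show "(\<lambda>m. \<bar>t\<bar> * sqrt (LINT w|M. (Y m w - Z w)\<^sup>2)) \<longlonglongrightarrow> 0"
      using tendsto_mult[OF tendsto_const[of "\<bar>t\<bar>"] tendsto_real_sqrt[OF lim]] by simp
  qed
  hence "(\<lambda>m. LINT w|M. iexp (t * Y m w)) \<longlonglongrightarrow> (LINT w|M. iexp (t * Z w))"
    by (rule LIM_zero_cancel)
  moreover have "(\<lambda>m. LINT w|M. iexp (t * Y m w)) = (\<lambda>m. complex_of_real (exp (- (t\<^sup>2 * v m) / 2)))"
    using Y by (auto simp: gaussian_def)
  moreover have "(\<lambda>m. complex_of_real (exp (- (t\<^sup>2 * v m) / 2))) \<longlonglongrightarrow> complex_of_real (exp (- (t\<^sup>2 * u) / 2))"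
    by (intro tendsto_intros v) simp
  ultimately show "(LINT w|M. iexp (t * Z w)) = complex_of_real (exp (- (t\<^sup>2 * u) / 2))"
    using LIMSEQ_unique by metis
qed (rule Z)

end

lemma lp_norm_2: "lp_norm M 2 f = sqrt (LINT x|M. (f x)\<^sup>2)"
proof -
  have "\<bar>y\<bar> powr 2 = y\<^sup>2" for y :: real by (cases "y = 0") (auto simp: powr_numeral)
  thus ?thesis by (simp add: lp_norm_def powr_half_sqrt)
qed

lemma lp_space_2: "f \<in> lp_space M 2 \<longleftrightarrow> f \<in> borel_measurable M \<and> integrable M (\<lambda>x. (f x)\<^sup>2)"
proof -
  have "\<bar>y\<bar> powr 2 = y\<^sup>2" for y :: real by (cases "y = 0") (auto simp: powr_numeral)
  thus ?thesis by (simp add: lp_space_def)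
qed

lemma lp_norm_2_tendsto_0_iff:
  "(\<lambda>m. lp_norm M 2 (f m)) \<longlonglongrightarrow> 0 \<longleftrightarrow> (\<lambda>m. LINT x|M. (f m x)\<^sup>2) \<longlonglongrightarrow> 0"
proof
  assume "(\<lambda>m. lp_norm M 2 (f m)) \<longlonglongrightarrow> 0"
  from tendsto_power[OF this, of 2] show "(\<lambda>m. LINT x|M. (f m x)\<^sup>2) \<longlonglongrightarrow> 0"
    by (simp add: lp_norm_2)
next
  assume "(\<lambda>m. LINT x|M. (f m x)\<^sup>2) \<longlonglongrightarrow> 0"
  from tendsto_real_sqrt[OF this] show "(\<lambda>m. lp_norm M 2 (f m)) \<longlonglongrightarrow> 0"
    by (simp add: lp_norm_2)
qed

context abstract_wiener_space
begin

abbreviation dual_emb_abbrev :: "('w dual) \<Rightarrow> 'h" (\<open>\<D>\<close>) where "\<D> \<equiv> dual_emb \<iota>"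
abbreviation variance_abbrev :: "('w dual) \<Rightarrow> real" (\<open>\<V>\<close>) where "\<V> \<phi> \<equiv> (norm (\<D> \<phi>))\<^sup>2"
abbreviation delta_abbrev :: "'h \<Rightarrow> 'w \<Rightarrow> real" (\<open>\<delta>\<close>) where "\<delta> \<equiv> delta \<mu> \<iota>"
abbreviation stoch_exp_abbrev :: "'h \<Rightarrow> 'w \<Rightarrow> real" (\<open>\<E>\<close>) where "\<E> \<equiv> stoch_exp \<mu> \<iota>"
abbreviation multiple_integral_abbrev :: "nat \<Rightarrow> 'h \<Rightarrow> 'w \<Rightarrow> real" (\<open>\<I>\<close>) where
  "\<I> \<equiv> multiple_integral_power \<mu> \<iota>"

lemma functional_measurable [measurable]:
  "blinfun_apply (\<phi> :: 'w dual) \<in> borel_measurable \<mu>"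
proof -
  have "blinfun_apply \<phi> \<in> borel_measurable borel"
    by (intro borel_measurable_continuous_onI linear_continuous_on blinfun.bounded_linear_right)
  thus ?thesis using measurable_cong_sets[OF sets_eq_borel refl] by metis
qed

lemmas dual_linear = dual_emb_linear[OF bounded_linear_embedding]

lemma gaussian_functional: "gaussian (\<V> \<phi>) (blinfun_apply \<phi>)"
  unfolding gaussian_def
proof (intro conjI allI)
  fix t
  have "(LINT w|\<mu>. iexp (t * \<phi> w)) = (LINT w|\<mu>. iexp ((t *\<^sub>R \<phi>) w))"
    by (simp add: blinfun.bilinear_simps)
  also have "\<dots> = exp (- \<V> (t *\<^sub>R \<phi>) / 2)"
    using characteristic_functional[of "t *\<^sub>R \<phi>"] by simp
  finally show "(LINT w|\<mu>. iexp (t * \<phi> w)) = complex_of_real (exp (- (t\<^sup>2 * \<V> \<phi>) / 2))"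
    by (simp add: dual_linear power_mult_distrib)
qed auto

text \<open>
  The isometry from \<open>W\<^sup>*\<close>, with the norm of \<open>H\<close>, into \<open>L\<^sup>2\<close>.
\<close>

lemma functional_diff_sq:
  fixes \<phi> \<psi> :: "'w dual"
  shows "(LINT w|\<mu>. (\<phi> w - \<psi> w)\<^sup>2) = (norm (\<D> \<phi> - \<D> \<psi>))\<^sup>2"
  using gaussian_square(2)[OF gaussian_functional[of "\<phi> - \<psi>"]]
  by (simp add: dual_linear blinfun.bilinear_simps)

lemma functionals_tending_to:
  obtains \<psi> :: "nat \<Rightarrow> 'w dual" where "(\<lambda>m. \<D> (\<psi> m)) \<longlonglongrightarrow> h"
proof -
  have "h \<in> closure (range (\<D>))"
    using dense_range_dual_emb[OF bounded_linear_embedding inj_embedding] by simp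
  then obtain x where x: "\<And>m. x m \<in> range (\<D>)" "x \<longlonglongrightarrow> h"
    unfolding closure_sequential by blast
  have "\<forall>m. \<exists>\<psi>. x m = \<D> \<psi>" using x(1) by auto
  then obtain \<psi> where "\<forall>m. x m = \<D> (\<psi> m)" by (rule choice[THEN exE])
  hence "x = (\<lambda>m. \<D> (\<psi> m))" by auto
  with x(2) have "(\<lambda>m. \<D> (\<psi> m)) \<longlonglongrightarrow> h" by simp
  thus thesis by (rule that)
qed

text \<open>
  \<open>\<delta> h\<close> is obtained as the \<open>L\<^sup>2\<close> limit along one sequence of functionals tending to \<open>h\<close>; by the isometry
  every other such sequence has the same limit.
\<close>

lemma delta_spec:
  "\<delta> h \<in> lp_space \<mu> 2 \<and>
     (\<forall>\<phi> :: nat \<Rightarrow> 'w dual. (\<lambda>m. \<D> (\<phi> m)) \<longlonglongrightarrow> h \<longrightarrow>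
        (\<lambda>m. lp_norm \<mu> 2 (\<lambda>w. (\<phi> m) w - \<delta> h w)) \<longlonglongrightarrow> 0)"
proof -
  obtain \<psi> :: "nat \<Rightarrow> 'w dual" where \<psi>: "(\<lambda>m. \<D> (\<psi> m)) \<longlonglongrightarrow> h"
    by (rule functionals_tending_to)
  have sqi: "integrable \<mu> (\<lambda>w. (\<phi> w)\<^sup>2)" for \<phi> :: "'w dual"
    by (rule gaussian_square(1)[OF gaussian_functional])
  obtain Z where Z: "Z \<in> borel_measurable \<mu>" "integrable \<mu> (\<lambda>x. (Z x)\<^sup>2)"
    "(\<lambda>m. LINT x|\<mu>. ((\<psi> m) x - Z x)\<^sup>2) \<longlonglongrightarrow> 0"
  proof (rule L2_complete[of "\<lambda>m. blinfun_apply (\<psi> m)"])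
    fix e :: real assume e: "0 < e"
    have "Cauchy (\<lambda>m. \<D> (\<psi> m))" using \<psi> by (rule LIMSEQ_imp_Cauchy)
    then obtain N where N: "\<And>m n. m \<ge> N \<Longrightarrow> n \<ge> N \<Longrightarrow> norm (\<D> (\<psi> m) - \<D> (\<psi> n)) < sqrt e"
      using CauchyD[of _ "sqrt e"] e by (metis real_sqrt_gt_zero)
    show "\<exists>N. \<forall>m\<ge>N. \<forall>n\<ge>N. (LINT x|\<mu>. ((\<psi> m) x - (\<psi> n) x)\<^sup>2) < e"
    proof (intro exI[of _ N] allI impI)
      fix m n assume "N \<le> m" "N \<le> n"
      from N[OF this] have "(norm (\<D> (\<psi> m) - \<D> (\<psi> n)))\<^sup>2 < (sqrt e)\<^sup>2"
        by (intro power_strict_mono) auto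
      thus "(LINT x|\<mu>. ((\<psi> m) x - (\<psi> n) x)\<^sup>2) < e"
        using e by (simp add: functional_diff_sq)
    qed
  qed (use sqi in auto)
  note Z(1)[measurable]
  have "(\<lambda>m. LINT w|\<mu>. ((\<phi> m) w - Z w)\<^sup>2) \<longlonglongrightarrow> 0"
    if \<phi>: "(\<lambda>m. \<D> (\<phi> m)) \<longlonglongrightarrow> h" for \<phi> :: "nat \<Rightarrow> 'w dual"
  proof (rule tendsto_sandwich[OF _ _ tendsto_const])
    let ?b = "\<lambda>m. 2 * (norm (\<D> (\<phi> m) - \<D> (\<psi> m)))\<^sup>2 + 2 * (LINT w|\<mu>. ((\<psi> m) w - Z w)\<^sup>2)"
    show "eventually (\<lambda>m. (LINT w|\<mu>. ((\<phi> m) w - Z w)\<^sup>2) \<le> ?b m) sequentially"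
    proof (rule always_eventually, rule allI)
      fix m
      have i: "integrable \<mu> (\<lambda>w. ((\<phi> m) w - (\<psi> m) w)\<^sup>2)"
        "integrable \<mu> (\<lambda>w. ((\<psi> m) w - Z w)\<^sup>2)" by (intro square_integrable_diff sqi Z; simp)+
      have "(LINT w|\<mu>. ((\<phi> m) w - Z w)\<^sup>2) \<le> (LINT w|\<mu>.
          2 * ((\<phi> m) w - (\<psi> m) w)\<^sup>2 + 2 * ((\<psi> m) w - Z w)\<^sup>2)"
      proof (rule integral_mono)
        show "integrable \<mu> (\<lambda>w. ((\<phi> m) w - Z w)\<^sup>2)" by (intro square_integrable_diff sqi Z) simp
        fix w
        show "((\<phi> m) w - Z w)\<^sup>2 \<le> 2 * ((\<phi> m) w - (\<psi> m) w)\<^sup>2 + 2 * ((\<psi> m) w - Z w)\<^sup>2"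
          using power2_diff_le[of "(\<phi> m) w - (\<psi> m) w" "Z w - (\<psi> m) w"]
          by (simp add: power2_commute[of "Z w"])
      qed (use i in auto)
      also have "\<dots> = ?b m" using i by (simp add: functional_diff_sq)
      finally show "(LINT w|\<mu>. ((\<phi> m) w - Z w)\<^sup>2) \<le> ?b m" .
    qed
    have "(\<lambda>m. \<D> (\<phi> m) - \<D> (\<psi> m)) \<longlonglongrightarrow> 0" using tendsto_diff[OF \<phi> \<psi>] by simp
    hence "(\<lambda>m. norm (\<D> (\<phi> m) - \<D> (\<psi> m))) \<longlonglongrightarrow> 0" by (rule tendsto_norm_zero)
    from tendsto_add[OF tendsto_mult[OF tendsto_const[of 2] tendsto_power[OF this, of 2]] tendsto_mult[OF tendsto_const[of 2] Z(3)]]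
    show "?b \<longlonglongrightarrow> 0" by simp
  qed auto
  hence "Z \<in> lp_space \<mu> 2 \<and> (\<forall>\<phi> :: nat \<Rightarrow> 'w dual. (\<lambda>m. \<D> (\<phi> m)) \<longlonglongrightarrow> h \<longrightarrow>
        (\<lambda>m. lp_norm \<mu> 2 (\<lambda>w. (\<phi> m) w - Z w)) \<longlonglongrightarrow> 0)"
    using Z by (simp add: lp_space_2 lp_norm_2_tendsto_0_iff)
  from someI[where P = "\<lambda>g. g \<in> lp_space \<mu> 2 \<and> (\<forall>\<phi> :: nat \<Rightarrow> 'w dual.
      (\<lambda>m. \<D> (\<phi> m)) \<longlonglongrightarrow> h \<longrightarrow>
        (\<lambda>m. lp_norm \<mu> 2 (\<lambda>w. (\<phi> m) w - g w)) \<longlonglongrightarrow> 0)", OF this]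
  show ?thesis unfolding delta_def .
qed

lemma delta_measurable [measurable]: "\<delta> h \<in> borel_measurable \<mu>"
  and delta_square_integrable: "integrable \<mu> (\<lambda>w. (\<delta> h w)\<^sup>2)"
  using delta_spec[of h] by (auto simp: lp_space_2)

lemma delta_limit:
  "(\<lambda>m. \<D> (\<phi> m)) \<longlonglongrightarrow> h \<Longrightarrow>
    (\<lambda>m. LINT w|\<mu>. ((\<phi> m) w - \<delta> h w)\<^sup>2) \<longlonglongrightarrow> 0"
  using delta_spec[of h] by (simp add: lp_norm_2_tendsto_0_iff)

lemma functional_minus_delta_square_integrable:
  "integrable \<mu> (\<lambda>w. (\<phi> w - \<delta> h w)\<^sup>2)" for \<phi> :: "'w dual"
  by (intro square_integrable_diff gaussian_square(1)[OF gaussian_functional] delta_square_integrable) auto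

lemma delta_dual_emb: "AE w in \<mu>. \<delta> (\<D> \<phi>) w = \<phi> w"
proof -
  have "(\<lambda>m::nat. LINT w|\<mu>. (\<phi> w - \<delta> (\<D> \<phi>) w)\<^sup>2) \<longlonglongrightarrow> 0"
    by (rule delta_limit) simp
  hence "(LINT w|\<mu>. (\<phi> w - \<delta> (\<D> \<phi>) w)\<^sup>2) = 0"
    by (simp add: LIMSEQ_const_iff)
  hence "AE w in \<mu>. (\<phi> w - \<delta> (\<D> \<phi>) w)\<^sup>2 = 0"
    by (subst (asm) integral_nonneg_eq_0_iff_AE)
      (auto intro!: functional_minus_delta_square_integrable)
  thus ?thesis by eventually_elim simp
qed

text \<open>
  The joint Gaussian law of \<open>\<delta> h\<close> and a functional, in the form in which it is used: the variance of
  \<open>s \<delta> h + \<phi>\<close> is the squared norm of \<open>s h + \<phi>\<close> in \<open>H\<close>, by passing to the limit from functionals.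
\<close>

lemma gaussian_delta:
  "gaussian ((norm (s *\<^sub>R h + \<D> \<phi>))\<^sup>2) (\<lambda>w. s * \<delta> h w + \<phi> w)"
proof -
  obtain \<psi> :: "nat \<Rightarrow> 'w dual" where \<psi>: "(\<lambda>m. \<D> (\<psi> m)) \<longlonglongrightarrow> h"
    by (rule functionals_tending_to)
  have eq: "((s *\<^sub>R \<psi> m + \<phi>) w - (s * \<delta> h w + \<phi> w))\<^sup>2
      = s\<^sup>2 * ((\<psi> m) w - \<delta> h w)\<^sup>2" for m w
    by (simp add: blinfun.bilinear_simps power2_eq_square algebra_simps)
  show ?thesis
  proof (rule gaussian_limit[of _ "\<lambda>m. blinfun_apply (s *\<^sub>R \<psi> m + \<phi>)"])
    show "gaussian (\<V> (s *\<^sub>R \<psi> m + \<phi>)) (blinfun_apply (s *\<^sub>R \<psi> m + \<phi>))" for m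
      by (rule gaussian_functional)
    show "(\<lambda>m. \<V> (s *\<^sub>R \<psi> m + \<phi>)) \<longlonglongrightarrow> (norm (s *\<^sub>R h + \<D> \<phi>))\<^sup>2"
      unfolding dual_linear by (intro tendsto_intros \<psi>)
    show "integrable \<mu> (\<lambda>w. ((s *\<^sub>R \<psi> m + \<phi>) w - (s * \<delta> h w + \<phi> w))\<^sup>2)" for m
      unfolding eq using functional_minus_delta_square_integrable by simp
    show "(\<lambda>m. LINT w|\<mu>. ((s *\<^sub>R \<psi> m + \<phi>) w - (s * \<delta> h w + \<phi> w))\<^sup>2) \<longlonglongrightarrow> 0"
      unfolding eq using tendsto_mult[OF tendsto_const[of "s\<^sup>2"] delta_limit[OF \<psi>]] by simp
  qed simp
qed

end

section \<open>Square-integrable functions and Hermite polynomials\<close>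

lemma LINT_Cauchy_Schwarz:
  fixes f g :: "'a \<Rightarrow> real"
  assumes [measurable]: "f \<in> borel_measurable M" "g \<in> borel_measurable M"
    and f: "integrable M (\<lambda>x. (f x)\<^sup>2)" and g: "integrable M (\<lambda>x. (g x)\<^sup>2)"
  shows "integrable M (\<lambda>x. f x * g x)"
    and "(LINT x|M. f x * g x)\<^sup>2 \<le> (LINT x|M. (f x)\<^sup>2) * (LINT x|M. (g x)\<^sup>2)"
proof -
  show int: "integrable M (\<lambda>x. f x * g x)"
  proof (rule Bochner_Integration.integrable_bound)
    show "integrable M (\<lambda>x. (f x)\<^sup>2 + (g x)\<^sup>2)" using f g by auto
    have "\<bar>a * b\<bar> \<le> a\<^sup>2 + b\<^sup>2" for a b :: real
    proof -
      have "0 \<le> (\<bar>a\<bar> - \<bar>b\<bar>)\<^sup>2" by simp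
      hence "2 * (\<bar>a\<bar> * \<bar>b\<bar>) \<le> a\<^sup>2 + b\<^sup>2" by (simp add: power2_eq_square algebra_simps)
      moreover have "0 \<le> \<bar>a\<bar> * \<bar>b\<bar>" by simp
      ultimately show ?thesis unfolding abs_mult by linarith
    qed
    thus "AE x in M. norm (f x * g x) \<le> norm ((f x)\<^sup>2 + (g x)\<^sup>2)"
      by (auto simp: abs_of_nonneg add_nonneg_nonneg)
  qed simp
  let ?A = "LINT x|M. (f x)\<^sup>2" and ?B = "LINT x|M. f x * g x" and ?C = "LINT x|M. (g x)\<^sup>2"
  have q: "0 \<le> t\<^sup>2 * ?A - 2 * t * ?B + ?C" for t
  proof -
    have "0 \<le> (LINT x|M. (t * f x - g x)\<^sup>2)" by simp
    also have "\<dots> = (LINT x|M. t\<^sup>2 * (f x)\<^sup>2 - 2 * t * (f x * g x) + (g x)\<^sup>2)"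
      by (simp add: power2_eq_square algebra_simps)
    finally show ?thesis using f g int by simp
  qed
  show "?B\<^sup>2 \<le> ?A * ?C"
  proof (cases "?A = 0")
    case True
    have "?B = 0"
    proof (rule ccontr)
      assume "?B \<noteq> 0"
      thus False using q[of "(?C + 1) / (2 * ?B)"] True by simp
    qed
    thus ?thesis using True by simp
  next
    case False
    moreover have "0 \<le> ?A" by simp
    ultimately have "0 < ?A" by linarith
    thus ?thesis using q[of "?B / ?A"] by (simp add: power2_eq_square field_simps)
  qed
qed

lemma lp_space_2_lin:
  assumes f: "f \<in> lp_space M 2" and g: "g \<in> lp_space M 2"
  shows "(\<lambda>x. a * f x + b * g x) \<in> lp_space M 2"
proof -
  have "integrable M (\<lambda>x. (a * f x - (- b) * g x)\<^sup>2)"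
    by (rule square_integrable_diff) (use f g in \<open>auto simp: lp_space_2 power_mult_distrib\<close>)
  thus ?thesis using f g by (auto simp: lp_space_2)
qed

lemma lp_space_2_sum:
  assumes "finite I" "\<And>i. i \<in> I \<Longrightarrow> f i \<in> lp_space M 2"
  shows "(\<lambda>x. \<Sum>i\<in>I. c i * f i x) \<in> lp_space M 2"
  using assms
proof (induct I rule: finite_induct)
  case (insert i I)
  have "(\<lambda>x. c i * f i x + 1 * (\<Sum>i\<in>I. c i * f i x)) \<in> lp_space M 2"
    by (rule lp_space_2_lin) (use insert in auto)
  thus ?case using insert by simp
qed (simp add: lp_space_2)

lemma lp_space_2_bound:
  assumes g: "g \<in> lp_space M 2" and f [measurable]: "f \<in> borel_measurable M"
    and le: "\<And>x. \<bar>f x\<bar> \<le> g x"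
  shows "f \<in> lp_space M 2"
proof -
  have "integrable M (\<lambda>x. (f x)\<^sup>2)"
  proof (rule Bochner_Integration.integrable_bound)
    show "integrable M (\<lambda>x. (g x)\<^sup>2)" using g by (simp add: lp_space_2)
    have "(f x)\<^sup>2 \<le> (g x)\<^sup>2" for x using le[of x] by (metis abs_ge_zero power2_abs power_mono)
    thus "AE x in M. norm ((f x)\<^sup>2) \<le> norm ((g x)\<^sup>2)" by simp
  qed simp
  thus ?thesis by (simp add: lp_space_2)
qed

text \<open>
  The lowest coefficient of the difference is its limit at \<open>0\<close>; dividing by a power of \<open>s\<close> repeats the
  argument.
\<close>

lemma power_series_coefficients_unique:
  fixes c d :: "nat \<Rightarrow> real"
  assumes "\<And>s. (\<lambda>n. c n * s ^ n) sums f s" "\<And>s. (\<lambda>n. d n * s ^ n) sums f s"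
  shows "c n = d n"
proof (induct n rule: less_induct)
  case (less n)
  have "((\<lambda>s::real. 0::real) \<longlongrightarrow> (\<lambda>m. c (m + n) - d (m + n)) 0) (at 0)"
  proof (rule powser_limit_0_strong[of 1])
    fix s :: real assume s: "s \<noteq> 0"
    have "(\<lambda>i. c i * s ^ i - d i * s ^ i) sums 0"
      using sums_diff[OF assms(1)[of s] assms(2)[of s]] by simp
    moreover have "(\<Sum>i<n. c i * s ^ i - d i * s ^ i) = 0" using less by simp
    ultimately have "(\<lambda>i. c (i + n) * s ^ (i + n) - d (i + n) * s ^ (i + n)) sums 0"
      using sums_iff_shift[of "\<lambda>i. c i * s ^ i - d i * s ^ i" n 0] by simp
    moreover have "1 / s ^ n * (c (m + n) * s ^ (m + n) - d (m + n) * s ^ (m + n)) = (c (m + n) - d (m + n)) * s ^ m" for m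
      using s by (simp add: power_add field_simps)
    ultimately show "(\<lambda>m. (c (m + n) - d (m + n)) * s ^ m) sums 0"
      using sums_mult[of _ 0 "1 / s ^ n"] by fastforce
  qed simp
  hence "c (0 + n) - d (0 + n) = 0" by (simp add: LIM_const_eq tendsto_const_iff)
  thus ?case by simp
qed

text \<open>
  The coefficients in \<open>s\<close> of \<open>exp (y s\<^sup>2)\<close>.
\<close>

definition even_exp_coeff :: "real \<Rightarrow> nat \<Rightarrow> real" where
  "even_exp_coeff y j = (if even j then y ^ (j div 2) / fact (j div 2) else 0)"

lemma even_exp_coeff_sums: "even_exp_coeff y sums exp y"
proof -
  have "(\<lambda>k. even_exp_coeff y (2 * k)) sums exp y"
    using exp_converges[of y] by (simp add: even_exp_coeff_def divide_inverse mult.commute)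
  thus ?thesis
    by (subst (asm) sums_mono_reindex) (auto simp: strict_mono_def even_exp_coeff_def elim!: evenE)
qed

text \<open>
  The product \<open>Q\<close> of the formal series of \<open>exp (x s)\<close> and \<open>exp (- v s\<^sup>2 / 2)\<close> satisfies
  \<open>Q' = (x - v s) Q\<close>, which is the Hermite recursion for its coefficients. The explicit form gives
  absolute bounds that the recursion does not.
\<close>

lemma hermite_eq_convolution:
  "hermite n v x / fact n = (\<Sum>i\<le>n. x ^ i / fact i * even_exp_coeff (- v / 2) (n - i))"
proof -
  define B where "B = Abs_fps (even_exp_coeff (- v / 2))"
  define Q where "Q = fps_exp x * B"
  have B: "fps_deriv B = fps_const (- v) * (fps_X * B)"
  proof (rule fps_ext)
    fix n show "fps_nth (fps_deriv B) n = fps_nth (fps_const (- v) * (fps_X * B)) n"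
    proof (cases n)
      case (Suc m)
      show ?thesis
      proof (cases "even m")
        case True
        then obtain k where k: "m = 2 * k" by (elim evenE)
        have "real (2 * k + 2) * (y ^ Suc k / fact (Suc k)) = 2 * y * (y ^ k / fact k)" for y :: real
        proof -
          have "real (2 * k + 2) = 2 * real (Suc k)" by simp
          thus ?thesis by (simp del: of_nat_Suc of_nat_add)
        qed
        from this[of "- (v / 2)"] show ?thesis using Suc k
          by (simp add: B_def even_exp_coeff_def algebra_simps)
      qed (use Suc in \<open>simp add: B_def even_exp_coeff_def\<close>)
    qed (simp add: B_def even_exp_coeff_def)
  qed
  have "fps_deriv Q = fps_const x * Q + fps_const (- v) * (fps_X * Q)"
    unfolding Q_def fps_deriv_mult B fps_exp_deriv by (simp only: mult_ac add_ac)
  hence "fps_nth (fps_deriv Q) (Suc n) = fps_nth (fps_const x * Q + fps_const (- v) * (fps_X * Q)) (Suc n)" for n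
    by simp
  hence rec: "real (n + 2) * fps_nth Q (Suc (Suc n)) = x * fps_nth Q (Suc n) - v * fps_nth Q n" for n
    by simp
  have Q0: "fps_nth Q 0 = 1" "fps_nth Q (Suc 0) = x"
    by (simp_all add: Q_def B_def fps_mult_nth even_exp_coeff_def)
  have "hermite n v x / fact n = fps_nth Q n"
  proof (induct n rule: induct_nat_012)
    case (ge2 n)
    have "real (n + 2) * (hermite (Suc (Suc n)) v x / fact (Suc (Suc n)))
        = x * (hermite (Suc n) v x / fact (Suc n)) - v * (hermite n v x / fact n)"
      by (simp add: divide_simps)
    also have "\<dots> = real (n + 2) * fps_nth Q (Suc (Suc n))" unfolding ge2 rec ..
    finally show ?case by (subst (asm) mult_left_cancel) simp_all
  qed (auto simp: Q0)
  thus ?thesis by (simp add: Q_def B_def fps_mult_nth atLeast0AtMost)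
qed

lemma hermite_scale: "hermite n (s\<^sup>2 * v) (s * x) = s ^ n * hermite n v x"
  by (induct n v x rule: hermite.induct) (auto simp: algebra_simps power2_eq_square)

lemma hermite_series:
  shows "(\<lambda>n. hermite n v x / fact n) sums exp (x - v / 2)"
    and "(\<Sum>n<N. \<bar>hermite n v x / fact n\<bar>) \<le> exp (\<bar>x\<bar> + \<bar>v\<bar> / 2)"
proof -
  have a: "(\<lambda>i. y ^ i / fact i) sums exp y" for y :: real
    using exp_converges[of y] by (simp add: divide_inverse mult.commute)
  have na: "norm (x ^ i / fact i) = \<bar>x\<bar> ^ i / fact i" for i by (simp add: power_abs)
  have nb: "norm (even_exp_coeff (- v / 2) j) = even_exp_coeff (\<bar>v\<bar> / 2) j" for j
    by (simp add: even_exp_coeff_def power_abs abs_divide)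
  have sa: "summable (\<lambda>i. norm (x ^ i / fact i))" unfolding na using a by (rule sums_summable)
  have sb: "summable (\<lambda>j. norm (even_exp_coeff (- v / 2) j))"
    unfolding nb using even_exp_coeff_sums by (rule sums_summable)
  show "(\<lambda>n. hermite n v x / fact n) sums exp (x - v / 2)"
    using Cauchy_product_sums[OF sa sb, folded sums_unique[OF a] sums_unique[OF even_exp_coeff_sums]]
    by (simp add: hermite_eq_convolution exp_add[symmetric])
  let ?q = "\<lambda>n. \<Sum>i\<le>n. \<bar>x\<bar> ^ i / fact i * even_exp_coeff (\<bar>v\<bar> / 2) (n - i)"
  have q: "?q sums exp (\<bar>x\<bar> + \<bar>v\<bar> / 2)"
  proof -
    have "norm (\<bar>x\<bar> ^ i / fact i) = \<bar>x\<bar> ^ i / fact i" for i by simp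
    moreover have "norm (even_exp_coeff (\<bar>v\<bar> / 2) j) = even_exp_coeff (\<bar>v\<bar> / 2) j" for j
      by (simp add: even_exp_coeff_def)
    ultimately have "?q sums ((\<Sum>i. \<bar>x\<bar> ^ i / fact i) * suminf (even_exp_coeff (\<bar>v\<bar> / 2)))"
      using sa sb unfolding na nb by (intro Cauchy_product_sums) simp_all
    thus ?thesis
      using sums_unique[OF a[of "\<bar>x\<bar>"]] sums_unique[OF even_exp_coeff_sums[of "\<bar>v\<bar> / 2"]]
      by (simp add: exp_add)
  qed
  have q0: "0 \<le> ?q n" for n
    by (intro sum_nonneg mult_nonneg_nonneg) (auto simp: even_exp_coeff_def)
  have "(\<Sum>n<N. \<bar>hermite n v x / fact n\<bar>) \<le> (\<Sum>n<N. ?q n)"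
  proof (rule sum_mono)
    fix n show "\<bar>hermite n v x / fact n\<bar> \<le> ?q n"
      unfolding hermite_eq_convolution
      by (rule order_trans[OF sum_abs]) (simp add: abs_mult na[simplified] nb[simplified] power_abs)
  qed
  also have "\<dots> \<le> suminf ?q" by (rule sum_le_suminf) (use q q0 in \<open>auto intro: sums_summable\<close>)
  also have "\<dots> = exp (\<bar>x\<bar> + \<bar>v\<bar> / 2)" using q by (rule sums_unique[symmetric])
  finally show "(\<Sum>n<N. \<bar>hermite n v x / fact n\<bar>) \<le> exp (\<bar>x\<bar> + \<bar>v\<bar> / 2)" .
qed

text \<open>
  The bound on the partial sums is the dominating function for the chaos expansion of an exponential.
\<close>

lemma hermite_generating_function:
  assumes "0 \<le> v"
  shows "(\<lambda>n. s ^ n * hermite n v x / fact n) sums exp (s * x - s\<^sup>2 * v / 2)"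
    and "\<bar>\<Sum>n<N. s ^ n * hermite n v x / fact n\<bar> \<le> exp (\<bar>s * x\<bar> + s\<^sup>2 * v / 2)"
proof -
  show "(\<lambda>n. s ^ n * hermite n v x / fact n) sums exp (s * x - s\<^sup>2 * v / 2)"
    using hermite_series(1)[of "s\<^sup>2 * v" "s * x"] by (simp add: hermite_scale)
  show "\<bar>\<Sum>n<N. s ^ n * hermite n v x / fact n\<bar> \<le> exp (\<bar>s * x\<bar> + s\<^sup>2 * v / 2)"
    using order_trans[OF sum_abs hermite_series(2)[of "s\<^sup>2 * v" "s * x" N]] assms
    by (simp add: hermite_scale)
qed

lemma hermite_bound:
  assumes "0 \<le> v" shows "\<bar>hermite n v x\<bar> \<le> fact n * exp (\<bar>x\<bar> + v / 2)"
proof -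
  have "\<bar>hermite n v x / fact n\<bar> \<le> (\<Sum>k<Suc n. \<bar>hermite k v x / fact k\<bar>)"
    by (rule member_le_sum[of n "{..<Suc n}" "\<lambda>k. \<bar>hermite k v x / fact k\<bar>"]) auto
  also have "\<dots> \<le> exp (\<bar>x\<bar> + v / 2)" using hermite_series(2)[of v x "Suc n"] assms by simp
  finally show ?thesis by (simp add: abs_divide field_simps)
qed

lemma hermite_measurable [measurable]: "hermite n v \<in> borel_measurable borel"
proof -
  have "(\<lambda>x. hermite n v x) \<in> borel_measurable borel"
  proof (induct n rule: induct_nat_012)
    case (ge2 n)
    note [measurable] = ge2
    show ?case by simp
  qed auto
  thus ?thesis .
qed

section \<open>The S-transform, \<open>\<Gamma>(\<lambda>)\<close> and the Wick product\<close>

text \<open>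
  The functions with equal integrals under both measures form a class to which
  \<open>exponential_monotone_class\<close> applies, by dominated convergence.
\<close>

lemma Laplace_measure_eqI:
  fixes N1 N2 :: "'w::{real_normed_vector, second_countable_topology} measure"
  assumes sets: "sets N1 = sets borel" "sets N2 = sets borel"
    and fin: "finite_measure N1" "finite_measure N2"
    and int: "\<And>\<phi> :: 'w dual. integrable N1 (\<lambda>w. exp (\<phi> w))"
      "\<And>\<phi> :: 'w dual. integrable N2 (\<lambda>w. exp (\<phi> w))"
    and eq: "\<And>\<phi> :: 'w dual. (LINT w|N1. exp (\<phi> w)) = (LINT w|N2. exp (\<phi> w))"
  shows "N1 = N2"
proof (rule measure_eqI)
  interpret N1: finite_measure N1 by fact
  interpret N2: finite_measure N2 by fact
  let ?K = "{f :: 'w \<Rightarrow> real. integrable N1 f \<and> integrable N2 f \<and> integral\<^sup>L N1 f = integral\<^sup>L N2 f}"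
  fix S assume S: "S \<in> sets N1"
  have "indicator S \<in> ?K"
  proof (rule exponential_monotone_class)
    fix F :: "nat \<Rightarrow> 'w \<Rightarrow> real" and f c and \<psi> :: "'w dual"
    assume F: "\<And>k. F k \<in> ?K"
      and b: "\<And>k w. \<bar>F k w\<bar> \<le> c * (exp (\<psi> w) + exp (- \<psi> w))"
      and l: "\<And>w. (\<lambda>k. F k w) \<longlonglongrightarrow> f w"
    have mF: "F k \<in> borel_measurable borel" for k
      using F[of k] borel_measurable_integrable[of N1 "F k"] measurable_cong_sets[OF sets(1) refl] by auto
    have mf: "f \<in> borel_measurable borel" by (rule borel_measurable_LIMSEQ_real[OF l mF])
    have conv: "integrable N f \<and> (\<lambda>k. integral\<^sup>L N (F k)) \<longlonglongrightarrow> integral\<^sup>L N f"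
      if N: "sets N = sets borel" and i: "\<And>\<phi> :: 'w dual. integrable N (\<lambda>w. exp (\<phi> w))" for N
    proof -
      have "integrable N (\<lambda>w. c * (exp (\<psi> w) + exp (- \<psi> w)))"
        using i[of \<psi>] i[of "- \<psi>"] by (simp add: blinfun.bilinear_simps)
      moreover have "f \<in> borel_measurable N" "\<And>k. F k \<in> borel_measurable N"
        using mf mF measurable_cong_sets[OF N refl] by auto
      ultimately have m: "integrable N (\<lambda>w. c * (exp (\<psi> w) + exp (- \<psi> w)))"
        "f \<in> borel_measurable N" "\<And>k. F k \<in> borel_measurable N" by blast+
      have bd: "AE w in N. norm (F k w) \<le> c * (exp (\<psi> w) + exp (- \<psi> w))" for k
        using b by (intro AE_I2) simp
      have lm: "AE w in N. (\<lambda>k. F k w) \<longlonglongrightarrow> f w" by (intro AE_I2 l)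
      show ?thesis
        using integrable_dominated_convergence[OF m(2,3,1) lm bd] integral_dominated_convergence[OF m(2,3,1) lm bd]
        by blast
    qed
    have "(\<lambda>k. integral\<^sup>L N1 (F k)) = (\<lambda>k. integral\<^sup>L N2 (F k))" using F by simp
    hence "(\<lambda>k. integral\<^sup>L N1 (F k)) \<longlonglongrightarrow> integral\<^sup>L N2 f"
      using conv[OF sets(2) int(2)] by simp
    hence "integral\<^sup>L N1 f = integral\<^sup>L N2 f"
      using conv[OF sets(1) int(1)] by (intro LIMSEQ_unique) auto
    thus "f \<in> ?K" using conv[OF sets(1) int(1)] conv[OF sets(2) int(2)] by blast
  qed (use S sets int eq in auto)
  hence "measure N1 S = measure N2 S" using S sets by simp
  thus "emeasure N1 S = emeasure N2 S" by (simp add: N1.emeasure_eq_measure N2.emeasure_eq_measure)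
qed (use sets in simp)

text \<open>
  The same argument for the signed measure with density \<open>d\<close>, applied to the functions orthogonal to \<open>d\<close>.
\<close>

lemma Laplace_function_eq_0:
  fixes \<mu> :: "'w::{real_normed_vector, second_countable_topology} measure"
  assumes sf: "sigma_finite_measure \<mu>" and sets: "sets \<mu> = sets borel"
    and int: "\<And>\<phi> :: 'w dual. integrable \<mu> (\<lambda>w. d w * exp (\<phi> w))"
    and zero: "\<And>\<phi> :: 'w dual. (LINT w|\<mu>. d w * exp (\<phi> w)) = 0"
  shows "AE w in \<mu>. d w = (0::real)"
proof -
  have d: "integrable \<mu> d" using int[of 0] by simp
  hence dm [measurable]: "d \<in> borel_measurable \<mu>" by auto
  let ?K = "{f. f \<in> borel_measurable \<mu> \<and> integrable \<mu> (\<lambda>w. d w * f w) \<and> (LINT w|\<mu>. d w * f w) = 0}"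
  have em: "(\<lambda>w. exp (\<phi> w)) \<in> borel_measurable \<mu>" for \<phi> :: "'w dual"
  proof -
    have "(\<lambda>w. exp (\<phi> w)) \<in> borel_measurable borel"
      by (intro borel_measurable_continuous_onI continuous_intros linear_continuous_on blinfun.bounded_linear_right)
    thus ?thesis using measurable_cong_sets[OF sets refl] by metis
  qed
  have K: "indicator S \<in> ?K" if "S \<in> sets borel" for S :: "'w set"
  proof (rule exponential_monotone_class[OF _ _ _ that])
    show "(\<lambda>w. exp (\<phi> w)) \<in> ?K" for \<phi> :: "'w dual" using int zero em by auto
  next
    fix f g :: "'w \<Rightarrow> real" and a b assume fg: "f \<in> ?K" "g \<in> ?K"
    have eq: "(\<lambda>w. d w * (a * f w + b * g w)) = (\<lambda>w. a * (d w * f w) + b * (d w * g w))"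
      by (auto simp: algebra_simps)
    show "(\<lambda>w. a * f w + b * g w) \<in> ?K" unfolding mem_Collect_eq eq using fg by auto
  next
    fix F :: "nat \<Rightarrow> 'w \<Rightarrow> real" and f c and \<psi> :: "'w dual"
    assume F: "\<And>k. F k \<in> ?K"
      and b: "\<And>k w. \<bar>F k w\<bar> \<le> c * (exp (\<psi> w) + exp (- \<psi> w))"
      and l: "\<And>w. (\<lambda>k. F k w) \<longlonglongrightarrow> f w"
    have [measurable]: "F k \<in> borel_measurable \<mu>" for k using F by auto
    have [measurable]: "f \<in> borel_measurable \<mu>" by (rule borel_measurable_LIMSEQ_real[OF l]) simp
    have "integrable \<mu> (\<lambda>w. c * (\<bar>d w * exp (\<psi> w)\<bar> + \<bar>d w * exp ((- \<psi>) w)\<bar>))"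
      using int by auto
    hence i: "integrable \<mu> (\<lambda>w. \<bar>d w\<bar> * (c * (exp (\<psi> w) + exp (- \<psi> w))))"
      by (simp add: blinfun.bilinear_simps abs_mult algebra_simps)
    have bd: "AE w in \<mu>. norm (d w * F k w) \<le> \<bar>d w\<bar> * (c * (exp (\<psi> w) + exp (- \<psi> w)))" for k
      using b by (auto simp: abs_mult intro!: mult_left_mono)
    have lm: "AE w in \<mu>. (\<lambda>k. d w * F k w) \<longlonglongrightarrow> d w * f w"
      by (intro AE_I2 tendsto_mult tendsto_const l)
    have "integrable \<mu> (\<lambda>w. d w * f w)"
      by (rule integrable_dominated_convergence[OF _ _ i lm bd]) auto
    moreover have "(\<lambda>k. LINT w|\<mu>. d w * F k w) \<longlonglongrightarrow> (LINT w|\<mu>. d w * f w)"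
      by (rule integral_dominated_convergence[OF _ _ i lm bd]) auto
    ultimately show "f \<in> ?K" using F by (simp add: LIMSEQ_const_iff)
  qed
  show ?thesis
  proof (rule sigma_finite_measure.density_zero[OF sf d])
    fix A assume "A \<in> sets \<mu>"
    thus "set_lebesgue_integral \<mu> A d = 0"
      using K[of A] sets by (simp add: set_lebesgue_integral_def mult.commute)
  qed
qed

context abstract_wiener_space
begin

definition exp_integrable :: "('w \<Rightarrow> real) \<Rightarrow> bool" where
  "exp_integrable u \<longleftrightarrow> u \<in> borel_measurable \<mu> \<and>
     (\<forall>\<phi> :: 'w dual. integrable \<mu> (\<lambda>w. u w * exp (\<phi> w)))"

text \<open>
  The factor \<open>exp (- \<parallel>\<phi>\<parallel>\<^sub>H\<^sup>2 / 2)\<close> makes the weight equal to \<open>\<E>(\<phi>)\<close>, so that the transform of \<open>1\<close> is \<open>1\<close> and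
  \<open>h \<mapsto> S \<E>(h)\<close> turns sums into products.
\<close>

definition s_transform :: "('w \<Rightarrow> real) \<Rightarrow> ('w dual) \<Rightarrow> real" where
  "s_transform u \<phi> = (LINT w|\<mu>. u w * exp (\<phi> w - \<V> \<phi> / 2))"

lemma exp_integrable_shift:
  "exp_integrable u \<Longrightarrow> integrable \<mu> (\<lambda>w. u w * exp (\<phi> w - c))" for \<phi> :: "'w dual"
  by (simp add: exp_integrable_def exp_diff)

lemma exp_integrable_sum:
  assumes "\<And>i. i \<in> I \<Longrightarrow> exp_integrable (u i)"
  shows "exp_integrable (\<lambda>w. \<Sum>i\<in>I. c i * u i w)"
    and "s_transform (\<lambda>w. \<Sum>i\<in>I. c i * u i w) \<phi> = (\<Sum>i\<in>I. c i * s_transform (u i) \<phi>)"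
proof -
  have "(\<lambda>w. \<Sum>i\<in>I. c i * u i w) \<in> borel_measurable \<mu>"
    by (intro borel_measurable_sum borel_measurable_times measurable_const)
      (use assms in \<open>auto simp: exp_integrable_def\<close>)
  thus "exp_integrable (\<lambda>w. \<Sum>i\<in>I. c i * u i w)"
    using assms unfolding exp_integrable_def
    by (auto simp: sum_distrib_right mult.assoc intro!: Bochner_Integration.integrable_sum)
  show "s_transform (\<lambda>w. \<Sum>i\<in>I. c i * u i w) \<phi> = (\<Sum>i\<in>I. c i * s_transform (u i) \<phi>)"
    unfolding s_transform_def sum_distrib_right mult.assoc
    by (subst Bochner_Integration.integral_sum)
      (use assms in \<open>auto intro!: exp_integrable_shift\<close>)
qed

lemma exp_integrable_cong_AE:
  assumes "exp_integrable u" "v \<in> borel_measurable \<mu>" "AE w in \<mu>. v w = u w"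
  shows "exp_integrable v" "s_transform v \<phi> = s_transform u \<phi>"
proof -
  have "integrable \<mu> (\<lambda>w. v w * exp (\<psi> w)) = integrable \<mu> (\<lambda>w. u w * exp (\<psi> w))" for \<psi> :: "'w dual"
    using assms by (intro integrable_cong_AE) (auto simp: exp_integrable_def)
  thus "exp_integrable v" using assms by (auto simp: exp_integrable_def)
  show "s_transform v \<phi> = s_transform u \<phi>" unfolding s_transform_def
    using assms by (intro integral_cong_AE) (auto simp: exp_integrable_def)
qed

theorem s_transform_inject:
  assumes u: "exp_integrable u" and v: "exp_integrable v"
    and eq: "\<And>\<phi>. s_transform u \<phi> = s_transform v \<phi>"
  shows "AE w in \<mu>. u w = v w"
proof -
  have int: "integrable \<mu> (\<lambda>w. (u w - v w) * exp (\<phi> w))" for \<phi> :: "'w dual"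
    using u v by (simp add: exp_integrable_def left_diff_distrib)
  have "(LINT w|\<mu>. (u w - v w) * exp (\<phi> w)) = 0" for \<phi> :: "'w dual"
  proof -
    have "(LINT w|\<mu>. (u w - v w) * exp (\<phi> w))
        = (LINT w|\<mu>. u w * exp (\<phi> w)) - (LINT w|\<mu>. v w * exp (\<phi> w))"
      using u v by (simp add: exp_integrable_def left_diff_distrib)
    thus ?thesis using eq[of \<phi>] unfolding s_transform_def exp_diff by simp
  qed
  from Laplace_function_eq_0[OF sigma_finite_measure_axioms sets_eq_borel int this] show ?thesis by simp
qed

lemma functional_exp:
  fixes \<phi> :: "'w dual"
  shows "integrable \<mu> (\<lambda>w. exp (\<phi> w))"
  "(LINT w|\<mu>. exp (\<phi> w)) = exp (\<V> \<phi> / 2)"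
  using gaussian_exp[OF gaussian_functional] by auto

lemma lp_space_2_exp_integrable: "u \<in> lp_space \<mu> 2 \<Longrightarrow> exp_integrable u"
  unfolding exp_integrable_def
proof (intro conjI allI)
  fix \<phi> :: "'w dual" assume u: "u \<in> lp_space \<mu> 2"
  show "integrable \<mu> (\<lambda>w. u w * exp (\<phi> w))"
    using u functional_exp(1)[of "2 *\<^sub>R \<phi>"]
    by (intro LINT_Cauchy_Schwarz(1)) (auto simp: lp_space_2 blinfun.bilinear_simps exp_double[symmetric])
qed (simp add: lp_space_2)

text \<open>
  The weight is square integrable, so this is the Cauchy-Schwarz inequality.
\<close>

lemma s_transform_L2_limit:
  assumes u: "\<And>m. u m \<in> lp_space \<mu> 2" and v: "v \<in> lp_space \<mu> 2"
    and lim: "(\<lambda>m. lp_norm \<mu> 2 (\<lambda>w. u m w - v w)) \<longlonglongrightarrow> 0"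
  shows "(\<lambda>m. s_transform (u m) \<phi>) \<longlonglongrightarrow> s_transform v \<phi>"
proof -
  define e where "e w = exp (\<phi> w - \<V> \<phi> / 2)" for w
  have e [measurable]: "e \<in> borel_measurable \<mu>" unfolding e_def[abs_def] by simp
  have e2: "integrable \<mu> (\<lambda>w. (e w)\<^sup>2)"
    using functional_exp(1)[of "2 *\<^sub>R \<phi>"]
    by (simp add: e_def exp_diff power_divide blinfun.bilinear_simps exp_double[symmetric])
  have d: "(\<lambda>w. u m w - v w) \<in> lp_space \<mu> 2" for m
    using lp_space_2_lin[OF u v, of 1 m "-1"] by simp
  have diff: "s_transform (u m) \<phi> - s_transform v \<phi> = (LINT w|\<mu>. (u m w - v w) * e w)" for m
    using exp_integrable_shift[OF lp_space_2_exp_integrable[OF u], of m \<phi>]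
      exp_integrable_shift[OF lp_space_2_exp_integrable[OF v], of \<phi>]
    by (simp add: s_transform_def e_def left_diff_distrib)
  have "(\<lambda>m. (s_transform (u m) \<phi> - s_transform v \<phi>)\<^sup>2) \<longlonglongrightarrow> 0"
  proof (rule tendsto_sandwich[OF _ _ tendsto_const])
    show "eventually (\<lambda>m. (s_transform (u m) \<phi> - s_transform v \<phi>)\<^sup>2 \<le> (LINT w|\<mu>. (u m w - v w)\<^sup>2) * (LINT w|\<mu>. (e w)\<^sup>2)) sequentially"
      unfolding diff by (intro always_eventually allI LINT_Cauchy_Schwarz(2) e e2)
        (use d in \<open>auto simp: lp_space_2\<close>)
    show "(\<lambda>m. (LINT w|\<mu>. (u m w - v w)\<^sup>2) * (LINT w|\<mu>. (e w)\<^sup>2)) \<longlonglongrightarrow> 0"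
      using lim by (intro tendsto_mult_left_zero) (simp add: lp_norm_2_tendsto_0_iff)
  qed auto
  hence "(\<lambda>m. s_transform (u m) \<phi> - s_transform v \<phi>) \<longlonglongrightarrow> 0"
    using tendsto_real_sqrt by (fastforce simp: tendsto_rabs_zero_iff)
  thus ?thesis by (rule LIM_zero_cancel)
qed

lemma exp_delta_integrable:
  fixes \<phi> :: "'w dual"
  shows "integrable \<mu> (\<lambda>w. exp (s * \<delta> h w + \<phi> w))"
  "(LINT w|\<mu>. exp (s * \<delta> h w + \<phi> w)) = exp ((norm (s *\<^sub>R h + \<D> \<phi>))\<^sup>2 / 2)"
  using gaussian_exp[OF gaussian_delta] by auto

lemma exp_abs_delta_lp_space:
  "(\<lambda>w. c * exp (\<bar>s * \<delta> h w\<bar> + a)) \<in> lp_space \<mu> 2"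
proof -
  have "integrable \<mu> (\<lambda>w. (c * exp (\<bar>s * \<delta> h w\<bar> + a))\<^sup>2)"
  proof (rule Bochner_Integration.integrable_bound)
    show "integrable \<mu> (\<lambda>w. (c * exp a)\<^sup>2 * (exp (2 * s * \<delta> h w) + exp (- 2 * s * \<delta> h w)))"
      using exp_delta_integrable(1)[of "2 * s" h 0] exp_delta_integrable(1)[of "- 2 * s" h 0] by simp
    have "(exp \<bar>x\<bar>)\<^sup>2 \<le> exp (2 * x) + exp (- 2 * x)" for x :: real
      by (cases "x \<ge> 0") (auto simp: exp_double[symmetric])
    from this[of "s * \<delta> h _"]
    show "AE w in \<mu>. norm ((c * exp (\<bar>s * \<delta> h w\<bar> + a))\<^sup>2) \<le>
        norm ((c * exp a)\<^sup>2 * (exp (2 * s * \<delta> h w) + exp (- 2 * s * \<delta> h w)))"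
      by (intro AE_I2) (auto simp: exp_add power_mult_distrib mult.assoc abs_of_nonneg add_nonneg_nonneg
         mult.left_commute[of "(exp a)\<^sup>2"] mult.commute[of _ "(exp a)\<^sup>2"] intro!: mult_left_mono)
  qed simp
  thus ?thesis by (simp add: lp_space_2)
qed

lemma exp_delta_lp_space: "(\<lambda>w. exp (s * \<delta> h w - a)) \<in> lp_space \<mu> 2"
  by (rule lp_space_2_bound[OF exp_abs_delta_lp_space[of 1 s h "- a"]]) auto

text \<open>
  The Gaussian Laplace transform; the cross term in \<open>\<parallel>s h + \<phi>\<parallel>\<^sub>H\<^sup>2\<close> is \<open>2 s \<langle>\<phi>, h\<rangle> = 2 s \<phi> (\<iota> h)\<close>.
\<close>

lemma s_transform_exp_delta:
  "s_transform (\<lambda>w. exp (s * \<delta> h w - s\<^sup>2 * (norm h)\<^sup>2 / 2)) \<phi> = exp (s * \<phi> (\<iota> h))"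
proof -
  have "s_transform (\<lambda>w. exp (s * \<delta> h w - s\<^sup>2 * (norm h)\<^sup>2 / 2)) \<phi> =
      (LINT w|\<mu>. exp (s * \<delta> h w + \<phi> w) * exp (- (s\<^sup>2 * (norm h)\<^sup>2 + \<V> \<phi>) / 2))"
    unfolding s_transform_def
  proof (rule Bochner_Integration.integral_cong[OF refl], unfold exp_add[symmetric], rule arg_cong[where f = exp])
    fix w show "s * \<delta> h w - s\<^sup>2 * (norm h)\<^sup>2 / 2 + (\<phi> w - \<V> \<phi> / 2) =
      s * \<delta> h w + \<phi> w + - (s\<^sup>2 * (norm h)\<^sup>2 + \<V> \<phi>) / 2"
      by (simp add: field_simps)
  qed
  also have "\<dots> = exp ((norm (s *\<^sub>R h + \<D> \<phi>))\<^sup>2 / 2) * exp (- (s\<^sup>2 * (norm h)\<^sup>2 + \<V> \<phi>) / 2)"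
    by (simp add: exp_delta_integrable(2))
  also have "(norm (s *\<^sub>R h + \<D> \<phi>))\<^sup>2 = s\<^sup>2 * (norm h)\<^sup>2 + 2 * s * (\<D> \<phi> \<bullet> h) + \<V> \<phi>"
    unfolding power2_norm_eq_inner by (simp add: inner_simps inner_commute power2_eq_square algebra_simps)
  also have "exp ((s\<^sup>2 * (norm h)\<^sup>2 + 2 * s * (\<D> \<phi> \<bullet> h) + \<V> \<phi>) / 2) *
      exp (- (s\<^sup>2 * (norm h)\<^sup>2 + \<V> \<phi>) / 2) = exp (s * (\<D> \<phi> \<bullet> h))"
    unfolding exp_add[symmetric] by (rule arg_cong[where f = exp]) (simp add: field_simps)
  finally show ?thesis unfolding dual_emb_inner[OF bounded_linear_embedding] .
qed

text \<open>
  The case \<open>s = 1\<close> of the scaled exponentials, with the factors \<open>1\<close> kept so that the facts about general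
  \<open>s\<close> apply by rewriting.
\<close>

lemma stoch_exp_eq: "\<E> h = (\<lambda>w. exp (1 * \<delta> h w - 1\<^sup>2 * (norm h)\<^sup>2 / 2))"
  by (auto simp: stoch_exp_def)

lemma stoch_exp_lp_space: "\<E> h \<in> lp_space \<mu> 2"
  unfolding stoch_exp_eq by (rule exp_delta_lp_space)

lemma stoch_exp_measurable [measurable]: "\<E> h \<in> borel_measurable \<mu>"
  using stoch_exp_lp_space by (simp add: lp_space_2)

lemma s_transform_stoch_exp: "s_transform (\<E> h) \<phi> = exp (\<phi> (\<iota> h))"
  using s_transform_exp_delta[of 1 h \<phi>] unfolding stoch_exp_eq by simp

lemma stoch_exp_dual_emb:
  "AE w in \<mu>. \<E> (\<D> \<phi>) w = exp (\<phi> w - \<V> \<phi> / 2)"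
  using delta_dual_emb[of \<phi>] by eventually_elim (simp add: stoch_exp_def)

lemma multiple_integral_power_lp_space: "\<I> n h \<in> lp_space \<mu> 2"
proof (rule lp_space_2_bound[OF exp_abs_delta_lp_space[of "fact n" 1 h "(norm h)\<^sup>2 / 2"]])
  show "\<I> n h \<in> borel_measurable \<mu>"
    unfolding multiple_integral_power_def[abs_def] by measurable
  show "\<bar>\<I> n h w\<bar> \<le> fact n * exp (\<bar>1 * \<delta> h w\<bar> + (norm h)\<^sup>2 / 2)" for w
    unfolding multiple_integral_power_def using hermite_bound[of "(norm h)\<^sup>2"] by simp
qed

lemma multiple_integral_power_generating:
  "(\<lambda>n. s ^ n * \<I> n h w / fact n) sums exp (s * \<delta> h w - s\<^sup>2 * (norm h)\<^sup>2 / 2)"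
  "\<bar>\<Sum>n<N. s ^ n * \<I> n h w / fact n\<bar> \<le> exp (\<bar>s * \<delta> h w\<bar> + s\<^sup>2 * (norm h)\<^sup>2 / 2)"
  unfolding multiple_integral_power_def by (rule hermite_generating_function; simp)+

lemma multiple_integral_power_measurable [measurable]: "\<I> n h \<in> borel_measurable \<mu>"
  using multiple_integral_power_lp_space by (simp add: lp_space_2)

text \<open>
  With \<open>s = 1\<close> this is the chaos expansion of a combination of exponentials. Multiplying the \<open>n\<close>-th
  term by \<open>s\<^sup>n\<close> amounts to replacing \<open>h\<close> by \<open>s h\<close>, which is the action of \<open>\<Gamma>(s)\<close>.
\<close>

lemma chaos_expansion_sum:
  assumes A: "finite A"
  shows "(\<lambda>N. lp_norm \<mu> 2 (\<lambda>w. (\<Sum>h\<in>A. c h * exp (s * \<delta> h w - s\<^sup>2 * (norm h)\<^sup>2 / 2))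
      - (\<Sum>n<N. s ^ n * (\<Sum>h\<in>A. c h / fact n * \<I> n h w)))) \<longlonglongrightarrow> 0"
  unfolding lp_norm_2_tendsto_0_iff
proof -
  let ?E = "\<lambda>h w. exp (s * \<delta> h w - s\<^sup>2 * (norm h)\<^sup>2 / 2)"
  let ?I = "\<lambda>N h w. \<Sum>n<N. s ^ n * \<I> n h w / fact n"
  let ?B = "\<lambda>w. \<Sum>h\<in>A. \<bar>c h\<bar> * (2 * exp (\<bar>s * \<delta> h w\<bar> + s\<^sup>2 * (norm h)\<^sup>2 / 2))"
  have eq: "(\<Sum>h\<in>A. c h * ?E h w) - (\<Sum>n<N. s ^ n * (\<Sum>h\<in>A. c h / fact n * \<I> n h w))
      = (\<Sum>h\<in>A. c h * (?E h w - ?I N h w))" for N w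
  proof -
    have "(\<Sum>n<N. s ^ n * (\<Sum>h\<in>A. c h / fact n * \<I> n h w))
        = (\<Sum>n<N. \<Sum>h\<in>A. c h * (s ^ n * \<I> n h w / fact n))"
      by (simp add: sum_distrib_left mult_ac)
    also have "\<dots> = (\<Sum>h\<in>A. c h * ?I N h w)" by (subst sum.swap) (simp add: sum_distrib_left)
    finally show ?thesis by (simp add: right_diff_distrib sum_subtractf)
  qed
  have "(\<lambda>N. LINT w|\<mu>. (\<Sum>h\<in>A. c h * (?E h w - ?I N h w))\<^sup>2) \<longlonglongrightarrow> (LINT w|\<mu>. 0)"
  proof (rule integral_dominated_convergence)
    have "?B \<in> lp_space \<mu> 2" by (intro lp_space_2_sum A exp_abs_delta_lp_space)
    thus "integrable \<mu> (\<lambda>w. (?B w)\<^sup>2)" by (simp add: lp_space_2)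
    show "AE w in \<mu>. (\<lambda>N. (\<Sum>h\<in>A. c h * (?E h w - ?I N h w))\<^sup>2) \<longlonglongrightarrow> 0"
    proof (rule AE_I2)
      fix w
      have "(\<lambda>N. (\<Sum>h\<in>A. c h * (?E h w - ?I N h w))\<^sup>2) \<longlonglongrightarrow> (\<Sum>h\<in>A. c h * (?E h w - ?E h w))\<^sup>2"
        using multiple_integral_power_generating(1)[of s] unfolding sums_def
        by (intro tendsto_intros) 
      thus "(\<lambda>N. (\<Sum>h\<in>A. c h * (?E h w - ?I N h w))\<^sup>2) \<longlonglongrightarrow> 0" by simp
    qed
    show "AE w in \<mu>. norm ((\<Sum>h\<in>A. c h * (?E h w - ?I N h w))\<^sup>2) \<le> (?B w)\<^sup>2" for N
    proof (rule AE_I2)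
      fix w
      have "\<bar>?E h w - ?I N h w\<bar> \<le> 2 * exp (\<bar>s * \<delta> h w\<bar> + s\<^sup>2 * (norm h)\<^sup>2 / 2)" for h
      proof -
        have "?E h w \<le> exp (\<bar>s * \<delta> h w\<bar> + s\<^sup>2 * (norm h)\<^sup>2 / 2)"
          unfolding exp_le_cancel_iff using abs_ge_self[of "s * \<delta> h w"]
            zero_le_power2[of "s * norm h"] unfolding power_mult_distrib by linarith
        thus ?thesis using multiple_integral_power_generating(2)[of s h w N] exp_gt_zero[of "s * \<delta> h w - s\<^sup>2 * (norm h)\<^sup>2 / 2"]
          by linarith
      qed
      hence "\<bar>\<Sum>h\<in>A. c h * (?E h w - ?I N h w)\<bar> \<le> ?B w"
        by (intro order_trans[OF sum_abs] sum_mono) (auto simp: abs_mult intro!: mult_left_mono)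
      hence "\<bar>\<Sum>h\<in>A. c h * (?E h w - ?I N h w)\<bar>\<^sup>2 \<le> (?B w)\<^sup>2" by (rule power_mono) simp
      thus "norm ((\<Sum>h\<in>A. c h * (?E h w - ?I N h w))\<^sup>2) \<le> (?B w)\<^sup>2" by simp
    qed
  qed measurable
  thus "(\<lambda>N. LINT w|\<mu>. ((\<Sum>h\<in>A. c h * ?E h w) - (\<Sum>n<N. s ^ n * (\<Sum>h\<in>A. c h / fact n * \<I> n h w)))\<^sup>2) \<longlonglongrightarrow> 0"
    unfolding eq by simp
qed

text \<open>
  Both sides are the coefficients of \<open>s\<^sup>n / n!\<close> in the transform \<open>exp (s \<phi> (\<iota> h))\<close> of the exponential
  of \<open>s h\<close>.
\<close>

lemma s_transform_multiple_integral_power: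
  "s_transform (\<I> n h) \<phi> = \<phi> (\<iota> h) ^ n"
proof -
  let ?I = "\<lambda>n. \<I> n h"
  have "(\<lambda>n. s_transform (?I n) \<phi> / fact n * s ^ n) sums exp (s * \<phi> (\<iota> h))" for s
  proof -
    have "(\<lambda>N. s_transform (\<lambda>w. \<Sum>n<N. s ^ n / fact n * ?I n w) \<phi>)
        \<longlonglongrightarrow> s_transform (\<lambda>w. exp (s * \<delta> h w - s\<^sup>2 * (norm h)\<^sup>2 / 2)) \<phi>"
    proof (rule s_transform_L2_limit)
      show "(\<lambda>w. \<Sum>n<N. s ^ n / fact n * ?I n w) \<in> lp_space \<mu> 2" for N
        by (intro lp_space_2_sum multiple_integral_power_lp_space) auto
      have "lp_norm \<mu> 2 (\<lambda>w. f w - g w) = lp_norm \<mu> 2 (\<lambda>w. g w - f w)" for f g :: "'w \<Rightarrow> real"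
        unfolding lp_norm_2 by (simp add: power2_commute)
      thus "(\<lambda>N. lp_norm \<mu> 2 (\<lambda>w. (\<Sum>n<N. s ^ n / fact n * ?I n w) - exp (s * \<delta> h w - s\<^sup>2 * (norm h)\<^sup>2 / 2))) \<longlonglongrightarrow> 0"
        using chaos_expansion_sum[of "{h}" "\<lambda>_. 1" s] by simp
    qed (rule exp_delta_lp_space)
    thus ?thesis
      unfolding sums_def s_transform_exp_delta
      by (subst (asm) exp_integrable_sum(2))
        (auto intro!: lp_space_2_exp_integrable multiple_integral_power_lp_space simp: mult_ac)
  qed
  moreover have "(\<lambda>n. \<phi> (\<iota> h) ^ n / fact n * s ^ n) sums exp (s * \<phi> (\<iota> h))" for s
    using exp_converges[of "s * \<phi> (\<iota> h)"] by (simp add: power_mult_distrib divide_inverse mult_ac)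
  ultimately have "s_transform (?I n) \<phi> / fact n = \<phi> (\<iota> h) ^ n / fact n"
    by (rule power_series_coefficients_unique)
  thus ?thesis by simp
qed

lemma wiener_chaos_lp_space: "g \<in> wiener_chaos \<mu> \<iota> n \<Longrightarrow> g \<in> lp_space \<mu> 2"
  by (simp add: wiener_chaos_def)

text \<open>
  Homogeneity of degree \<open>n\<close> holds for the powers \<open>\<phi> (\<iota> h)\<^sup>n\<close>, hence on their span, and passes to the
  \<open>L\<^sup>2\<close> closure. This is what links the chaos decomposition to dilations of \<open>\<phi>\<close>.
\<close>

lemma s_transform_wiener_chaos:
  assumes g: "g \<in> wiener_chaos \<mu> \<iota> n"
  shows "s_transform g (l *\<^sub>R \<phi>) = l ^ n * s_transform g \<phi>"
proof -
  obtain u where u: "\<And>m::nat. u m \<in> fun_span (\<I> n)"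
    and lim: "(\<lambda>m. lp_norm \<mu> 2 (\<lambda>w. u m w - g w)) \<longlonglongrightarrow> 0"
    using g unfolding wiener_chaos_def by blast
  have span: "v \<in> lp_space \<mu> 2 \<and> s_transform v (l *\<^sub>R \<phi>) = l ^ n * s_transform v \<phi>"
    if v: "v \<in> fun_span (\<I> n)" for v
  proof -
    obtain A c where A: "finite A" "v = (\<lambda>w. \<Sum>h\<in>A. c h * \<I> n h w)"
      using v unfolding fun_span_def by blast
    have "s_transform v \<psi> = (\<Sum>h\<in>A. c h * \<psi> (\<iota> h) ^ n)" for \<psi>
      unfolding A(2) by (subst exp_integrable_sum(2))
        (auto simp: s_transform_multiple_integral_power intro!: lp_space_2_exp_integrable multiple_integral_power_lp_space)
    thus ?thesis unfolding A(2) using A(1)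
      by (auto intro!: lp_space_2_sum multiple_integral_power_lp_space
          simp: blinfun.bilinear_simps power_mult_distrib sum_distrib_left mult_ac)
  qed
  have conv: "(\<lambda>m. s_transform (u m) \<psi>) \<longlonglongrightarrow> s_transform g \<psi>" for \<psi>
    by (rule s_transform_L2_limit[OF _ wiener_chaos_lp_space[OF g] lim]) (use span u in blast)
  have "(\<lambda>m. l ^ n * s_transform (u m) \<phi>) \<longlonglongrightarrow> l ^ n * s_transform g \<phi>"
    by (intro tendsto_intros conv)
  moreover have "(\<lambda>m. l ^ n * s_transform (u m) \<phi>) = (\<lambda>m. s_transform (u m) (l *\<^sub>R \<phi>))"
    using span u by auto
  ultimately show ?thesis using conv[of "l *\<^sub>R \<phi>"] LIMSEQ_unique by metis
qed

definition exp_poly :: "('w \<Rightarrow> real) \<Rightarrow> bool" where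
  "exp_poly u \<longleftrightarrow> u \<in> borel_measurable \<mu> \<and>
     (\<exists>A c. finite A \<and> (AE w in \<mu>. u w = (\<Sum>h\<in>A. c h * \<E> h w)))"

text \<open>
  Terms with equal vectors \<open>e i\<close> are collected, so that the sum runs over a set of vectors with one
  coefficient each. Dilation by \<open>l = 0\<close> and sums \<open>h + k\<close> do produce such repetitions.
\<close>

lemma exp_poly_indexed:
  assumes "finite I" "u \<in> borel_measurable \<mu>" "AE w in \<mu>. u w = (\<Sum>i\<in>I. c i * \<E> (e i) w)"
  shows "exp_poly u"
proof -
  have "(\<Sum>i\<in>I. c i * \<E> (e i) w) = (\<Sum>h\<in>e ` I. (\<Sum>i\<in>{i\<in>I. e i = h}. c i) * \<E> h w)" for w
    unfolding sum_distrib_right using assms(1)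
    by (subst sum.image_gen[OF assms(1), of _ e]) (auto intro!: sum.cong)
  thus ?thesis unfolding exp_poly_def using assms
    by (intro conjI exI[of _ "e ` I"] exI[of _ "\<lambda>h. \<Sum>i\<in>{i\<in>I. e i = h}. c i"]) auto
qed

lemmas linear_embedding = bounded_linear.linear[OF bounded_linear_embedding]

lemma s_transform_exp_sum:
  assumes "u \<in> borel_measurable \<mu>" "AE w in \<mu>. u w = (\<Sum>i\<in>I. c i * \<E> (e i) w)"
  shows "exp_integrable u" "s_transform u \<phi> = (\<Sum>i\<in>I. c i * exp (\<phi> (\<iota> (e i))))"
proof -
  have "exp_integrable (\<lambda>w. \<Sum>i\<in>I. c i * \<E> (e i) w)"
    by (intro exp_integrable_sum lp_space_2_exp_integrable stoch_exp_lp_space)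
  from exp_integrable_cong_AE[OF this assms]
  show "exp_integrable u" "s_transform u \<phi> = (\<Sum>i\<in>I. c i * exp (\<phi> (\<iota> (e i))))"
    by (auto simp: exp_integrable_sum(2) lp_space_2_exp_integrable stoch_exp_lp_space s_transform_stoch_exp)
qed

lemma exp_poly_exp_integrable: "exp_poly u \<Longrightarrow> exp_integrable u"
  unfolding exp_poly_def using s_transform_exp_sum(1)[where e = "\<lambda>h. h"] by blast

text \<open>
  Any function chosen in the definition of \<open>\<Gamma>(l) f\<close> is a sum of \<open>l\<^sup>n g\<^sub>n\<close> with \<open>g\<^sub>n\<close> in the \<open>n\<close>-th chaos and
  \<open>f = \<Sum>g\<^sub>n\<close>. By homogeneity its transform at \<open>\<phi>\<close> is \<open>\<Sum>(S g\<^sub>n)(l \<phi>) = (S f)(l \<phi>)\<close>, whatever the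
  choice, and injectivity of the transform identifies it.
\<close>

lemma Gamma_op_span:
  assumes f: "f \<in> fun_span (\<E>)"
  shows "exp_poly (Gamma_op \<mu> \<iota> l f)" "s_transform (Gamma_op \<mu> \<iota> l f) \<phi> = s_transform f (l *\<^sub>R \<phi>)"
proof -
  obtain A c where A: "finite A" and f_eq: "f = (\<lambda>w. \<Sum>h\<in>A. c h * \<E> h w)"
    using f unfolding fun_span_def by blast
  have fL: "f \<in> lp_space \<mu> 2" unfolding f_eq by (intro lp_space_2_sum A stoch_exp_lp_space)
  let ?g = "\<lambda>n w. \<Sum>h\<in>A. c h / fact n * \<I> n h w"
  let ?P = "\<lambda>u. u \<in> lp_space \<mu> 2 \<and>
     (\<exists>g. (\<forall>n. g n \<in> wiener_chaos \<mu> \<iota> n) \<and>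
       (\<lambda>N. lp_norm \<mu> 2 (\<lambda>w. f w - (\<Sum>n<N. g n w))) \<longlonglongrightarrow> 0 \<and>
       (\<lambda>N. lp_norm \<mu> 2 (\<lambda>w. u w - (\<Sum>n<N. l ^ n * g n w))) \<longlonglongrightarrow> 0)"
  have "?P (\<lambda>w. \<Sum>h\<in>A. c h * exp (l * \<delta> h w - l\<^sup>2 * (norm h)\<^sup>2 / 2))"
  proof (intro conjI exI[of _ "?g"] allI)
    fix n
    have "?g n \<in> fun_span (\<I> n)"
      unfolding fun_span_def by (intro CollectI exI[of _ A] exI[of _ "\<lambda>h. c h / fact n"] conjI A refl)
    thus "?g n \<in> wiener_chaos \<mu> \<iota> n"
      unfolding wiener_chaos_def mem_Collect_eq
      by (intro conjI lp_space_2_sum A multiple_integral_power_lp_space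
          exI[of _ "\<lambda>_. ?g n"])
        (simp_all add: lp_norm_2)
  next
    show "(\<lambda>N. lp_norm \<mu> 2 (\<lambda>w. f w - (\<Sum>n<N. ?g n w))) \<longlonglongrightarrow> 0"
      using chaos_expansion_sum[OF A, of c 1] unfolding f_eq stoch_exp_eq by simp
  qed (intro lp_space_2_sum A exp_delta_lp_space, rule chaos_expansion_sum[OF A])
  from someI[where P = ?P, OF this] have "?P (Gamma_op \<mu> \<iota> l f)" unfolding Gamma_op_def .
  then obtain g where uL: "Gamma_op \<mu> \<iota> l f \<in> lp_space \<mu> 2" and g: "\<And>n. g n \<in> wiener_chaos \<mu> \<iota> n"
    and lim_f: "(\<lambda>N. lp_norm \<mu> 2 (\<lambda>w. f w - (\<Sum>n<N. g n w))) \<longlonglongrightarrow> 0"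
    and lim_u: "(\<lambda>N. lp_norm \<mu> 2 (\<lambda>w. Gamma_op \<mu> \<iota> l f w - (\<Sum>n<N. l ^ n * g n w))) \<longlonglongrightarrow> 0" by blast
  have partial: "(\<lambda>N. \<Sum>n<N. a n * s_transform (g n) \<psi>) \<longlonglongrightarrow> s_transform v \<psi>"
    if v: "v \<in> lp_space \<mu> 2" and lim: "(\<lambda>N. lp_norm \<mu> 2 (\<lambda>w. v w - (\<Sum>n<N. a n * g n w))) \<longlonglongrightarrow> 0" for v a \<psi>
  proof -
    have "lp_norm \<mu> 2 (\<lambda>w. f w - g w) = lp_norm \<mu> 2 (\<lambda>w. g w - f w)" for f g :: "'w \<Rightarrow> real"
      unfolding lp_norm_2 by (simp add: power2_commute)
    from lim[unfolded this[of v]]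
    have "(\<lambda>N. s_transform (\<lambda>w. \<Sum>n<N. a n * g n w) \<psi>) \<longlonglongrightarrow> s_transform v \<psi>"
      by (intro s_transform_L2_limit lp_space_2_sum wiener_chaos_lp_space[OF g] v) auto
    thus ?thesis
      by (subst (asm) exp_integrable_sum(2)) (auto intro!: lp_space_2_exp_integrable wiener_chaos_lp_space[OF g])
  qed
  have S: "s_transform (Gamma_op \<mu> \<iota> l f) \<phi> = s_transform f (l *\<^sub>R \<phi>)" for \<phi>
  proof (rule LIMSEQ_unique)
    show "(\<lambda>N. \<Sum>n<N. l ^ n * s_transform (g n) \<phi>) \<longlonglongrightarrow> s_transform (Gamma_op \<mu> \<iota> l f) \<phi>"
      by (rule partial[OF uL lim_u])
    show "(\<lambda>N. \<Sum>n<N. l ^ n * s_transform (g n) \<phi>) \<longlonglongrightarrow> s_transform f (l *\<^sub>R \<phi>)"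
      using partial[OF fL, of "\<lambda>_. 1" "l *\<^sub>R \<phi>"] lim_f by (simp add: s_transform_wiener_chaos[OF g])
  qed
  thus "s_transform (Gamma_op \<mu> \<iota> l f) \<phi> = s_transform f (l *\<^sub>R \<phi>)" .
  have v: "exp_integrable (\<lambda>w. \<Sum>h\<in>A. c h * \<E> (l *\<^sub>R h) w)"
    by (intro exp_integrable_sum lp_space_2_exp_integrable stoch_exp_lp_space)
  have Sv: "s_transform (\<lambda>w. \<Sum>h\<in>A. c h * \<E> (l *\<^sub>R h) w) \<phi> = s_transform f (l *\<^sub>R \<phi>)" for \<phi>
    unfolding f_eq
    by (simp add: exp_integrable_sum(2) lp_space_2_exp_integrable stoch_exp_lp_space s_transform_stoch_exp
        linear_scale[OF linear_embedding] blinfun.bilinear_simps)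
  have "AE w in \<mu>. Gamma_op \<mu> \<iota> l f w = (\<Sum>h\<in>A. c h * \<E> (l *\<^sub>R h) w)"
    by (rule s_transform_inject[OF lp_space_2_exp_integrable[OF uL] v]) (simp add: S Sv)
  thus "exp_poly (Gamma_op \<mu> \<iota> l f)"
    using uL by (intro exp_poly_indexed[OF A]) (auto simp: lp_space_2)
qed

text \<open>
  Whichever representations of \<open>f\<close> and \<open>g\<close> enter the definition, \<open>exp (\<phi> (\<iota> (h + k)))\<close> factorises, so the
  transform of the result is the product of the transforms.
\<close>

lemma wick_exp_poly:
  assumes f: "exp_poly f" and g: "exp_poly g"
  shows "exp_poly (wick \<mu> \<iota> f g)" "s_transform (wick \<mu> \<iota> f g) \<phi> = s_transform f \<phi> * s_transform g \<phi>"
proof -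
  let ?P = "\<lambda>u. \<exists>A c B d. finite A \<and> finite B \<and>
     (AE w in \<mu>. f w = (\<Sum>h\<in>A. c h * \<E> h w)) \<and>
     (AE w in \<mu>. g w = (\<Sum>k\<in>B. d k * \<E> k w)) \<and>
     u = (\<lambda>w. \<Sum>h\<in>A. \<Sum>k\<in>B. c h * d k * \<E> (h + k) w)"
  have "\<exists>u. ?P u" using f g unfolding exp_poly_def by blast
  hence "?P (wick \<mu> \<iota> f g)" unfolding wick_def by (rule someI_ex)
  then obtain A c B d where AB: "finite A" "finite B"
    and fA: "AE w in \<mu>. f w = (\<Sum>h\<in>A. c h * \<E> h w)"
    and gB: "AE w in \<mu>. g w = (\<Sum>k\<in>B. d k * \<E> k w)"
    and u: "wick \<mu> \<iota> f g = (\<lambda>w. \<Sum>h\<in>A. \<Sum>k\<in>B. c h * d k * \<E> (h + k) w)" by blast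
  let ?e = "\<lambda>p. fst p + snd p" and ?c = "\<lambda>p. c (fst p) * d (snd p)"
  have u': "wick \<mu> \<iota> f g = (\<lambda>w. \<Sum>p\<in>A \<times> B. ?c p * \<E> (?e p) w)"
    unfolding u by (simp add: sum.cartesian_product case_prod_beta)
  have m: "wick \<mu> \<iota> f g \<in> borel_measurable \<mu>" unfolding u' by measurable
  have ae: "AE w in \<mu>. wick \<mu> \<iota> f g w = (\<Sum>p\<in>A \<times> B. ?c p * \<E> (?e p) w)" unfolding u' by simp
  show "exp_poly (wick \<mu> \<iota> f g)" using exp_poly_indexed[OF _ m ae] AB by simp
  have "s_transform (wick \<mu> \<iota> f g) \<phi> = (\<Sum>p\<in>A \<times> B. (c (fst p) * exp (\<phi> (\<iota> (fst p)))) * (d (snd p) * exp (\<phi> (\<iota> (snd p)))))"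
    unfolding s_transform_exp_sum(2)[OF m ae] by (simp add: linear_add[OF linear_embedding] blinfun.bilinear_simps exp_add mult_ac)
  also have "\<dots> = (\<Sum>h\<in>A. c h * exp (\<phi> (\<iota> h))) * (\<Sum>k\<in>B. d k * exp (\<phi> (\<iota> k)))"
    by (simp add: sum_product sum.cartesian_product case_prod_beta)
  also have "(\<Sum>h\<in>A. c h * exp (\<phi> (\<iota> h))) = s_transform f \<phi>"
    using f fA by (simp add: s_transform_exp_sum(2) exp_poly_def)
  also have "(\<Sum>k\<in>B. d k * exp (\<phi> (\<iota> k))) = s_transform g \<phi>"
    using g gB by (simp add: s_transform_exp_sum(2) exp_poly_def)
  finally show "s_transform (wick \<mu> \<iota> f g) \<phi> = s_transform f \<phi> * s_transform g \<phi>" .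
qed

lemma wick_prod_exp_poly:
  assumes "\<And>j. j \<in> {1..n} \<Longrightarrow> exp_poly (F j)"
  shows "exp_poly (wick_prod \<mu> \<iota> F n) \<and> (\<forall>\<phi>. s_transform (wick_prod \<mu> \<iota> F n) \<phi> = (\<Prod>j=1..n. s_transform (F j) \<phi>))"
  using assms
proof (induct n)
  case 0
  have "AE w in \<mu>. \<E> 0 w = 1"
    using stoch_exp_dual_emb[of 0] by (simp add: dual_linear)
  hence ae: "AE w in \<mu>. 1 = (\<Sum>i\<in>{0}. 1 * \<E> i w)" by (auto elim: eventually_mono)
  show ?case using exp_poly_indexed[OF _ _ ae] s_transform_exp_sum(2)[OF _ ae]
    by (simp add: linear_0[OF linear_embedding] blinfun.bilinear_simps)
next
  case (Suc n)
  hence IH: "exp_poly (wick_prod \<mu> \<iota> F n)" "\<And>\<phi>. s_transform (wick_prod \<mu> \<iota> F n) \<phi> = (\<Prod>j=1..n. s_transform (F j) \<phi>)"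
    and F: "exp_poly (F (Suc n))" by auto
  show ?case using wick_exp_poly[OF IH(1) F] IH(2) by simp
qed

end

section \<open>Densities of image measures and density of exponentials in \<open>L\<^sup>1\<close>\<close>

locale image_density = sigma_finite_measure \<mu>
  for \<mu> :: "'b measure" +
  fixes M :: "'a measure" and S :: "'a \<Rightarrow> 'b"
  assumes S [measurable]: "S \<in> measurable M \<mu>" and dist: "distr M \<mu> S = \<mu>"
begin

abbreviation image_law :: "('a \<Rightarrow> real) \<Rightarrow> 'b measure" where "image_law F \<equiv> distr (density M (\<lambda>x. ennreal (F x))) \<mu> S"

text \<open>
  The density with respect to \<open>\<mu>\<close> of the image under \<open>S\<close> of the signed measure \<open>F \<cdot> M\<close>. The conversion to
  \<open>ennreal\<close> truncates at \<open>0\<close>, so the two terms come from the positive and the negative part of \<open>F\<close>.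
\<close>

definition push_density :: "('a \<Rightarrow> real) \<Rightarrow> 'b \<Rightarrow> real" where
  "push_density F w =
     enn2real (RN_deriv \<mu> (image_law F) w) -
     enn2real (RN_deriv \<mu> (image_law (\<lambda>x. - F x)) w)"

lemma push_density_measurable [measurable]: "push_density F \<in> borel_measurable \<mu>"
  unfolding push_density_def[abs_def] by measurable

text \<open>
  Absolute continuity of the image measure is inherited from the image of \<open>M\<close>, which is \<open>\<mu>\<close>; it is finite
  because \<open>F\<close> is integrable.
\<close>

lemma push_density_part:
  assumes F: "integrable M F" and g [measurable]: "g \<in> borel_measurable \<mu>"
  defines "N \<equiv> image_law F"
  shows "integrable \<mu> (\<lambda>w. enn2real (RN_deriv \<mu> N w) * g w) \<longleftrightarrow> integrable M (\<lambda>x. max 0 (F x) * g (S x))"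
    and "(LINT w|\<mu>. enn2real (RN_deriv \<mu> N w) * g w) = (LINT x|M. max 0 (F x) * (g (S x) :: real))"
proof -
  have [measurable]: "F \<in> borel_measurable M" using F by auto
  have S' [measurable]: "S \<in> measurable (density M h) \<mu>" for h
    using S measurable_cong_sets[OF sets_density refl] by metis
  have max: "density M (\<lambda>x. ennreal (F x)) = density M (\<lambda>x. ennreal (max 0 (F x)))"
    by (rule density_cong) (auto simp: max_def ennreal_neg)
  have "S -` space \<mu> \<inter> space M = space M" using measurable_space[OF S] by auto
  hence "emeasure N (space N) = emeasure (density M (\<lambda>x. ennreal (F x))) (space M)"
    unfolding N_def by (subst emeasure_distr) auto
  also have "\<dots> = (\<integral>\<^sup>+x. ennreal (F x) \<partial>M)"
    by (subst emeasure_density) (auto intro!: nn_integral_cong)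
  also have "\<dots> \<le> (\<integral>\<^sup>+x. ennreal (norm (F x)) \<partial>M)" by (intro nn_integral_mono ennreal_leI) simp
  also have "\<dots> < \<infinity>" using F by (simp add: integrable_iff_bounded)
  finally have "finite_measure N" by (intro finite_measureI) simp
  hence fin: "sigma_finite_measure N" by (rule finite_measure.axioms(1))
  have ac: "absolutely_continuous \<mu> N" unfolding absolutely_continuous_def
  proof
    fix A assume A: "A \<in> null_sets \<mu>"
    hence [measurable]: "A \<in> sets \<mu>" by auto
    have "emeasure (distr M \<mu> S) A = 0" using A dist by auto
    hence "emeasure M (S -` A \<inter> space M) = 0" by (simp add: emeasure_distr)
    moreover have V [measurable]: "S -` A \<inter> space M \<in> sets M" by measurable
    ultimately have "S -` A \<inter> space M \<in> null_sets M" by (rule null_setsI)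
    hence "AE x in M. x \<notin> S -` A \<inter> space M" by (rule AE_not_in)
    hence "AE x in M. x \<in> S -` A \<inter> space M \<longrightarrow> ennreal (F x) = 0" by (rule eventually_mono) blast
    hence "S -` A \<inter> space M \<in> null_sets (density M (\<lambda>x. ennreal (F x)))"
      using V by (subst null_sets_density_iff) auto
    hence "emeasure N A = 0" unfolding N_def by (subst emeasure_distr) auto
    thus "A \<in> null_sets N" unfolding N_def by (intro null_setsI) auto
  qed
  have sets: "sets N = sets \<mu>" by (simp add: N_def)
  have mg: "(\<lambda>x. g (S x)) \<in> borel_measurable M" by measurable
  have 1: "integrable N g \<longleftrightarrow> integrable M (\<lambda>x. max 0 (F x) * g (S x))"
    unfolding N_def
    by (subst integrable_distr_eq[OF S' g], subst max, subst integrable_density) (auto simp: mg)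
  have 2: "integral\<^sup>L N g = (LINT x|M. max 0 (F x) * g (S x))"
    unfolding N_def
    by (subst integral_distr[OF S' g], subst max, subst integral_density) (auto simp: mg)
  show "integrable \<mu> (\<lambda>w. enn2real (RN_deriv \<mu> N w) * g w) \<longleftrightarrow> integrable M (\<lambda>x. max 0 (F x) * g (S x))"
    using RN_deriv_integrable[OF fin ac sets g] 1 by simp
  show "(LINT w|\<mu>. enn2real (RN_deriv \<mu> N w) * g w) = (LINT x|M. max 0 (F x) * g (S x))"
    using RN_deriv_integral[OF fin ac sets g] 2 by simp
qed

text \<open>
  This characterises \<open>push_density\<close> as the conditional expectation of \<open>F\<close> given \<open>S\<close>, read as a function
  of the value of \<open>S\<close>. Unbounded \<open>g\<close> are allowed because the transform tests against exponentials.
\<close>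

lemma push_density_integral:
  assumes F: "integrable M F" and g: "g \<in> borel_measurable \<mu>"
    and int: "integrable M (\<lambda>x. F x * g (S x))"
  shows "integrable \<mu> (\<lambda>w. push_density F w * g w)"
    and "(LINT w|\<mu>. push_density F w * g w) = (LINT x|M. F x * (g (S x) :: real))"
proof -
  note [measurable] = g
  have [measurable]: "F \<in> borel_measurable M" using F by auto
  have F': "integrable M (\<lambda>x. - F x)" using F by simp
  have i1: "integrable M (\<lambda>x. max 0 (F x) * g (S x))"
    by (rule Bochner_Integration.integrable_bound[OF int]) (auto simp: abs_mult intro!: mult_right_mono AE_I2)
  have i2: "integrable M (\<lambda>x. max 0 (- F x) * g (S x))"
    by (rule Bochner_Integration.integrable_bound[OF int]) (auto simp: abs_mult intro!: mult_right_mono AE_I2)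
  note p1 = push_density_part[OF F g] and p2 = push_density_part[OF F' g]
  have j1: "integrable \<mu> (\<lambda>w. enn2real (RN_deriv \<mu> (image_law F) w) * g w)"
    using p1(1) i1 by simp
  have j2: "integrable \<mu> (\<lambda>w. enn2real (RN_deriv \<mu> (image_law (\<lambda>x. - F x)) w) * g w)"
    using p2(1) i2 by simp
  show "integrable \<mu> (\<lambda>w. push_density F w * g w)"
    unfolding push_density_def left_diff_distrib using j1 j2 by (rule Bochner_Integration.integrable_diff)
  have "(LINT w|\<mu>. push_density F w * g w) = (LINT x|M. max 0 (F x) * g (S x)) - (LINT x|M. max 0 (- F x) * g (S x))"
    unfolding push_density_def left_diff_distrib using j1 j2 p1(2) p2(2) by simp
  also have "\<dots> = (LINT x|M. max 0 (F x) * g (S x) - max 0 (- F x) * g (S x))" using i1 i2 by simp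
  also have "\<dots> = (LINT x|M. F x * g (S x))" by (rule Bochner_Integration.integral_cong) (auto simp: max_def)
  finally show "(LINT w|\<mu>. push_density F w * g w) = (LINT x|M. F x * g (S x))" .
qed

lemma push_density_integrable:
  assumes F: "integrable M F"
  shows "integrable \<mu> (push_density F)"
  using push_density_integral(1)[OF F, of "\<lambda>_. 1"] F by simp

lemma push_density_set_integral:
  assumes F: "integrable M F" and A: "A \<in> sets \<mu>"
  shows "set_lebesgue_integral \<mu> A (push_density F) = (LINT x|M. F x * indicator A (S x))"
proof -
  have [measurable]: "A \<in> sets \<mu>" "F \<in> borel_measurable M" using A F by auto
  have "integrable M (\<lambda>x. F x * indicator A (S x))"
    by (rule Bochner_Integration.integrable_bound[OF F]) (auto simp: indicator_def)
  from push_density_integral(2)[OF F _ this] show ?thesis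
    by (simp add: set_lebesgue_integral_def mult.commute)
qed

text \<open>
  Test against the sign of the density.
\<close>

lemma push_density_L1_bound:
  assumes F: "integrable M F"
  shows "(LINT w|\<mu>. \<bar>push_density F w\<bar>) \<le> (LINT x|M. \<bar>F x\<bar>)"
proof -
  have [measurable]: "F \<in> borel_measurable M" using F by auto
  let ?g = "\<lambda>w. sgn (push_density F w)"
  have int: "integrable M (\<lambda>x. F x * ?g (S x))"
    by (rule Bochner_Integration.integrable_bound[OF F]) (auto simp: abs_mult abs_sgn_eq)
  have "(LINT w|\<mu>. \<bar>push_density F w\<bar>) = (LINT w|\<mu>. push_density F w * ?g w)"
    by (simp add: abs_sgn)
  also have "\<dots> = (LINT x|M. F x * ?g (S x))"
    by (rule push_density_integral(2)[OF F _ int]) measurable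
  also have "\<dots> \<le> (LINT x|M. \<bar>F x\<bar>)"
    using F int by (intro integral_mono) (auto simp: sgn_if)
  finally show ?thesis .
qed

lemma push_density_linear:
  assumes F: "integrable M F" and G: "integrable M G"
  shows "AE w in \<mu>. push_density (\<lambda>x. a * F x + b * G x) w =
    a * push_density F w + b * push_density G w"
proof (rule density_unique_banach)
  have FG: "integrable M (\<lambda>x. a * F x + b * G x)" using F G by auto
  note pF = push_density_integrable[OF F] and pG = push_density_integrable[OF G]
  show "integrable \<mu> (push_density (\<lambda>x. a * F x + b * G x))"
    by (rule push_density_integrable[OF FG])
  show "integrable \<mu> (\<lambda>w. a * push_density F w + b * push_density G w)"
    using pF pG by auto
  fix A assume A: "A \<in> sets \<mu>"
  note [measurable] = A
  have [measurable]: "F \<in> borel_measurable M" "G \<in> borel_measurable M" using F G by auto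
  have iF: "integrable M (\<lambda>x. F x * indicator A (S x))" "integrable M (\<lambda>x. G x * indicator A (S x))"
    by (rule Bochner_Integration.integrable_bound[OF F] Bochner_Integration.integrable_bound[OF G]; auto simp: indicator_def)+
  have "set_lebesgue_integral \<mu> A (\<lambda>w. a * push_density F w + b * push_density G w)
      = a * set_lebesgue_integral \<mu> A (push_density F) + b * set_lebesgue_integral \<mu> A (push_density G)"
  proof -
    have i: "integrable \<mu> (\<lambda>w. indicator A w * push_density F w)"
        "integrable \<mu> (\<lambda>w. indicator A w * push_density G w)"
      using integrable_mult_indicator[OF A pF] integrable_mult_indicator[OF A pG] by auto
    have "indicator A w * (a * push_density F w + b * push_density G w) =
        a * (indicator A w * push_density F w) + b * (indicator A w * push_density G w)" for w
      by (simp add: algebra_simps)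
    thus ?thesis using i by (simp add: set_lebesgue_integral_def)
  qed
  also have "\<dots> = (LINT x|M. (a * F x + b * G x) * indicator A (S x))"
    unfolding push_density_set_integral[OF F A] push_density_set_integral[OF G A]
    using iF by (simp add: distrib_right mult.assoc)
  also have "\<dots> = set_lebesgue_integral \<mu> A (push_density (\<lambda>x. a * F x + b * G x))"
    by (rule push_density_set_integral[OF FG A, symmetric])
  finally show "set_lebesgue_integral \<mu> A (push_density (\<lambda>x. a * F x + b * G x)) =
    set_lebesgue_integral \<mu> A (\<lambda>w. a * push_density F w + b * push_density G w)" ..
qed

lemma push_density_nonneg:
  assumes F: "integrable M F" and pos: "AE x in M. 0 \<le> F x"
  shows "AE w in \<mu>. 0 \<le> push_density F w"
    and "density \<mu> (\<lambda>w. ennreal (push_density F w)) = image_law F"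
proof -
  have [measurable]: "F \<in> borel_measurable M" using F by auto
  have S' [measurable]: "S \<in> measurable (density M h) \<mu>" for h
    using S measurable_cong_sets[OF sets_density refl] by metis
  note pF = push_density_integrable[OF F]
  show nn: "AE w in \<mu>. 0 \<le> push_density F w"
  proof (rule density_nonneg[OF pF])
    fix A assume A: "A \<in> sets \<mu>"
    have "0 \<le> (LINT x|M. F x * indicator A (S x))"
      using pos by (intro integral_nonneg_AE) (auto elim: eventually_mono)
    thus "0 \<le> set_lebesgue_integral \<mu> A (push_density F)"
      unfolding push_density_set_integral[OF F A] .
  qed
  show "density \<mu> (\<lambda>w. ennreal (push_density F w)) = image_law F"
  proof (rule measure_eqI)
    fix A assume "A \<in> sets (density \<mu> (\<lambda>w. ennreal (push_density F w)))"
    hence A [measurable]: "A \<in> sets \<mu>" by simp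
    have "emeasure (density \<mu> (\<lambda>w. ennreal (push_density F w))) A
        = (\<integral>\<^sup>+w. ennreal (indicator A w * push_density F w) \<partial>\<mu>)"
      by (subst emeasure_density) (auto intro!: nn_integral_cong simp: indicator_def)
    also have "\<dots> = ennreal (set_lebesgue_integral \<mu> A (push_density F))"
      unfolding set_lebesgue_integral_def real_scaleR_def
      using integrable_mult_indicator[OF A pF] nn
      by (intro nn_integral_eq_integral) (auto elim: eventually_mono)
    also have "\<dots> = ennreal (LINT x|M. F x * indicator A (S x))"
      by (simp only: push_density_set_integral[OF F A])
    also have "\<dots> = (\<integral>\<^sup>+x. ennreal (F x * indicator A (S x)) \<partial>M)"
      by (rule nn_integral_eq_integral[symmetric])
        (use pos in \<open>auto intro!: Bochner_Integration.integrable_bound[OF F] simp: indicator_def elim: eventually_mono\<close>)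
    also have "\<dots> = emeasure (density M (\<lambda>x. ennreal (F x))) (S -` A \<inter> space M)"
      by (subst emeasure_density) (auto intro!: nn_integral_cong simp: indicator_def)
    also have "\<dots> = emeasure (image_law F) A"
      by (subst emeasure_distr) auto
    finally show "emeasure (density \<mu> (\<lambda>w. ennreal (push_density F w))) A =
      emeasure (image_law F) A" .
  qed simp
qed

end

lemma lp_space_1: "f \<in> lp_space M 1 \<longleftrightarrow> integrable M f"
proof -
  have "\<bar>y\<bar> powr 1 = \<bar>y\<bar>" for y :: real by (cases "y = 0") auto
  thus ?thesis using integrable_abs_iff[of f M] by (auto simp: lp_space_def)
qed

lemma lp_norm_1: "lp_norm M 1 f = (LINT x|M. \<bar>f x\<bar>)"
proof -
  have "\<bar>y\<bar> powr 1 = \<bar>y\<bar>" for y :: real by (cases "y = 0") auto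
  thus ?thesis by (simp add: lp_norm_def)
qed

lemma fun_span_lin:
  assumes f: "f \<in> fun_span F" and g: "g \<in> fun_span F"
  shows "(\<lambda>x. a * f x + b * g x) \<in> fun_span F"
proof -
  obtain A c where A: "finite A" "f = (\<lambda>x. \<Sum>i\<in>A. c i * F i x)" using f unfolding fun_span_def by blast
  obtain B d where B: "finite B" "g = (\<lambda>x. \<Sum>i\<in>B. d i * F i x)" using g unfolding fun_span_def by blast
  let ?c = "\<lambda>i. a * (if i \<in> A then c i else 0) + b * (if i \<in> B then d i else 0)"
  have "a * f x + b * g x = (\<Sum>i\<in>A \<union> B. ?c i * F i x)" for x
  proof -
    have "f x = (\<Sum>i\<in>A \<union> B. (if i \<in> A then c i else 0) * F i x)" unfolding A(2)
      using A(1) B(1) by (intro sum.mono_neutral_cong_left) auto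
    moreover have "g x = (\<Sum>i\<in>A \<union> B. (if i \<in> B then d i else 0) * F i x)" unfolding B(2)
      using A(1) B(1) by (intro sum.mono_neutral_cong_left) auto
    ultimately show ?thesis by (simp add: sum_distrib_left sum.distrib[symmetric] algebra_simps)
  qed
  thus ?thesis unfolding fun_span_def using A(1) B(1)
    by (intro CollectI exI[of _ "A \<union> B"] exI[of _ ?c]) auto
qed

lemma fun_span_base: "(\<lambda>x. c * F i x) \<in> fun_span F"
  unfolding fun_span_def by (intro CollectI exI[of _ "{i}"] exI[of _ "\<lambda>_. c"]) auto

context abstract_wiener_space
begin

lemma span_stoch_exp_integrable:
  assumes "f \<in> fun_span (\<E>)" shows "integrable \<mu> f" "exp_integrable f"
proof -
  obtain A c where A: "finite A" "f = (\<lambda>w. \<Sum>h\<in>A. c h * \<E> h w)"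
    using assms unfolding fun_span_def by blast
  have f: "f \<in> lp_space \<mu> 2" unfolding A(2) by (intro lp_space_2_sum A stoch_exp_lp_space)
  thus "exp_integrable f" by (rule lp_space_2_exp_integrable)
  show "integrable \<mu> f" using f square_integrable_imp_integrable by (auto simp: lp_space_2)
qed

text \<open>
  The \<open>L\<^sup>1\<close> closure of the span is closed under dominated limits and contains \<open>exp \<phi>\<close>, which is almost
  everywhere a multiple of \<open>\<E>(\<phi>)\<close>. Hence it contains all indicators, and then all integrable functions.
\<close>

theorem span_stoch_exp_dense_L1:
  assumes f: "integrable \<mu> f" and e: "0 < e"
  obtains g where "g \<in> fun_span (\<E>)" "(LINT w|\<mu>. \<bar>f w - g w\<bar>) < e"
proof -
  let ?E = "fun_span (\<E>)"
  let ?K = "{f. integrable \<mu> f \<and> (\<forall>e>0. \<exists>g\<in>?E. (LINT w|\<mu>. \<bar>f w - g w\<bar>) < e)}"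
  have lin: "(\<lambda>w. a * f w + b * g w) \<in> ?K" if fg: "f \<in> ?K" "g \<in> ?K" for f g a b
  proof (intro CollectI conjI allI impI)
    show "integrable \<mu> (\<lambda>w. a * f w + b * g w)" using fg by auto
    fix e :: real assume e: "0 < e"
    define d where "d = e / (2 * (\<bar>a\<bar> + \<bar>b\<bar> + 1))"
    have d: "0 < d" using e by (simp add: d_def)
    obtain u where u: "u \<in> ?E" "(LINT w|\<mu>. \<bar>f w - u w\<bar>) < d" using fg(1) d by auto
    obtain v where v: "v \<in> ?E" "(LINT w|\<mu>. \<bar>g w - v w\<bar>) < d" using fg(2) d by auto
    have int: "integrable \<mu> (\<lambda>w. \<bar>f w - u w\<bar>)" "integrable \<mu> (\<lambda>w. \<bar>g w - v w\<bar>)"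
      using fg span_stoch_exp_integrable[OF u(1)] span_stoch_exp_integrable[OF v(1)] by auto
    have "(LINT w|\<mu>. \<bar>(a * f w + b * g w) - (a * u w + b * v w)\<bar>) \<le> (LINT w|\<mu>. \<bar>a\<bar> * \<bar>f w - u w\<bar> + \<bar>b\<bar> * \<bar>g w - v w\<bar>)"
    proof (rule integral_mono)
      show "integrable \<mu> (\<lambda>w. \<bar>(a * f w + b * g w) - (a * u w + b * v w)\<bar>)"
        using fg span_stoch_exp_integrable[OF u(1)] span_stoch_exp_integrable[OF v(1)] by auto
      show "integrable \<mu> (\<lambda>w. \<bar>a\<bar> * \<bar>f w - u w\<bar> + \<bar>b\<bar> * \<bar>g w - v w\<bar>)" using int by auto
      fix w
      have "(a * f w + b * g w) - (a * u w + b * v w) = a * (f w - u w) + b * (g w - v w)" by (simp add: algebra_simps)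
      thus "\<bar>(a * f w + b * g w) - (a * u w + b * v w)\<bar> \<le> \<bar>a\<bar> * \<bar>f w - u w\<bar> + \<bar>b\<bar> * \<bar>g w - v w\<bar>"
        using abs_triangle_ineq[of "a * (f w - u w)" "b * (g w - v w)"] by (simp add: abs_mult)
    qed
    also have "\<dots> = \<bar>a\<bar> * (LINT w|\<mu>. \<bar>f w - u w\<bar>) + \<bar>b\<bar> * (LINT w|\<mu>. \<bar>g w - v w\<bar>)" using int by simp
    also have "\<dots> \<le> \<bar>a\<bar> * d + \<bar>b\<bar> * d" using u(2) v(2) by (intro add_mono mult_left_mono) auto
    also have "\<dots> < e"
    proof -
      have "\<bar>a\<bar> * d + \<bar>b\<bar> * d \<le> (\<bar>a\<bar> + \<bar>b\<bar> + 1) * d" using d by (simp add: algebra_simps)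
      also have "\<dots> = e / 2"
      proof -
        have "t * (e / (2 * t)) = e / 2" if "t \<noteq> 0" for t using that by simp
        from this[of "\<bar>a\<bar> + \<bar>b\<bar> + 1"] show ?thesis unfolding d_def by linarith
      qed
      finally show ?thesis using e by simp
    qed
    finally show "\<exists>h\<in>?E. (LINT w|\<mu>. \<bar>a * f w + b * g w - h w\<bar>) < e"
      using fun_span_lin[OF u(1) v(1), of a b] by (rule bexI)
  qed
  have L1_lim: "f \<in> ?K"
    if F: "\<And>k::nat. F k \<in> ?K" and B: "integrable \<mu> B" and bd: "\<And>k w. w \<in> space \<mu> \<Longrightarrow> \<bar>F k w\<bar> \<le> B w"
      and l: "\<And>w. w \<in> space \<mu> \<Longrightarrow> (\<lambda>k. F k w) \<longlonglongrightarrow> f w" for F f and B :: "'w \<Rightarrow> real"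
  proof -
    have iF: "integrable \<mu> (F k)" for k using F by auto
    hence [measurable]: "F k \<in> borel_measurable \<mu>" for k by auto
    have [measurable]: "f \<in> borel_measurable \<mu>" by (rule borel_measurable_LIMSEQ_metric[of F]) (use l in auto)
    have if': "integrable \<mu> f"
      by (rule integrable_dominated_convergence[where s = F and w = B]) (use B bd l in auto)
    have "(\<lambda>k. LINT w|\<mu>. \<bar>f w - F k w\<bar>) \<longlonglongrightarrow> (LINT w|\<mu>. 0)"
    proof (rule integral_dominated_convergence[where w = "\<lambda>w. \<bar>f w\<bar> + B w"])
      show "integrable \<mu> (\<lambda>w. \<bar>f w\<bar> + B w)" using if' B by auto
      show "AE w in \<mu>. (\<lambda>k. \<bar>f w - F k w\<bar>) \<longlonglongrightarrow> 0"
      proof (rule AE_I2)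
        fix w assume "w \<in> space \<mu>"
        from tendsto_rabs[OF tendsto_diff[OF tendsto_const[of "f w"] l[OF this]]]
        show "(\<lambda>k. \<bar>f w - F k w\<bar>) \<longlonglongrightarrow> 0" by simp
      qed
      show "AE w in \<mu>. norm \<bar>f w - F k w\<bar> \<le> \<bar>f w\<bar> + B w" for k
      proof (rule AE_I2)
        fix w assume "w \<in> space \<mu>"
        from bd[OF this, of k] abs_triangle_ineq4[of "f w" "F k w"]
        show "norm \<bar>f w - F k w\<bar> \<le> \<bar>f w\<bar> + B w" by simp
      qed
    qed auto
    hence conv: "(\<lambda>k. LINT w|\<mu>. \<bar>f w - F k w\<bar>) \<longlonglongrightarrow> 0" by simp
    show ?thesis
    proof (intro CollectI conjI if' allI impI)
      fix e :: real assume e: "0 < e"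
      obtain k where k: "(LINT w|\<mu>. \<bar>f w - F k w\<bar>) < e / 2"
        using order_tendstoD(2)[OF conv, of "e / 2"] e by (auto simp: eventually_sequentially)
      obtain g where g: "g \<in> ?E" "(LINT w|\<mu>. \<bar>F k w - g w\<bar>) < e / 2"
        using F[of k] e by (auto dest: spec[of _ "e / 2"])
      have "(LINT w|\<mu>. \<bar>f w - g w\<bar>) \<le> (LINT w|\<mu>. \<bar>f w - F k w\<bar> + \<bar>F k w - g w\<bar>)"
        using if' iF span_stoch_exp_integrable[OF g(1)] by (intro integral_mono) auto
      also have "\<dots> = (LINT w|\<mu>. \<bar>f w - F k w\<bar>) + (LINT w|\<mu>. \<bar>F k w - g w\<bar>)"
        using if' iF span_stoch_exp_integrable[OF g(1)] by simp
      finally show "\<exists>g\<in>?E. (LINT w|\<mu>. \<bar>f w - g w\<bar>) < e" using k g by force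
    qed
  qed
  have expK: "(\<lambda>w. exp (\<phi> w)) \<in> ?K" for \<phi> :: "'w dual"
  proof (intro CollectI conjI allI impI)
    show "integrable \<mu> (\<lambda>w. exp (\<phi> w))" by (rule functional_exp)
    fix e :: real assume "0 < e"
    let ?g = "\<lambda>w. exp ((norm (\<D> \<phi>))\<^sup>2 / 2) * \<E> (\<D> \<phi>) w"
    have "AE w in \<mu>. \<bar>exp (\<phi> w) - ?g w\<bar> = 0"
      using stoch_exp_dual_emb[of \<phi>] by eventually_elim (simp add: exp_add[symmetric])
    hence "(LINT w|\<mu>. \<bar>exp (\<phi> w) - ?g w\<bar>) = 0" by (rule integral_eq_zero_AE)
    thus "\<exists>g\<in>?E. (LINT w|\<mu>. \<bar>exp (\<phi> w) - g w\<bar>) < e"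
      using \<open>0 < e\<close> fun_span_base[of _ "\<E>" "\<D> \<phi>"] by (intro bexI[of _ ?g]) auto
  qed
  have ind: "indicator S \<in> ?K" if "S \<in> sets borel" for S :: "'w set"
  proof (rule exponential_monotone_class[OF expK lin _ that])
    fix F :: "nat \<Rightarrow> 'w \<Rightarrow> real" and f c and \<psi> :: "'w dual"
    assume F: "\<And>k. F k \<in> ?K"
      and b: "\<And>k w. \<bar>F k w\<bar> \<le> c * (exp (\<psi> w) + exp (- \<psi> w))"
      and l: "\<And>w. (\<lambda>k. F k w) \<longlonglongrightarrow> f w"
    show "f \<in> ?K"
    proof (rule L1_lim[OF F _ b l])
      show "integrable \<mu> (\<lambda>w. c * (exp (\<psi> w) + exp (- \<psi> w)))"
        using functional_exp(1)[of \<psi>] functional_exp(1)[of "- \<psi>"] by (simp add: blinfun.bilinear_simps)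
    qed
  qed
  have "f \<in> ?K" using f
  proof (induct rule: integrable_induct)
    case (base A c)
    have "indicator A \<in> ?K" using base ind sets_eq_borel by auto
    from lin[OF this this, of c 0] show ?case by (simp add: mult.commute)
  next
    case (add f g)
    from lin[OF add(2,4), of 1 1] show ?case by simp
  next
    case (lim f s)
    show ?case
      by (rule L1_lim[of s "\<lambda>w. 2 * \<bar>f w\<bar>"]) (use lim in auto)
  qed
  thus thesis using that e by blast
qed

end

section \<open>The law of \<open>\<alpha>\<^sub>1 X\<^sub>1 + \<dots> + \<alpha>\<^sub>n X\<^sub>n\<close>\<close>

(* The index sets {1..n} keep their form under simplification. *)
declare One_nat_def [simp del]

lemmas gamma_wick_extension_maps =
    gamma_wick_extension_def[THEN iffD1, THEN conjunct1, rule_format]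
  and gamma_wick_extension_linear =
    gamma_wick_extension_def[THEN iffD1, THEN conjunct2, THEN conjunct1, rule_format]
  and gamma_wick_extension_bounded =
    gamma_wick_extension_def[THEN iffD1, THEN conjunct2, THEN conjunct2, THEN conjunct1]
  and gamma_wick_extension_span =
    gamma_wick_extension_def[THEN iffD1, THEN conjunct2, THEN conjunct2, THEN conjunct2, rule_format]

context abstract_wiener_space
begin

definition mixture :: "nat \<Rightarrow> (nat \<Rightarrow> real) \<Rightarrow> (nat \<Rightarrow> 'w) \<Rightarrow> 'w" where
  "mixture n \<alpha> x = (\<Sum>j=1..n. \<alpha> j *\<^sub>R x j)"

abbreviation copies :: "nat \<Rightarrow> (nat \<Rightarrow> 'w) measure" where
  "copies n \<equiv> Pi\<^sub>M {1..n} (\<lambda>_. \<mu>)"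

definition mixture_density :: "nat \<Rightarrow> (nat \<Rightarrow> real) \<Rightarrow> (nat \<Rightarrow> 'w \<Rightarrow> real) \<Rightarrow> 'w \<Rightarrow> real" where
  "mixture_density n \<alpha> f = image_density.push_density \<mu> (copies n) (mixture n \<alpha>) (\<lambda>x. \<Prod>j=1..n. f j (x j))"

lemma product_sigma_finite_copies: "product_sigma_finite (\<lambda>_::nat. \<mu>)"
  by (rule product_sigma_finite.intro) (rule sigma_finite_measure_axioms)

lemma mixture_measurable_borel: "mixture n \<alpha> \<in> borel_measurable (Pi\<^sub>M {1..n} (\<lambda>_. borel))"
proof -
  have "(\<lambda>x. \<Sum>j=1..n. \<alpha> j *\<^sub>R x j :: 'w) \<in> borel_measurable (Pi\<^sub>M {1..n} (\<lambda>_. borel))"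
  proof (rule borel_measurable_sum)
    fix j assume "j \<in> {1..n}"
    hence "(\<lambda>x. x j :: 'w) \<in> measurable (Pi\<^sub>M {1..n} (\<lambda>_. borel)) borel"
      by (rule measurable_component_singleton)
    thus "(\<lambda>x. \<alpha> j *\<^sub>R x j :: 'w) \<in> borel_measurable (Pi\<^sub>M {1..n} (\<lambda>_. borel))"
      by (intro borel_measurable_scaleR borel_measurable_const)
  qed
  thus ?thesis by (simp add: mixture_def[abs_def])
qed

lemma mixture_measurable [measurable]: "mixture n \<alpha> \<in> measurable (copies n) \<mu>"
proof -
  have "sets (copies n) = sets (Pi\<^sub>M {1..n} (\<lambda>_. borel))"
    by (rule sets_PiM_cong) (auto simp: sets_eq_borel)
  thus ?thesis using mixture_measurable_borel measurable_cong_sets[OF _ sets_eq_borel] by blast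
qed

lemma functional_mixture:
  "\<phi> (mixture n \<alpha> x) = (\<Sum>j=1..n. (\<alpha> j *\<^sub>R \<phi>) (x j))" for \<phi> :: "'w dual"
  by (simp add: mixture_def blinfun.sum_right blinfun.bilinear_simps)

text \<open>
  The quadratic terms add up to \<open>\<Sum>\<alpha>\<^sub>j\<^sup>2 \<parallel>\<phi>\<parallel>\<^sub>H\<^sup>2 / 2\<close>, so this is where \<open>\<Sum>\<alpha>\<^sub>j\<^sup>2 = 1\<close> makes the weights of the
  S-transform factorise.
\<close>

lemma exp_functional_mixture:
  fixes \<phi> :: "'w dual"
  assumes "(\<Sum>j=1..n. (\<alpha> j)\<^sup>2) = 1"
  shows "exp (\<phi> (mixture n \<alpha> x) - \<V> \<phi> / 2) =
    (\<Prod>j=1..n. exp ((\<alpha> j *\<^sub>R \<phi>) (x j) - \<V> (\<alpha> j *\<^sub>R \<phi>) / 2))"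
proof -
  have "(\<Sum>j=1..n. \<V> (\<alpha> j *\<^sub>R \<phi>) / 2) = (\<Sum>j=1..n. (\<alpha> j)\<^sup>2) * (\<V> \<phi> / 2)"
    by (simp add: dual_linear power_mult_distrib sum_distrib_right)
  thus ?thesis by (simp only: functional_mixture exp_sum[symmetric] sum_subtractf assms finite_atLeastAtMost) simp
qed

text \<open>
  Rotation invariance of Gaussian measures, read off from the Laplace transform.
\<close>

lemma distr_mixture:
  assumes \<alpha>: "(\<Sum>j=1..n. (\<alpha> j)\<^sup>2) = 1"
  shows "distr (copies n) \<mu> (mixture n \<alpha>) = \<mu>"
proof (rule Laplace_measure_eqI)
  interpret product_sigma_finite "\<lambda>_::nat. \<mu>" by (rule product_sigma_finite_copies)
  interpret copies: prob_space "copies n" by (rule prob_space_PiM) (rule prob_space_axioms)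
  show "sets (distr (copies n) \<mu> (mixture n \<alpha>)) = sets borel" "sets \<mu> = sets borel"
    by (simp_all add: sets_eq_borel)
  show "finite_measure \<mu>" by unfold_locales
  show "finite_measure (distr (copies n) \<mu> (mixture n \<alpha>))"
    using copies.prob_space_distr[OF mixture_measurable] prob_space.axioms(1) by blast
  fix \<phi> :: "'w dual"
  show "integrable \<mu> (\<lambda>w. exp (\<phi> w))" by (rule functional_exp)
  have eq: "(\<lambda>x. exp (\<phi> (mixture n \<alpha> x))) = (\<lambda>x. \<Prod>j=1..n. exp ((\<alpha> j *\<^sub>R \<phi>) (x j)))"
    by (simp only: functional_mixture exp_sum finite_atLeastAtMost)
  have int: "integrable (copies n) (\<lambda>x. exp (\<phi> (mixture n \<alpha> x)))"
    unfolding eq by (intro product_integrable_prod functional_exp) simp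
  thus "integrable (distr (copies n) \<mu> (mixture n \<alpha>)) (\<lambda>w. exp (\<phi> w))"
    by (subst integrable_distr_eq) auto
  have "(LINT w|distr (copies n) \<mu> (mixture n \<alpha>). exp (\<phi> w)) = (LINT x|copies n. exp (\<phi> (mixture n \<alpha> x)))"
    by (rule integral_distr) auto
  also have "\<dots> = (\<Prod>j=1..n. LINT w|\<mu>. exp ((\<alpha> j *\<^sub>R \<phi>) w))"
    unfolding eq by (rule product_integral_prod) (auto intro: functional_exp)
  also have "\<dots> = exp (\<Sum>j=1..n. \<V> (\<alpha> j *\<^sub>R \<phi>) / 2)"
    by (simp only: functional_exp(2) exp_sum finite_atLeastAtMost)
  also have "(\<Sum>j=1..n. \<V> (\<alpha> j *\<^sub>R \<phi>) / 2) = (\<Sum>j=1..n. (\<alpha> j)\<^sup>2) * (\<V> \<phi> / 2)"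
    by (simp add: dual_linear power_mult_distrib sum_distrib_right)
  also have "exp \<dots> = (LINT w|\<mu>. exp (\<phi> w))" by (simp add: \<alpha> functional_exp(2))
  finally show "(LINT w|distr (copies n) \<mu> (mixture n \<alpha>). exp (\<phi> w)) = (LINT w|\<mu>. exp (\<phi> w))" .
qed

lemma image_density_mixture:
  "(\<Sum>j=1..n. (\<alpha> j)\<^sup>2) = 1 \<Longrightarrow> image_density \<mu> (copies n) (mixture n \<alpha>)"
  by unfold_locales (auto intro: distr_mixture)

lemma product_density_integrable:
  assumes "\<And>j. j \<in> {1..n} \<Longrightarrow> integrable \<mu> (f j)"
  shows "integrable (copies n) (\<lambda>x. \<Prod>j=1..n. f j (x j) :: real)"
    and "(LINT x|copies n. (\<Prod>j=1..n. f j (x j))) = (\<Prod>j=1..n. LINT w|\<mu>. f j w)"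
proof -
  interpret product_sigma_finite "\<lambda>_::nat. \<mu>" by (rule product_sigma_finite_copies)
  show "integrable (copies n) (\<lambda>x. \<Prod>j=1..n. f j (x j))"
    by (rule product_integrable_prod) (use assms in auto)
  show "(LINT x|copies n. (\<Prod>j=1..n. f j (x j))) = (\<Prod>j=1..n. LINT w|\<mu>. f j w)"
    by (rule product_integral_prod) (use assms in auto)
qed

lemma mixture_density_integrable:
  assumes \<alpha>: "(\<Sum>j=1..n. (\<alpha> j)\<^sup>2) = 1" and f: "\<And>j. j \<in> {1..n} \<Longrightarrow> integrable \<mu> (f j)"
  shows "integrable \<mu> (mixture_density n \<alpha> f)"
  unfolding mixture_density_def
  by (rule image_density.push_density_integrable[OF image_density_mixture[OF \<alpha>]])
    (rule product_density_integrable(1)[OF f])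

lemma mixture_density_L1_bound:
  assumes \<alpha>: "(\<Sum>j=1..n. (\<alpha> j)\<^sup>2) = 1" and f: "\<And>j. j \<in> {1..n} \<Longrightarrow> integrable \<mu> (f j)"
  shows "(LINT w|\<mu>. \<bar>mixture_density n \<alpha> f w\<bar>) \<le> (\<Prod>j=1..n. LINT w|\<mu>. \<bar>f j w\<bar>)"
proof -
  have "(LINT w|\<mu>. \<bar>mixture_density n \<alpha> f w\<bar>) \<le> (LINT x|copies n. \<bar>\<Prod>j=1..n. f j (x j)\<bar>)"
    unfolding mixture_density_def
    by (rule image_density.push_density_L1_bound[OF image_density_mixture[OF \<alpha>]])
      (rule product_density_integrable(1)[OF f])
  also have "\<dots> = (\<Prod>j=1..n. LINT w|\<mu>. \<bar>f j w\<bar>)"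
    unfolding abs_prod using f by (intro product_density_integrable(2)) auto
  finally show ?thesis .
qed

lemma mixture_density_multilinear:
  assumes \<alpha>: "(\<Sum>j=1..n. (\<alpha> j)\<^sup>2) = 1" and f: "\<And>j. j \<in> {1..n} \<Longrightarrow> integrable \<mu> (f j)"
    and i: "i \<in> {1..n}" and g: "integrable \<mu> g"
  shows "AE w in \<mu>. mixture_density n \<alpha> (f(i := \<lambda>x. a * f i x + b * g x)) w =
    a * mixture_density n \<alpha> f w + b * mixture_density n \<alpha> (f(i := g)) w"
proof -
  have upd: "(\<Prod>j=1..n. (f(i := h)) j (x j)) = h (x i) * (\<Prod>j\<in>{1..n} - {i}. f j (x j))" for h x
    by (subst prod.remove[OF _ i]) (auto intro!: prod.cong)
  have "(\<Prod>j=1..n. f j (x j)) = f i (x i) * (\<Prod>j\<in>{1..n} - {i}. f j (x j))" for x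
    using upd[of "f i" x] by simp
  hence eq: "(\<lambda>x. \<Prod>j=1..n. (f(i := \<lambda>x. a * f i x + b * g x)) j (x j)) =
      (\<lambda>x. a * (\<Prod>j=1..n. f j (x j)) + b * (\<Prod>j=1..n. (f(i := g)) j (x j)))"
    unfolding upd by (auto simp: algebra_simps)
  show ?thesis unfolding mixture_density_def eq
    by (rule image_density.push_density_linear[OF image_density_mixture[OF \<alpha>]];
        rule product_density_integrable(1)) (use f g in auto)
qed

text \<open>
  Integrating \<open>\<Prod>f\<^sub>j(w\<^sub>j)\<close> against the weight at \<open>\<Sum>\<alpha>\<^sub>j w\<^sub>j\<close> splits into independent factors.
\<close>

lemma mixture_density_s_transform:
  assumes \<alpha>: "(\<Sum>j=1..n. (\<alpha> j)\<^sup>2) = 1" and f: "\<And>j. j \<in> {1..n} \<Longrightarrow> exp_integrable (f j)"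
  shows "exp_integrable (mixture_density n \<alpha> f)"
    and "s_transform (mixture_density n \<alpha> f) \<phi> = (\<Prod>j=1..n. s_transform (f j) (\<alpha> j *\<^sub>R \<phi>))"
proof -
  have f1: "integrable \<mu> (f j)" if "j \<in> {1..n}" for j
    using exp_integrable_shift[OF f[OF that], of 0 0] by simp
  let ?e = "\<lambda>\<phi> w. exp (blinfun_apply \<phi> w - \<V> \<phi> / 2)"
  have eq: "(\<Prod>j=1..n. f j (x j)) * ?e \<phi> (mixture n \<alpha> x) = (\<Prod>j=1..n. f j (x j) * ?e (\<alpha> j *\<^sub>R \<phi>) (x j))" for x \<phi>
    unfolding exp_functional_mixture[OF \<alpha>] prod.distrib ..
  have fe: "integrable \<mu> (\<lambda>w. f j w * ?e (\<alpha> j *\<^sub>R \<phi>) w)" if "j \<in> {1..n}" for j \<phi>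
    by (rule exp_integrable_shift[OF f[OF that]])
  have int: "integrable (copies n) (\<lambda>x. (\<Prod>j=1..n. f j (x j)) * ?e \<phi> (mixture n \<alpha> x))" for \<phi>
    unfolding eq by (rule product_density_integrable(1)[OF fe])
  note p = image_density.push_density_integral[OF image_density_mixture[OF \<alpha>]
      product_density_integrable(1)[OF f1] _ int, folded mixture_density_def]
  have "integrable \<mu> (\<lambda>w. mixture_density n \<alpha> f w * exp (\<phi> w))" for \<phi> :: "'w dual"
  proof -
    have "integrable \<mu> (\<lambda>w. exp (\<V> \<phi> / 2) * (mixture_density n \<alpha> f w * ?e \<phi> w))"
      using p(1) by auto
    thus ?thesis by (simp add: exp_diff)
  qed
  moreover have "mixture_density n \<alpha> f \<in> borel_measurable \<mu>"
    by (rule borel_measurable_integrable[OF mixture_density_integrable[OF \<alpha> f1]])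
  ultimately show "exp_integrable (mixture_density n \<alpha> f)" by (simp add: exp_integrable_def)
  have "s_transform (mixture_density n \<alpha> f) \<phi> = (LINT x|copies n. (\<Prod>j=1..n. f j (x j)) * ?e \<phi> (mixture n \<alpha> x))"
    unfolding s_transform_def by (rule p(2)) auto
  also have "\<dots> = (\<Prod>j=1..n. s_transform (f j) (\<alpha> j *\<^sub>R \<phi>))"
    unfolding eq s_transform_def by (rule product_density_integrable(2)[OF fe])
  finally show "s_transform (mixture_density n \<alpha> f) \<phi> = (\<Prod>j=1..n. s_transform (f j) (\<alpha> j *\<^sub>R \<phi>))" .
qed

text \<open>
  On combinations of exponentials both sides have the transform \<open>\<Prod>(S f\<^sub>j)(\<alpha>\<^sub>j \<phi>)\<close>.
\<close>

theorem mixture_density_extends_wick: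
  assumes \<alpha>: "(\<Sum>j=1..n. (\<alpha> j)\<^sup>2) = 1"
  shows "gamma_wick_extension \<mu> \<iota> 1 n \<alpha> (mixture_density n \<alpha>)"
  unfolding gamma_wick_extension_def
proof (intro conjI allI impI)
  fix f :: "nat \<Rightarrow> 'w \<Rightarrow> real" assume "\<forall>j\<in>{1..n}. f j \<in> lp_space \<mu> 1"
  thus "mixture_density n \<alpha> f \<in> lp_space \<mu> 1"
    unfolding lp_space_1 by (intro mixture_density_integrable[OF \<alpha>]) blast
next
  fix f :: "nat \<Rightarrow> 'w \<Rightarrow> real" and i g a b
  assume "\<forall>j\<in>{1..n}. f j \<in> lp_space \<mu> 1" "i \<in> {1..n}" "g \<in> lp_space \<mu> 1"
  thus "AE w in \<mu>. mixture_density n \<alpha> (f(i := \<lambda>x. a * f i x + b * g x)) w =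
      a * mixture_density n \<alpha> f w + b * mixture_density n \<alpha> (f(i := g)) w"
    by (intro mixture_density_multilinear[OF \<alpha>]) (auto simp: lp_space_1)
next
  show "\<exists>C. \<forall>f. (\<forall>j\<in>{1..n}. f j \<in> lp_space \<mu> 1) \<longrightarrow>
      lp_norm \<mu> 1 (mixture_density n \<alpha> f) \<le> C * (\<Prod>j=1..n. lp_norm \<mu> 1 (f j))"
    unfolding lp_norm_1 lp_space_1
    by (intro exI[of _ 1] allI impI, unfold mult_1, rule mixture_density_L1_bound[OF \<alpha>]) blast
next
  fix f :: "nat \<Rightarrow> 'w \<Rightarrow> real" assume f: "\<forall>j\<in>{1..n}. f j \<in> fun_span (\<E>)"
  let ?W = "wick_prod \<mu> \<iota> (\<lambda>j. Gamma_op \<mu> \<iota> (\<alpha> j) (f j)) n"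
  have W: "exp_poly ?W \<and> (\<forall>\<phi>. s_transform ?W \<phi> = (\<Prod>j=1..n. s_transform (Gamma_op \<mu> \<iota> (\<alpha> j) (f j)) \<phi>))"
    by (rule wick_prod_exp_poly) (use f Gamma_op_span(1) in blast)
  have fe: "exp_integrable (f j)" if "j \<in> {1..n}" for j using f that span_stoch_exp_integrable(2) by blast
  show "AE w in \<mu>. mixture_density n \<alpha> f w = ?W w"
  proof (rule s_transform_inject)
    show "exp_integrable (mixture_density n \<alpha> f)" by (rule mixture_density_s_transform(1)[OF \<alpha> fe])
    show "exp_integrable ?W" using W exp_poly_exp_integrable by blast
    fix \<phi>
    have "s_transform (mixture_density n \<alpha> f) \<phi> = (\<Prod>j=1..n. s_transform (f j) (\<alpha> j *\<^sub>R \<phi>))"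
      by (rule mixture_density_s_transform(2)[OF \<alpha> fe])
    also have "\<dots> = (\<Prod>j=1..n. s_transform (Gamma_op \<mu> \<iota> (\<alpha> j) (f j)) \<phi>)"
      using f by (intro prod.cong refl Gamma_op_span(2)[symmetric]) auto
    finally show "s_transform (mixture_density n \<alpha> f) \<phi> = s_transform ?W \<phi>" using W by simp
  qed
qed

text \<open>
  The arguments are replaced by combinations of exponentials one after another: changing one
  argument by a function of small \<open>L\<^sup>1\<close> norm changes both values by little, by multilinearity and
  boundedness.
\<close>

theorem gamma_wick_extension_unique:
  assumes T: "gamma_wick_extension \<mu> \<iota> 1 n \<alpha> T" and U: "gamma_wick_extension \<mu> \<iota> 1 n \<alpha> U"
    and f: "\<And>j. j \<in> {1..n} \<Longrightarrow> integrable \<mu> (f j)"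
  shows "AE w in \<mu>. T f w = U f w"
proof -
  have "AE w in \<mu>. T f w = U f w"
    if "\<forall>j\<in>{1..n}. f j \<in> lp_space \<mu> 1" "\<forall>j\<in>{1..n}. k < j \<longrightarrow> f j \<in> fun_span (\<E>)" for k f
    using that
  proof (induct k arbitrary: f)
    case 0
    hence span: "\<forall>j\<in>{1..n}. f j \<in> fun_span (\<E>)" by auto
    have "AE w in \<mu>. T f w = wick_prod \<mu> \<iota> (\<lambda>j. Gamma_op \<mu> \<iota> (\<alpha> j) (f j)) n w"
      by (rule gamma_wick_extension_span[OF T]) (use span in blast)
    moreover have "AE w in \<mu>. U f w = wick_prod \<mu> \<iota> (\<lambda>j. Gamma_op \<mu> \<iota> (\<alpha> j) (f j)) n w"
      by (rule gamma_wick_extension_span[OF U]) (use span in blast)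
    ultimately show ?case by eventually_elim simp
  next
    case (Suc k)
    show ?case
    proof (cases "Suc k \<in> {1..n}")
      case False
      thus ?thesis using Suc by (intro Suc(1)) auto
    next
      case True
      define i where "i = Suc k"
      have i: "i \<in> {1..n}" using True by (simp add: i_def)
      \<comment> \<open>The norm of the arguments that stay fixed while the \<open>i\<close>-th is approximated.\<close>
      define B where "B = (\<Prod>j\<in>{1..n} - {i}. LINT w|\<mu>. \<bar>f j w\<bar>)"
      have B: "0 \<le> B" unfolding B_def by (intro prod_nonneg) auto
      obtain C where C: "\<And>f. (\<forall>j\<in>{1..n}. f j \<in> lp_space \<mu> 1) \<Longrightarrow> lp_norm \<mu> 1 (T f) \<le> C * (\<Prod>j=1..n. lp_norm \<mu> 1 (f j))"
        using gamma_wick_extension_bounded[OF T] by blast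
      obtain D where D: "\<And>f. (\<forall>j\<in>{1..n}. f j \<in> lp_space \<mu> 1) \<Longrightarrow> lp_norm \<mu> 1 (U f) \<le> D * (\<Prod>j=1..n. lp_norm \<mu> 1 (f j))"
        using gamma_wick_extension_bounded[OF U] by blast
      have intT: "integrable \<mu> (T h)" "integrable \<mu> (U h)" if "\<forall>j\<in>{1..n}. h j \<in> lp_space \<mu> 1" for h
        using gamma_wick_extension_maps[OF T] gamma_wick_extension_maps[OF U] that unfolding lp_space_1 by blast+
      have fi: "integrable \<mu> (f i)" using Suc(2) i by (simp add: lp_space_1)
      have bound: "(LINT w|\<mu>. \<bar>T f w - U f w\<bar>) \<le> (\<bar>C\<bar> + \<bar>D\<bar>) * B * e" if e: "0 < e" for e
      proof -
        obtain g where g: "g \<in> fun_span (\<E>)" "(LINT w|\<mu>. \<bar>f i w - g w\<bar>) < e"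
          by (rule span_stoch_exp_dense_L1[OF fi e])
        have gi: "g \<in> lp_space \<mu> 1" using span_stoch_exp_integrable(1)[OF g(1)] by (simp add: lp_space_1)
        let ?d = "\<lambda>x. 1 * f i x + (-1) * g x"
        have di: "?d \<in> lp_space \<mu> 1" using fi gi by (simp add: lp_space_1)
        define h where "h = f(i := ?d)"
        have dL: "\<forall>j\<in>{1..n}. h j \<in> lp_space \<mu> 1" using Suc(2) di by (simp add: h_def)
        have "AE w in \<mu>. T (f(i := g)) w = U (f(i := g)) w"
          by (rule Suc(1)) (use Suc(2,3) g gi in \<open>auto simp: i_def\<close>)
        moreover have "AE w in \<mu>. T h w = 1 * T f w + (-1) * T (f(i := g)) w"
          unfolding h_def by (rule gamma_wick_extension_linear[OF T _ i gi]) (use Suc(2) in blast)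
        moreover have "AE w in \<mu>. U h w = 1 * U f w + (-1) * U (f(i := g)) w"
          unfolding h_def by (rule gamma_wick_extension_linear[OF U _ i gi]) (use Suc(2) in blast)
        ultimately have ae: "AE w in \<mu>. \<bar>T f w - U f w\<bar> = \<bar>T h w - U h w\<bar>"
          by eventually_elim simp
        have norm: "(\<Prod>j=1..n. lp_norm \<mu> 1 (h j)) = (LINT w|\<mu>. \<bar>f i w - g w\<bar>) * B"
          by (subst prod.remove[OF _ i]) (auto simp: B_def h_def lp_norm_1 intro!: prod.cong)
        have le: "c * ((LINT w|\<mu>. \<bar>f i w - g w\<bar>) * B) \<le> \<bar>c\<bar> * (e * B)" for c
          using g(2) B by (intro mult_mono mult_right_mono) auto
        have "(LINT w|\<mu>. \<bar>T f w - U f w\<bar>) = (LINT w|\<mu>. \<bar>T h w - U h w\<bar>)"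
          by (intro integral_cong_AE ae borel_measurable_abs borel_measurable_diff borel_measurable_integrable
              intT[OF Suc(2)] intT[OF dL])
        also have "\<dots> \<le> (LINT w|\<mu>. \<bar>T h w\<bar> + \<bar>U h w\<bar>)"
          using intT[OF dL] by (intro integral_mono) auto
        also have "\<dots> = lp_norm \<mu> 1 (T h) + lp_norm \<mu> 1 (U h)"
          using intT[OF dL] by (simp add: lp_norm_1)
        also have "\<dots> \<le> \<bar>C\<bar> * (e * B) + \<bar>D\<bar> * (e * B)"
          using C[OF dL] D[OF dL] le[of C] le[of D] unfolding norm by linarith
        finally show ?thesis by (simp add: algebra_simps)
      qed
      have "(LINT w|\<mu>. \<bar>T f w - U f w\<bar>) \<le> 0"
      proof (rule field_le_epsilon)
        fix e :: real assume e: "0 < e"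
        let ?c = "(\<bar>C\<bar> + \<bar>D\<bar>) * B"
        have c: "0 \<le> ?c" using B by simp
        have "(LINT w|\<mu>. \<bar>T f w - U f w\<bar>) \<le> ?c * (e / (?c + 1))"
          using e c by (intro bound) auto
        also have "\<dots> \<le> e" using e c by (simp add: field_simps)
        finally show "(LINT w|\<mu>. \<bar>T f w - U f w\<bar>) \<le> 0 + e" by simp
      qed
      moreover have i2: "integrable \<mu> (\<lambda>w. \<bar>T f w - U f w\<bar>)" using intT[OF Suc(2)] by auto
      moreover have "0 \<le> (LINT w|\<mu>. \<bar>T f w - U f w\<bar>)" by simp
      ultimately have "AE w in \<mu>. \<bar>T f w - U f w\<bar> = 0"
        using integral_nonneg_eq_0_iff_AE[OF i2] by simp
      thus ?thesis by eventually_elim simp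
    qed
  qed
  from this[of f n] show ?thesis using f by (simp add: lp_space_1)
qed

lemma gamma_wick_eq_mixture_density:
  assumes \<alpha>: "(\<Sum>j=1..n. (\<alpha> j)\<^sup>2) = 1" and f: "\<And>j. j \<in> {1..n} \<Longrightarrow> integrable \<mu> (f j)"
  shows "gamma_wick \<mu> \<iota> 1 n \<alpha> f \<in> borel_measurable \<mu>"
    and "AE w in \<mu>. gamma_wick \<mu> \<iota> 1 n \<alpha> f w = mixture_density n \<alpha> f w"
proof -
  let ?G = "gamma_wick \<mu> \<iota> 1 n \<alpha> f"
  have G: "gamma_wick_extension \<mu> \<iota> 1 n \<alpha> (gamma_wick \<mu> \<iota> 1 n \<alpha>)"
    unfolding gamma_wick_def by (rule someI[where P = "gamma_wick_extension \<mu> \<iota> 1 n \<alpha>"])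
      (rule mixture_density_extends_wick[OF \<alpha>])
  have "?G \<in> lp_space \<mu> 1"
    by (rule gamma_wick_extension_maps[OF G]) (use f in \<open>simp add: lp_space_1\<close>)
  thus "?G \<in> borel_measurable \<mu>" by (auto simp: lp_space_1)
  show "AE w in \<mu>. ?G w = mixture_density n \<alpha> f w"
    by (rule gamma_wick_extension_unique[OF G mixture_density_extends_wick[OF \<alpha>] f])
qed

text \<open>
  Stated for extended nonnegative densities, so that boxes can be evaluated factor by factor without
  integrability conditions.
\<close>

lemma joint_law_density:
  assumes P: "prob_space P" and n: "{1..n} \<noteq> {}"
    and indep: "prob_space.indep_vars P (\<lambda>_. borel) X {1..n}"
    and f: "\<And>j. j \<in> {1..n} \<Longrightarrow> f j \<in> borel_measurable \<mu>"
    and law: "\<And>j. j \<in> {1..n} \<Longrightarrow> distr P borel (X j) = density \<mu> (f j)"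
  shows "distr P (copies n) (\<lambda>\<omega>. \<lambda>j\<in>{1..n}. X j \<omega>) = density (copies n) (\<lambda>x. \<Prod>j=1..n. f j (x j))"
proof -
  interpret P: prob_space P by fact
  interpret product_sigma_finite "\<lambda>_::nat. \<mu>" by (rule product_sigma_finite_copies)
  have X: "X j \<in> measurable P borel" if "j \<in> {1..n}" for j
    using indep that unfolding P.indep_vars_def by auto
  \<comment> \<open>Extended by \<open>\<mu>\<close> outside \<open>{1..n}\<close>, since all members of a product family must be \<open>\<sigma>\<close>-finite.\<close>
  define N where "N j = (if j \<in> {1..n} then density \<mu> (f j) else \<mu>)" for j
  have N: "prob_space (N j)" for j
    using P.prob_space_distr[OF X] law prob_space_axioms by (auto simp: N_def)
  interpret N: product_sigma_finite N
    by (rule product_sigma_finite.intro) (use N prob_space_imp_sigma_finite in blast)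
  have sets: "sets (copies n) = sets (Pi\<^sub>M {1..n} (\<lambda>_. borel))"
    by (rule sets_PiM_cong) (auto simp: sets_eq_borel)
  have "distr P (copies n) (\<lambda>\<omega>. \<lambda>j\<in>{1..n}. X j \<omega>) = distr P (Pi\<^sub>M {1..n} (\<lambda>_. borel)) (\<lambda>\<omega>. \<lambda>j\<in>{1..n}. X j \<omega>)"
    by (rule distr_cong) (simp_all add: sets)
  also have "\<dots> = Pi\<^sub>M {1..n} (\<lambda>j. distr P borel (X j))"
    using P.indep_vars_iff_distr_eq_PiM'[where X = X and M' = "\<lambda>_. borel", OF n X] indep by blast
  also have "\<dots> = Pi\<^sub>M {1..n} N" by (rule PiM_cong) (auto simp: law N_def)
  also have "\<dots> = density (copies n) (\<lambda>x. \<Prod>j=1..n. f j (x j))"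
  proof (rule N.PiM_eqI[symmetric])
    show "sets (density (copies n) (\<lambda>x. \<Prod>j=1..n. f j (x j))) = sets (Pi\<^sub>M {1..n} N)"
      unfolding sets_density by (rule sets_PiM_cong) (auto simp: N_def)
    fix A assume A: "\<And>j. j \<in> {1..n} \<Longrightarrow> A j \<in> sets (N j)"
    hence A': "A j \<in> sets \<mu>" if "j \<in> {1..n}" for j using that by (simp add: N_def)
    have "emeasure (density (copies n) (\<lambda>x. \<Prod>j=1..n. f j (x j))) (Pi\<^sub>E {1..n} A)
        = (\<integral>\<^sup>+x. (\<Prod>j=1..n. f j (x j)) * indicator (Pi\<^sub>E {1..n} A) x \<partial>copies n)"
    proof (rule emeasure_density)
      show "Pi\<^sub>E {1..n} A \<in> sets (copies n)" using A' by (intro sets_PiM_I_finite) auto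
      show "(\<lambda>x. \<Prod>j=1..n. f j (x j)) \<in> borel_measurable (copies n)"
      proof (rule borel_measurable_prod_ennreal)
        fix j assume j: "j \<in> {1..n}"
        show "(\<lambda>x. f j (x j)) \<in> borel_measurable (copies n)"
          by (rule measurable_compose[OF measurable_component_singleton[OF j] f[OF j]])
      qed
    qed
    also have "\<dots> = (\<integral>\<^sup>+x. (\<Prod>j=1..n. f j (x j) * indicator (A j) (x j)) \<partial>copies n)"
    proof (rule nn_integral_cong)
      fix x assume "x \<in> space (copies n)"
      hence "x \<in> extensional {1..n}" by (auto simp: space_PiM PiE_def)
      hence "indicator (Pi\<^sub>E {1..n} A) x = (\<Prod>j=1..n. indicator (A j) (x j) :: ennreal)"
        by (auto simp: indicator_def PiE_def Pi_def prod_eq_1_iff intro!: prod_zero)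
      thus "(\<Prod>j=1..n. f j (x j)) * indicator (Pi\<^sub>E {1..n} A) x = (\<Prod>j=1..n. f j (x j) * indicator (A j) (x j))"
        by (simp add: prod.distrib)
    qed
    also have "\<dots> = (\<Prod>j=1..n. \<integral>\<^sup>+w. f j w * indicator (A j) w \<partial>\<mu>)"
      using f A' by (intro product_nn_integral_prod) auto
    also have "\<dots> = (\<Prod>j=1..n. emeasure (N j) (A j))"
      using f A' by (intro prod.cong) (auto simp: N_def emeasure_density)
    finally show "emeasure (density (copies n) (\<lambda>x. \<Prod>j=1..n. f j (x j))) (Pi\<^sub>E {1..n} A) = (\<Prod>j=1..n. emeasure (N j) (A j))" .
  qed simp
  finally show ?thesis .
qed

text \<open>
  The joint law of the \<open>X\<^sub>j\<close> is mapped by \<open>mixture\<close> to the law of the linear combination, and its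
  density to \<open>mixture_density\<close>.
\<close>

theorem mixture_has_density_gamma_wick:
  assumes P: "prob_space P" and n: "{1..n} \<noteq> {}"
    and indep: "prob_space.indep_vars P (\<lambda>_. borel) X {1..n}"
    and f: "\<And>j. j \<in> {1..n} \<Longrightarrow> has_real_density P \<mu> (X j) (f j)"
    and \<alpha>: "(\<Sum>j=1..n. (\<alpha> j)\<^sup>2) = 1"
  shows "has_real_density P \<mu> (\<lambda>\<omega>. \<Sum>j=1..n. \<alpha> j *\<^sub>R X j \<omega>) (gamma_wick \<mu> \<iota> 1 n \<alpha> f)"
proof -
  interpret P: prob_space P by fact
  let ?F = "\<lambda>x. \<Prod>j=1..n. f j (x j)" and ?X = "\<lambda>\<omega>. \<lambda>j\<in>{1..n}. X j \<omega>"
    and ?Y = "\<lambda>\<omega>. \<Sum>j=1..n. \<alpha> j *\<^sub>R X j \<omega>" and ?G = "gamma_wick \<mu> \<iota> 1 n \<alpha> f"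
  have fm: "f j \<in> borel_measurable \<mu>" and fpos: "AE w in \<mu>. 0 \<le> f j w"
    and fd: "distributed P \<mu> (X j) (\<lambda>w. ennreal (f j w))" if "j \<in> {1..n}" for j
    using f[OF that] by (auto simp: has_real_density_def)
  have law: "distr P borel (X j) = density \<mu> (\<lambda>w. ennreal (f j w))" if "j \<in> {1..n}" for j
  proof -
    have "distr P borel (X j) = distr P \<mu> (X j)" by (rule distr_cong) (simp_all add: sets_eq_borel)
    thus ?thesis using distributed_distr_eq_density[OF fd[OF that]] by simp
  qed
  have fi: "integrable \<mu> (f j)" if j: "j \<in> {1..n}" for j
  proof (rule integrableI_nonneg[OF fm[OF j] fpos[OF j]])
    interpret D: prob_space "density \<mu> (\<lambda>w. ennreal (f j w))"
      using P.prob_space_distr[OF distributed_measurable[OF fd[OF j]]] distributed_distr_eq_density[OF fd[OF j]] by simp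
    have "(\<integral>\<^sup>+w. ennreal (f j w) \<partial>\<mu>) = emeasure (density \<mu> (\<lambda>w. ennreal (f j w))) (space \<mu>)"
      using fm[OF j] by (subst emeasure_density) (auto intro!: nn_integral_cong)
    thus "(\<integral>\<^sup>+w. ennreal (f j w) \<partial>\<mu>) < \<infinity>" using D.emeasure_space_1 by simp
  qed
  have pos: "AE x in copies n. \<forall>j\<in>{1..n}. 0 \<le> f j (x j)"
    by (intro AE_finite_allI AE_PiM_component prob_space_axioms fpos) auto
  hence Fpos: "AE x in copies n. 0 \<le> ?F x" by eventually_elim (auto intro: prod_nonneg)
  have Fi: "integrable (copies n) ?F" by (rule product_density_integrable(1)[where f = f, OF fi])
  have G: "?G \<in> borel_measurable \<mu>"
    "AE w in \<mu>. ?G w = mixture_density n \<alpha> f w"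
    by (rule gamma_wick_eq_mixture_density[OF \<alpha>], rule fi, assumption)+
  note push = image_density.push_density_nonneg[OF image_density_mixture[OF \<alpha>] Fi Fpos,
      folded mixture_density_def]
  have Xm: "?X \<in> measurable P (copies n)"
    by (rule measurable_restrict) (use distributed_measurable[OF fd] in auto)
  have mix: "mixture n \<alpha> (?X \<omega>) = (\<Sum>j=1..n. \<alpha> j *\<^sub>R X j \<omega>)" for \<omega>
    by (simp add: mixture_def)
  have dF: "density (copies n) (\<lambda>x. \<Prod>j=1..n. ennreal (f j (x j))) = density (copies n) (\<lambda>x. ennreal (?F x))"
  proof (rule density_cong)
    show "(\<lambda>x. \<Prod>j=1..n. ennreal (f j (x j))) \<in> borel_measurable (copies n)"
    proof (rule borel_measurable_prod_ennreal)
      fix j assume j: "j \<in> {1..n}"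
      from measurable_compose[OF measurable_component_singleton[OF j] fm[OF j]]
      show "(\<lambda>x. ennreal (f j (x j))) \<in> borel_measurable (copies n)" by simp
    qed
    show "(\<lambda>x. ennreal (?F x)) \<in> borel_measurable (copies n)" using Fi by auto
    show "AE x in copies n. (\<Prod>j=1..n. ennreal (f j (x j))) = ennreal (?F x)"
      using pos by eventually_elim (auto intro!: prod_ennreal)
  qed
  have "distr P \<mu> ?Y = distr (distr P (copies n) ?X) \<mu> (mixture n \<alpha>)"
    using distr_distr[OF mixture_measurable Xm] by (simp add: comp_def mix)
  also have "distr P (copies n) ?X = density (copies n) (\<lambda>x. ennreal (?F x))"
    unfolding dF[symmetric] by (rule joint_law_density[OF P n indep _ law]) (use fm in auto)
  also have "distr (density (copies n) (\<lambda>x. ennreal (?F x))) \<mu> (mixture n \<alpha>) = density \<mu> (\<lambda>w. ennreal (mixture_density n \<alpha> f w))"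
    by (rule push(2)[symmetric])
  also have "density \<mu> (\<lambda>w. ennreal (mixture_density n \<alpha> f w)) = density \<mu> (\<lambda>w. ennreal (?G w))"
  proof (rule density_cong)
    show "AE w in \<mu>. ennreal (mixture_density n \<alpha> f w) = ennreal (?G w)"
      using G(2) by eventually_elim simp
  qed (use G(1) mixture_density_integrable[where f = f, OF \<alpha> fi] in auto)
  finally have "distr P \<mu> ?Y = density \<mu> (\<lambda>w. ennreal (?G w))" .
  moreover have "?Y \<in> measurable P \<mu>"
    using measurable_compose[OF Xm mixture_measurable[of n \<alpha>]] by (simp add: mix)
  moreover have "AE w in \<mu>. 0 \<le> ?G w"
    using G(2) push(1) by eventually_elim simp
  ultimately show ?thesis
    using G(1) by (simp add: has_real_density_def distributed_def)
qed

end

theorem proposition3p1: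
  fixes \<mu> :: "'w::{banach, second_countable_topology} measure"
    and \<iota> :: "'h::{real_inner, complete_space, second_countable_topology} \<Rightarrow> 'w"
    and P :: "'o measure"
    and X :: "nat \<Rightarrow> 'o \<Rightarrow> 'w"
    and f :: "nat \<Rightarrow> 'w \<Rightarrow> real"
    and \<alpha> :: "nat \<Rightarrow> real"
    and n :: nat
  assumes "abstract_wiener_space \<mu> \<iota>"
    and "prob_space P"
    and "prob_space.indep_vars P (\<lambda>_. borel) X {1..n}"
    and "\<And>j. j \<in> {1..n} \<Longrightarrow> absolutely_continuous \<mu> (distr P borel (X j))"
    and "\<And>j. j \<in> {1..n} \<Longrightarrow> has_real_density P \<mu> (X j) (f j)"
    and "\<And>j. j \<in> {1..n} \<Longrightarrow> \<alpha> j \<in> {-1..1}"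
    and "(\<Sum>j=1..n. (\<alpha> j)\<^sup>2) = 1"
  shows "absolutely_continuous \<mu> (distr P borel (\<lambda>\<omega>. \<Sum>j=1..n. \<alpha> j *\<^sub>R X j \<omega>)) \<and>
         has_real_density P \<mu> (\<lambda>\<omega>. \<Sum>j=1..n. \<alpha> j *\<^sub>R X j \<omega>) (gamma_wick \<mu> \<iota> 1 n \<alpha> f)"
proof
  interpret abstract_wiener_space \<mu> \<iota> by fact
  have "{1..n} \<noteq> {}" using assms(7) by (cases "n = 0") auto
  from mixture_has_density_gamma_wick[OF assms(2) this assms(3,5,7)]
  show density: "has_real_density P \<mu> (\<lambda>\<omega>. \<Sum>j=1..n. \<alpha> j *\<^sub>R X j \<omega>) (gamma_wick \<mu> \<iota> 1 n \<alpha> f)" .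
  have "distr P borel (\<lambda>\<omega>. \<Sum>j=1..n. \<alpha> j *\<^sub>R X j \<omega>) = distr P \<mu> (\<lambda>\<omega>. \<Sum>j=1..n. \<alpha> j *\<^sub>R X j \<omega>)"
    by (rule distr_cong) (simp_all add: sets_eq_borel)
  also have "\<dots> = density \<mu> (\<lambda>w. ennreal (gamma_wick \<mu> \<iota> 1 n \<alpha> f w))"
    using density by (auto simp: has_real_density_def intro: distributed_distr_eq_density)
  finally show "absolutely_continuous \<mu> (distr P borel (\<lambda>\<omega>. \<Sum>j=1..n. \<alpha> j *\<^sub>R X j \<omega>))"
    using density absolutely_continuousI_density[of "\<lambda>w. ennreal (gamma_wick \<mu> \<iota> 1 n \<alpha> f w)" \<mu>]
    by (auto simp: has_real_density_def)
qed

end
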